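(* Let $$(M,g)=\left(\mathbb{R}^2\times X,\; H_{x_u}\,\mathrm{d}x_u\otimes\mathrm{d}x_u+\mathrm{d}x_u\odot\alpha_{x_u}+\mathrm{d}x_u\odot\mathrm{d}x_v+q_{x_u}\right)$$ be a standard Brinkmann space-time. Then $(M,g)$ admits an adapted parallel spinor if and only if there exists a family $\{\ell_{x_u},n_{x_u}\}_{x_u\in\mathbb{R}}$ of one-forms on $X$ such that, for every $x_u\in\mathbb{R}$, $(\ell_{x_u},n_{x_u})$ is a parallel orthonormal coframe on $(X,q_{x_u})$ and $$\mathrm{d}_X\alpha_{x_u}=\partial_{x_u}n_{x_u}\wedge n_{x_u}+\partial_{x_u}\ell_{x_u}\wedge\ell_{x_u}.$$ In particular, in this case $\{q_{x_u}\}_{x_u\in\mathbb{R}}$ is a family of complete flat metrics on $X$.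
   Context: All objects and families are smooth. $\alpha\odot\beta:=\alpha\otimes\beta+\beta\otimes\alpha$. $\mathrm{d}_X$ is the exterior derivative on $X$. "Parallel" for the coframe means parallel with respect to the Levi-Civita connection of $q_{x_u}$ on $X$. A standard Brinkmann space-time is $M=\mathbb{R}^2\times X$, with $X$ a connected oriented two-manifold and $(x_u,x_v)$ Cartesian coordinates on $\mathbb{R}^2$, equipped with the displayed Lorentzian metric, where $\{H_{x_u}\}$, $\{\alpha_{x_u}\}$ and $\{q_{x_u}\}$ are respectively families of functions, one-forms and complete Riemannian metrics on $X$, parametrized by $x_u\in\mathbb{R}$ (independent of $x_v$). The vector field $\partial_{x_v}$ is null and parallel, with metric dual $\mathrm{d}x_u$. A parallel spinor is a (not identically zero) section $\varepsilon$ of a bundle of irreducible real spinors (associated to a spin structure on $(M,g)$ via the irreducible real representation of $\mathrm{Cl}(3,1)$ restricted to $\mathrm{Spin}_+(3,1)$) with $\nabla^g\varepsilon=0$; "admits" means for some spin structure. A parallel spinor determines a null parallel vector field, its Dirac current, obtained as a quadratic expression in $\varepsilon$; up to constant normalization it is the null vector field annihilating $\varepsilon$ under Clifford multiplication. The spinor is adapted if its Dirac current is $\partial_{x_v}$. Equivalently (by a known correspondence), $(M,g)$ admits an adapted parallel spinor if and only if there is a one-form $l$ on $M$ with $g(l,\mathrm{d}x_u)=0$, $g(l,l)=1$ and $\nabla^gl=\kappa\otimes\mathrm{d}x_u$ for some one-form $\kappa$ on $M$. *)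

theory Defs
  imports "HOL-Analysis.Analysis"
begin

section \<open>Smooth maps between open subsets of normed spaces\<close>

primrec Ck_on :: "nat \<Rightarrow> 'a set \<Rightarrow> ('a::real_normed_vector \<Rightarrow> 'b::real_normed_vector) \<Rightarrow> bool" where
  "Ck_on 0 S f \<longleftrightarrow> continuous_on S f"
| "Ck_on (Suc k) S f \<longleftrightarrow>
     (\<forall>y\<in>S. f differentiable at y) \<and> (\<forall>v. Ck_on k S (\<lambda>y. frechet_derivative f (at y) v))"

text \<open>Used for open \<open>S\<close> in finite-dimensional spaces only, where this is the usual notion.\<close>

definition smooth_map_on :: "'a set \<Rightarrow> ('a::real_normed_vector \<Rightarrow> 'b::real_normed_vector) \<Rightarrow> bool" where
  "smooth_map_on S f \<longleftrightarrow> (\<forall>k. Ck_on k S f)"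


section \<open>Manifolds and tensor fields in local charts\<close>

text \<open>
  The underlying space of a manifold is a whole topological type \<open>'x\<close>; an atlas is a family of
  charts indexed by a type \<open>'i\<close>, with values in a model vector space \<open>'e\<close>. Tangent vectors,
  forms and metrics at a point \<open>x\<close> are given by their components with respect to every chart
  \<open>i\<close> around \<open>x\<close>, related by the Jacobians of the coordinate changes.
  Values with respect to chart \<open>i\<close> at points outside the domain of \<open>i\<close> are meaningless and never used.
\<close>

record ('i, 'x, 'e) atlas =
  chart_dom :: "'i \<Rightarrow> 'x set"
  chart_map :: "'i \<Rightarrow> 'x \<Rightarrow> 'e"

type_synonym ('i, 'x, 'e) vec_field = "'i \<Rightarrow> 'x \<Rightarrow> 'e"
type_synonym ('i, 'x, 'e) one_form = "'i \<Rightarrow> 'x \<Rightarrow> 'e \<Rightarrow> real"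
type_synonym ('i, 'x, 'e) two_tensor = "'i \<Rightarrow> 'x \<Rightarrow> 'e \<Rightarrow> 'e \<Rightarrow> real"

definition chart_inv :: "('i, 'x, 'e) atlas \<Rightarrow> 'i \<Rightarrow> 'e \<Rightarrow> 'x" where
  "chart_inv A i = inv_into (chart_dom A i) (chart_map A i)"

definition transition :: "('i, 'x, 'e) atlas \<Rightarrow> 'i \<Rightarrow> 'i \<Rightarrow> 'e \<Rightarrow> 'e" where
  "transition A i j y = chart_map A j (chart_inv A i y)"

definition smooth_atlas ::
  "('i, 'x::topological_space, 'e::real_normed_vector) atlas \<Rightarrow> bool" where
  "smooth_atlas A \<longleftrightarrow>
     (\<Union>i. chart_dom A i) = UNIV \<and>
     (\<forall>i. open (chart_dom A i) \<and> open (chart_map A i ` chart_dom A i) \<and>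
          homeomorphism (chart_dom A i) (chart_map A i ` chart_dom A i) (chart_map A i) (chart_inv A i)) \<and>
     (\<forall>i j. smooth_map_on (chart_map A i ` (chart_dom A i \<inter> chart_dom A j)) (transition A i j))"

text \<open>\<open>chart_D A i F x v\<close>: derivative at \<open>x\<close> of \<open>F\<close>, read in chart \<open>i\<close>, in the coordinate direction \<open>v\<close>.\<close>

definition chart_D :: "('i, 'x, 'e::real_normed_vector) atlas \<Rightarrow> 'i \<Rightarrow> ('x \<Rightarrow> 'b::real_normed_vector)
    \<Rightarrow> 'x \<Rightarrow> 'e \<Rightarrow> 'b" where
  "chart_D A i F x v = frechet_derivative (\<lambda>y. F (chart_inv A i y)) (at (chart_map A i x)) v"

definition jac :: "('i, 'x, 'e::real_normed_vector) atlas \<Rightarrow> 'i \<Rightarrow> 'i \<Rightarrow> 'x \<Rightarrow> 'e \<Rightarrow> 'e" where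
  "jac A i j x v = chart_D A i (chart_map A j) x v"

definition oriented_atlas :: "('i, 'x, real^'n) atlas \<Rightarrow> bool" where
  "oriented_atlas A \<longleftrightarrow>
     (\<forall>i j. \<forall>x \<in> chart_dom A i \<inter> chart_dom A j. det (matrix (jac A i j x)) > 0)"

definition smooth_fun_on :: "('i, 'x, 'e::real_normed_vector) atlas \<Rightarrow> 'x set
    \<Rightarrow> ('x \<Rightarrow> 'b::real_normed_vector) \<Rightarrow> bool" where
  "smooth_fun_on A U F \<longleftrightarrow>
     (\<forall>i. smooth_map_on (chart_map A i ` (chart_dom A i \<inter> U)) (\<lambda>y. F (chart_inv A i y)))"

definition smooth_vec_field_on :: "('i, 'x, 'e::real_normed_vector) atlas \<Rightarrow> 'x set
    \<Rightarrow> ('i, 'x, 'e) vec_field \<Rightarrow> bool" where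
  "smooth_vec_field_on A U Y \<longleftrightarrow>
     (\<forall>i j. \<forall>x \<in> U \<inter> chart_dom A i \<inter> chart_dom A j. Y j x = jac A i j x (Y i x)) \<and>
     (\<forall>i. smooth_map_on (chart_map A i ` (chart_dom A i \<inter> U)) (\<lambda>y. Y i (chart_inv A i y)))"

definition is_one_form ::
  "('i, 'x, 'e::real_normed_vector) atlas \<Rightarrow> ('i, 'x, 'e) one_form \<Rightarrow> bool" where
  "is_one_form A \<omega> \<longleftrightarrow>
     (\<forall>i. \<forall>x \<in> chart_dom A i. linear (\<omega> i x)) \<and>
     (\<forall>i j. \<forall>x \<in> chart_dom A i \<inter> chart_dom A j. \<forall>v. \<omega> i x v = \<omega> j x (jac A i j x v))"

definition is_riemannian ::
  "('i, 'x, 'e::real_normed_vector) atlas \<Rightarrow> ('i, 'x, 'e) two_tensor \<Rightarrow> bool" where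
  "is_riemannian A q \<longleftrightarrow>
     (\<forall>i. \<forall>x \<in> chart_dom A i. bilinear (q i x) \<and> (\<forall>v w. q i x v w = q i x w v) \<and>
        (\<forall>v. v \<noteq> 0 \<longrightarrow> q i x v v > 0)) \<and>
     (\<forall>i j. \<forall>x \<in> chart_dom A i \<inter> chart_dom A j. \<forall>v w.
        q i x v w = q j x (jac A i j x v) (jac A i j x w))"


text \<open>Families parametrized by a real number are smooth jointly in the parameter and the point;
  in particular each member is smooth.\<close>

definition smooth_fun_family ::
  "('i, 'x, 'e::real_normed_vector) atlas \<Rightarrow> (real \<Rightarrow> 'x \<Rightarrow> real) \<Rightarrow> bool" where
  "smooth_fun_family A F \<longleftrightarrow>
     (\<forall>i. smooth_map_on (UNIV \<times> chart_map A i ` chart_dom A i) (\<lambda>(t, y). F t (chart_inv A i y)))"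

definition smooth_form_family ::
  "('i, 'x, 'e::real_normed_vector) atlas \<Rightarrow> (real \<Rightarrow> ('i, 'x, 'e) one_form) \<Rightarrow> bool" where
  "smooth_form_family A \<omega> \<longleftrightarrow>
     (\<forall>t. is_one_form A (\<omega> t)) \<and>
     (\<forall>i v. smooth_map_on (UNIV \<times> chart_map A i ` chart_dom A i)
              (\<lambda>(t, y). \<omega> t i (chart_inv A i y) v))"

definition smooth_riemannian_family ::
  "('i, 'x, 'e::real_normed_vector) atlas \<Rightarrow> (real \<Rightarrow> ('i, 'x, 'e) two_tensor) \<Rightarrow> bool" where
  "smooth_riemannian_family A q \<longleftrightarrow>
     (\<forall>t. is_riemannian A (q t)) \<and>
     (\<forall>i v w. smooth_map_on (UNIV \<times> chart_map A i ` chart_dom A i)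
                (\<lambda>(t, y). q t i (chart_inv A i y) v w))"

definition dt_form :: "(real \<Rightarrow> ('i, 'x, 'e) one_form) \<Rightarrow> real \<Rightarrow> ('i, 'x, 'e) one_form" where
  "dt_form \<omega> t = (\<lambda>i x v. deriv (\<lambda>s. \<omega> s i x v) t)"

definition ext_deriv ::
  "('i, 'x, 'e::real_normed_vector) atlas \<Rightarrow> ('i, 'x, 'e) one_form \<Rightarrow> ('i, 'x, 'e) two_tensor" where
  "ext_deriv A \<omega> = (\<lambda>i x v w. chart_D A i (\<lambda>z. \<omega> i z w) x v - chart_D A i (\<lambda>z. \<omega> i z v) x w)"

definition wedge :: "('i, 'x, 'e) one_form \<Rightarrow> ('i, 'x, 'e) one_form \<Rightarrow> ('i, 'x, 'e) two_tensor" where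
  "wedge \<omega> \<eta> = (\<lambda>i x v w. \<omega> i x v * \<eta> i x w - \<omega> i x w * \<eta> i x v)"


section \<open>Levi-Civita connection\<close>

text \<open>The Christoffel symbols of a nondegenerate metric, as a bilinear map
  \<open>\<Gamma>(v, w) = v\<^sup>b w\<^sup>c \<Gamma>\<^sup>a\<^sub>b\<^sub>c \<partial>\<^sub>a\<close>, from the Koszul formula for constant coordinate vectors.\<close>

definition christoffel :: "('i, 'x, 'e::real_normed_vector) atlas \<Rightarrow> ('i, 'x, 'e) two_tensor
    \<Rightarrow> 'i \<Rightarrow> 'x \<Rightarrow> 'e \<Rightarrow> 'e \<Rightarrow> 'e" where
  "christoffel A g i x v w = (THE z. \<forall>a. g i x z a =
     (chart_D A i (\<lambda>p. g i p w a) x v + chart_D A i (\<lambda>p. g i p v a) x w - chart_D A i (\<lambda>p. g i p v w) x a) / 2)"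

definition nabla_vec :: "('i, 'x, 'e::real_normed_vector) atlas \<Rightarrow> ('i, 'x, 'e) two_tensor
    \<Rightarrow> ('i, 'x, 'e) vec_field \<Rightarrow> 'i \<Rightarrow> 'x \<Rightarrow> 'e \<Rightarrow> 'e" where
  "nabla_vec A g Y i x v = chart_D A i (Y i) x v + christoffel A g i x v (Y i x)"

definition nabla_form :: "('i, 'x, 'e::real_normed_vector) atlas \<Rightarrow> ('i, 'x, 'e) two_tensor
    \<Rightarrow> ('i, 'x, 'e) one_form \<Rightarrow> ('i, 'x, 'e) two_tensor" where
  "nabla_form A g \<omega> = (\<lambda>i x v w. chart_D A i (\<lambda>z. \<omega> i z w) x v - \<omega> i x (christoffel A g i x v w))"

definition parallel_form :: "('i, 'x, 'e::real_normed_vector) atlas \<Rightarrow> ('i, 'x, 'e) two_tensor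
    \<Rightarrow> ('i, 'x, 'e) one_form \<Rightarrow> bool" where
  "parallel_form A g \<omega> \<longleftrightarrow> (\<forall>i. \<forall>x \<in> chart_dom A i. \<forall>v w. nabla_form A g \<omega> i x v w = 0)"

text \<open>\<open>curvature A g i x u v w\<close> is \<open>R(u, v) w\<close>.\<close>

definition curvature :: "('i, 'x, 'e::real_normed_vector) atlas \<Rightarrow> ('i, 'x, 'e) two_tensor
    \<Rightarrow> 'i \<Rightarrow> 'x \<Rightarrow> 'e \<Rightarrow> 'e \<Rightarrow> 'e \<Rightarrow> 'e" where
  "curvature A g i x u v w =
     chart_D A i (\<lambda>p. christoffel A g i p v w) x u - chart_D A i (\<lambda>p. christoffel A g i p u w) x v
     + christoffel A g i x u (christoffel A g i x v w)
     - christoffel A g i x v (christoffel A g i x u w)"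

definition flat_metric ::
  "('i, 'x, 'e::real_normed_vector) atlas \<Rightarrow> ('i, 'x, 'e) two_tensor \<Rightarrow> bool" where
  "flat_metric A g \<longleftrightarrow> (\<forall>i. \<forall>x \<in> chart_dom A i. \<forall>u v w. curvature A g i x u v w = 0)"

definition geodesic :: "('i, 'x::topological_space, 'e::real_normed_vector) atlas
    \<Rightarrow> ('i, 'x, 'e) two_tensor \<Rightarrow> (real \<Rightarrow> 'x) \<Rightarrow> bool" where
  "geodesic A g \<gamma> \<longleftrightarrow> continuous_on UNIV \<gamma> \<and>
     (\<forall>i s. \<gamma> s \<in> chart_dom A i \<longrightarrow>
        (let c = (\<lambda>r. chart_map A i (\<gamma> r)); c' = (\<lambda>r. vector_derivative c (at r)) in
           (c has_vector_derivative c' s) (at s) \<and>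
           (c' has_vector_derivative - christoffel A g i (\<gamma> s) (c' s) (c' s)) (at s)))"

text \<open>Geodesic completeness; for connected manifolds this is completeness of the Riemannian
  distance, by Hopf--Rinow.\<close>

definition complete_metric :: "('i, 'x::topological_space, 'e::real_normed_vector) atlas
    \<Rightarrow> ('i, 'x, 'e) two_tensor \<Rightarrow> bool" where
  "complete_metric A g \<longleftrightarrow> (\<forall>i. \<forall>x \<in> chart_dom A i. \<forall>v. \<exists>\<gamma>. geodesic A g \<gamma> \<and> \<gamma> 0 = x \<and>
     ((\<lambda>r. chart_map A i (\<gamma> r)) has_vector_derivative v) (at 0))"

definition sharp :: "('i, 'x, 'e) two_tensor \<Rightarrow> ('i, 'x, 'e) one_form \<Rightarrow> ('i, 'x, 'e) vec_field" where
  "sharp g \<omega> i x = (THE z. \<forall>w. g i x z w = \<omega> i x w)"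

definition cometric :: "('i, 'x, 'e) two_tensor \<Rightarrow> ('i, 'x, 'e) one_form \<Rightarrow> ('i, 'x, 'e) one_form
    \<Rightarrow> 'i \<Rightarrow> 'x \<Rightarrow> real" where
  "cometric g \<omega> \<eta> i x = g i x (sharp g \<omega> i x) (sharp g \<eta> i x)"

text \<open>An orthonormal pair of one-forms is a coframe because it is only used in dimension two.\<close>

definition orthonormal_coframe :: "('i, 'x, real^2) atlas \<Rightarrow> ('i, 'x, real^2) two_tensor
    \<Rightarrow> ('i, 'x, real^2) one_form \<Rightarrow> ('i, 'x, real^2) one_form \<Rightarrow> bool" where
  "orthonormal_coframe A q l n \<longleftrightarrow> (\<forall>i. \<forall>x \<in> chart_dom A i.
     cometric q l l i x = 1 \<and> cometric q n n i x = 1 \<and> cometric q l n i x = 0)"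


section \<open>Standard Brinkmann space-times\<close>

text \<open>Points of \<open>\<real>\<^sup>2 \<times> X\<close> are triples \<open>(x\<^sub>u, x\<^sub>v, x)\<close>.\<close>

definition brinkmann_atlas ::
  "('i, 'x, real^2) atlas \<Rightarrow> ('i, real \<times> real \<times> 'x, real \<times> real \<times> (real^2)) atlas" where
  "brinkmann_atlas X =
     \<lparr> chart_dom = (\<lambda>i. UNIV \<times> UNIV \<times> chart_dom X i),
       chart_map = (\<lambda>i (u, v, x). (u, v, chart_map X i x)) \<rparr>"

definition brinkmann_metric :: "(real \<Rightarrow> 'x \<Rightarrow> real) \<Rightarrow> (real \<Rightarrow> ('i, 'x, real^2) one_form)
    \<Rightarrow> (real \<Rightarrow> ('i, 'x, real^2) two_tensor)
    \<Rightarrow> ('i, real \<times> real \<times> 'x, real \<times> real \<times> (real^2)) two_tensor" where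
  "brinkmann_metric H \<alpha> q = (\<lambda>i (u, v, x) (a, b, y) (a', b', y').
     H u x * a * a' + (a * \<alpha> u i x y' + a' * \<alpha> u i x y) + (a * b' + a' * b) + q u i x y y')"

definition d_v :: "real \<times> real \<times> (real^2)" where
  "d_v = (0, 1, 0)"


section \<open>Real spinors in signature (3,1)\<close>

text \<open>
  The orthonormal index type is \<open>4\<close> with \<open>4\<close> (which equals \<open>0\<close> in this type) timelike.
  The matrices below give the irreducible representation of \<open>Cl(3,1) \<cong> Mat(4,\<real>)\<close> on \<open>\<real>\<^sup>4\<close>,
  with the convention \<open>w\<^sup>2 = \<langle>w, w\<rangle>\<close>; see the lemmas below.
\<close>

definition eta :: "4 \<Rightarrow> real" where
  "eta a = (if a = 4 then -1 else 1)"

definition mink :: "real^4 \<Rightarrow> real^4 \<Rightarrow> real" where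
  "mink w w' = (\<Sum>a\<in>UNIV. eta a * w $ a * w' $ a)"

definition gamma :: "4 \<Rightarrow> real^4^4" where
  "gamma a = vector (map vector
     (if a = 1 then
       [[0, 0, 1, 0],
        [0, 0, 0, 1],
        [1, 0, 0, 0],
        [0, 1, 0, 0]]
      else if a = 2 then
       [[0, 1, 0, 0],
        [1, 0, 0, 0],
        [0, 0, 0, -1],
        [0, 0, -1, 0]]
      else if a = 3 then
       [[1, 0, 0, 0],
        [0, -1, 0, 0],
        [0, 0, -1, 0],
        [0, 0, 0, 1]]
      else
       [[0, 0, 1, 0],
        [0, 0, 0, 1],
        [-1, 0, 0, 0],
        [0, -1, 0, 0]]))"

definition cliff :: "real^4 \<Rightarrow> real^4^4" where
  "cliff w = (\<Sum>a\<in>UNIV. w $ a *\<^sub>R gamma a)"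

lemma vector_4_nth [simp]:
  "(vector [a, b, c, d] :: 'a::zero^4) $ 1 = a"
  "(vector [a, b, c, d] :: 'a::zero^4) $ 2 = b"
  "(vector [a, b, c, d] :: 'a::zero^4) $ 3 = c"
  "(vector [a, b, c, d] :: 'a::zero^4) $ 4 = d"
  by (simp_all add: vector_def)

lemma gamma_clifford:
  "gamma a ** gamma b + gamma b ** gamma a = (if a = b then 2 * eta a else 0) *\<^sub>R mat 1"
proof -
  have "\<forall>a b. gamma a ** gamma b + gamma b ** gamma a = (if a = b then 2 * eta a else 0) *\<^sub>R mat 1"
    unfolding forall_4
    by (simp add: gamma_def eta_def vec_eq_iff forall_4 matrix_matrix_mult_def sum_4 mat_def)
  then show ?thesis by blast
qed

lemma gamma_irreducible:
  assumes S: "subspace S" and inv: "\<And>a s. s \<in> S \<Longrightarrow> gamma a *v s \<in> S" and ne: "S \<noteq> {0}"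
  shows "S = UNIV"
proof -
  obtain s where s: "s \<in> S" "s \<noteq> 0" using ne subspace_0[OF S] by auto
  note ops = subspace_add[OF S] subspace_scale[OF S]
  define P where "P = (\<lambda>e f. \<lambda>s::real^4. (1/4) *\<^sub>R (s + e *\<^sub>R (gamma 3 *v s)
     + f *\<^sub>R (gamma 1 *v (gamma 4 *v s)) + (e * f) *\<^sub>R (gamma 3 *v (gamma 1 *v (gamma 4 *v s)))))"
  have PS: "P e f s \<in> S" for e f unfolding P_def by (intro ops inv s)
  note mv = vec_eq_iff forall_4 matrix_vector_mult_def sum_4 gamma_def axis_def
  have P: "P 1 (-1) s = s $ 1 *\<^sub>R axis 1 1" "P (-1) (-1) s = s $ 2 *\<^sub>R axis 2 1"
    "P (-1) 1 s = s $ 3 *\<^sub>R axis 3 1" "P 1 1 s = s $ 4 *\<^sub>R axis 4 1"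
    by (simp_all add: P_def mv)
  have sc: "axis k 1 \<in> S" if "s $ k *\<^sub>R axis k 1 \<in> S" "s $ k \<noteq> 0" for k
    using ops(2)[OF that(1), of "1 / s $ k"] that(2) by simp
  have "\<exists>k. axis k 1 \<in> S"
  proof -
    from s(2) have "s $ 1 \<noteq> 0 \<or> s $ 2 \<noteq> 0 \<or> s $ 3 \<noteq> 0 \<or> s $ 4 \<noteq> 0"
      by (simp add: vec_eq_iff forall_4)
    then show ?thesis using sc P PS by metis
  qed
  moreover have G: "gamma 1 *v axis 1 1 = axis 3 1" "gamma 1 *v axis 2 1 = axis 4 1"
    "gamma 1 *v axis 3 1 = axis 1 1" "gamma 1 *v axis 4 1 = axis 2 1"
    "gamma 2 *v axis 1 1 = axis 2 1" "gamma 2 *v axis 2 1 = axis 1 1"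
    by (simp_all add: mv)
  ultimately have "axis 1 1 \<in> S" by (metis inv exhaust_4)
  with G have all: "axis k 1 \<in> S" for k by (metis inv exhaust_4)
  have "x \<in> S" for x
  proof -
    have "x = (\<Sum>k\<in>UNIV. x $ k *\<^sub>R axis k 1)"
      using basis_expansion[of x] by (simp add: scalar_mult_eq_scaleR)
    also have "\<dots> \<in> S" by (intro subspace_sum[OF S] ops all)
    finally show ?thesis .
  qed
  then show ?thesis by blast
qed

text \<open>\<open>Spin\<^sub>+(3,1)\<close>: products of unit vectors, evenly many spacelike and evenly many timelike.\<close>

definition Spin_plus :: "(real^4^4) set" where
  "Spin_plus = {foldr (\<lambda>w S. cliff w ** S) ws (mat 1) | ws.
     (\<forall>w \<in> set ws. mink w w = 1 \<or> mink w w = -1) \<and>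
     even (length (filter (\<lambda>w. mink w w = 1) ws)) \<and>
     even (length (filter (\<lambda>w. mink w w = -1) ws))}"


section \<open>Spin structures and parallel spinors on \<open>\<real>\<^sup>2 \<times> X\<close>\<close>

text \<open>
  \<open>\<real>\<^sup>2 \<times> X\<close> carries the product orientation and the time orientation for which the null vector
  field \<open>\<partial>\<^sub>v\<close> is future-directed.
\<close>

definition coord_vec :: "real \<times> real \<times> (real^2) \<Rightarrow> real^4" where
  "coord_vec = (\<lambda>(a, b, y). vector [a, b, y $ 1, y $ 2])"

definition oriented_frame_on ::
  "('i, 'm, real \<times> real \<times> (real^2)) atlas \<Rightarrow> ('i, 'm, real \<times> real \<times> (real^2)) two_tensor
    \<Rightarrow> 'm set \<Rightarrow> (4 \<Rightarrow> ('i, 'm, real \<times> real \<times> (real^2)) vec_field) \<Rightarrow> bool" where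
  "oriented_frame_on M g U e \<longleftrightarrow>
     (\<forall>a. smooth_vec_field_on M U (e a)) \<and>
     (\<forall>i. \<forall>x \<in> U \<inter> chart_dom M i.
        (\<forall>a b. g i x (e a i x) (e b i x) = (if a = b then eta a else 0)) \<and>
        det (\<chi> a. coord_vec (e a i x)) > 0 \<and>
        g i x (e 4 i x) d_v < 0)"

text \<open>
  A spin structure in terms of local data: for every point \<open>p\<close> a local section \<open>s\<^sub>p\<close> of the
  \<open>Spin\<^sub>+\<close>-bundle over a neighbourhood \<open>U p\<close> of \<open>p\<close>, recorded by the oriented and time-oriented
  orthonormal frame \<open>e p\<close> which it covers, and the transition functions \<open>h p p'\<close> given by
  \<open>s\<^sub>p\<^sub>' = s\<^sub>p h p p'\<close>. These form a cocycle and lift the transition functions of the frames along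
  the double cover \<open>Spin\<^sub>+(3,1) \<rightarrow> SO\<^sub>+(3,1)\<close>, \<open>h \<gamma>\<^sub>b h\<^sup>-\<^sup>1 = \<Sum>\<^sub>a \<Lambda>\<^sub>a\<^sub>b \<gamma>\<^sub>a\<close>.
\<close>

definition spin_structure ::
  "('i, 'm::topological_space, real \<times> real \<times> (real^2)) atlas
    \<Rightarrow> ('i, 'm, real \<times> real \<times> (real^2)) two_tensor \<Rightarrow> ('m \<Rightarrow> 'm set)
    \<Rightarrow> ('m \<Rightarrow> 4 \<Rightarrow> ('i, 'm, real \<times> real \<times> (real^2)) vec_field)
    \<Rightarrow> ('m \<Rightarrow> 'm \<Rightarrow> 'm \<Rightarrow> real^4^4) \<Rightarrow> bool" where
  "spin_structure M g U e h \<longleftrightarrow>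
     (\<forall>p. open (U p) \<and> p \<in> U p \<and> oriented_frame_on M g (U p) (e p)) \<and>
     (\<forall>p p'. smooth_fun_on M (U p \<inter> U p') (h p p') \<and>
        (\<forall>x \<in> U p \<inter> U p'. h p p' x \<in> Spin_plus \<and>
           (\<exists>\<Lambda>::real^4^4. \<forall>b.
              (\<forall>i. x \<in> chart_dom M i \<longrightarrow> e p' b i x = (\<Sum>a\<in>UNIV. \<Lambda> $ a $ b *\<^sub>R e p a i x)) \<and>
              h p p' x ** gamma b = (\<Sum>a\<in>UNIV. \<Lambda> $ a $ b *\<^sub>R gamma a) ** h p p' x))) \<and>
     (\<forall>p p' p''. \<forall>x \<in> U p \<inter> U p' \<inter> U p''. h p p' x ** h p' p'' x = h p p'' x)"

text \<open>A spinor field, i.e. a section of the vector bundle associated to the spin structure: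
  \<open>\<epsilon> p\<close> is its component function with respect to \<open>s\<^sub>p\<close>.\<close>

definition spinor_field :: "('i, 'm, real \<times> real \<times> (real^2)) atlas \<Rightarrow> ('m \<Rightarrow> 'm set)
    \<Rightarrow> ('m \<Rightarrow> 'm \<Rightarrow> 'm \<Rightarrow> real^4^4) \<Rightarrow> ('m \<Rightarrow> 'm \<Rightarrow> real^4) \<Rightarrow> bool" where
  "spinor_field M U h \<epsilon> \<longleftrightarrow>
     (\<forall>p. smooth_fun_on M (U p) (\<epsilon> p)) \<and>
     (\<forall>p p'. \<forall>x \<in> U p \<inter> U p'. \<epsilon> p x = h p p' x *v \<epsilon> p' x)"

text \<open>The spin connection matrix \<open>\<Omega>(v) = 1/4 \<Sum> \<omega>\<^sup>a\<^sup>b(v) \<gamma>\<^sub>a \<gamma>\<^sub>b\<close> of a frame, where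
  \<open>\<omega>\<^sub>a\<^sub>b(v) = g(e\<^sub>a, \<nabla>\<^sub>v e\<^sub>b)\<close>. With \<open>w\<^sup>2 = \<langle>w, w\<rangle>\<close> this makes Clifford multiplication parallel.\<close>

definition spin_connection ::
  "('i, 'm, 'e::real_normed_vector) atlas \<Rightarrow> ('i, 'm, 'e) two_tensor
    \<Rightarrow> (4 \<Rightarrow> ('i, 'm, 'e) vec_field) \<Rightarrow> 'i \<Rightarrow> 'm \<Rightarrow> 'e \<Rightarrow> real^4^4" where
  "spin_connection M g e i x v = (1/4) *\<^sub>R (\<Sum>a\<in>UNIV. \<Sum>b\<in>UNIV.
     (eta a * eta b * g i x (e a i x) (nabla_vec M g (e b) i x v)) *\<^sub>R (gamma a ** gamma b))"

definition parallel_spinor ::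
  "('i, 'm, real \<times> real \<times> (real^2)) atlas \<Rightarrow> ('i, 'm, real \<times> real \<times> (real^2)) two_tensor
    \<Rightarrow> ('m \<Rightarrow> 'm set) \<Rightarrow> ('m \<Rightarrow> 4 \<Rightarrow> ('i, 'm, real \<times> real \<times> (real^2)) vec_field)
    \<Rightarrow> ('m \<Rightarrow> 'm \<Rightarrow> 'm \<Rightarrow> real^4^4) \<Rightarrow> ('m \<Rightarrow> 'm \<Rightarrow> real^4) \<Rightarrow> bool" where
  "parallel_spinor M g U e h \<epsilon> \<longleftrightarrow>
     spinor_field M U h \<epsilon> \<and>
     (\<exists>p. \<exists>x \<in> U p. \<epsilon> p x \<noteq> 0) \<and>
     (\<forall>p i. \<forall>x \<in> U p \<inter> chart_dom M i. \<forall>v.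
        chart_D M i (\<epsilon> p) x v + spin_connection M g (e p) i x v *v \<epsilon> p x = 0)"

text \<open>The Dirac current \<open>\<Sum> \<eta>\<^sup>a\<^sup>a B(\<epsilon>, \<gamma>\<^sub>a \<epsilon>) e\<^sub>a\<close>, for the \<open>Spin\<^sub>+(3,1)\<close>-invariant bilinear form
  \<open>B(\<psi>, \<chi>) = \<psi>\<^sup>T \<gamma>\<^sub>4 \<chi>\<close>. Its \<open>e\<^sub>4\<close>-component is \<open>|\<epsilon>|\<^sup>2\<close>, so it is future-directed.\<close>

definition dirac_current :: "(4 \<Rightarrow> ('i, 'm, 'e::real_vector) vec_field) \<Rightarrow> real^4 \<Rightarrow> 'i \<Rightarrow> 'm \<Rightarrow> 'e" where
  "dirac_current e \<epsilon> i x =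
     (\<Sum>a\<in>UNIV. (eta a * (\<epsilon> \<bullet> (gamma 4 *v (gamma a *v \<epsilon>)))) *\<^sub>R e a i x)"

definition admits_adapted_parallel_spinor ::
  "('i, 'm::topological_space, real \<times> real \<times> (real^2)) atlas
    \<Rightarrow> ('i, 'm, real \<times> real \<times> (real^2)) two_tensor \<Rightarrow> bool" where
  "admits_adapted_parallel_spinor M g \<longleftrightarrow>
     (\<exists>U e h \<epsilon>. spin_structure M g U e h \<and> parallel_spinor M g U e h \<epsilon> \<and>
        (\<forall>p i. \<forall>x \<in> U p \<inter> chart_dom M i. dirac_current (e p) (\<epsilon> p x) i x = d_v))"

end

theory Submission
  imports Defs
begin

text \<open>
  A spinor \<open>\<epsilon>\<close> on \<open>\<real>\<^sup>2 \<times> X\<close> carries more than its Dirac current. With the invariant pairing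
  \<open>B\<close> of spinors, the two-form \<open>F(w, w') = B(\<epsilon>, w w' \<epsilon>)\<close> and the form \<open>G\<close> obtained by inserting the
  volume element (the Hodge dual of \<open>F\<close> up to sign) are quadratic in \<open>\<epsilon>\<close> and \<open>Spin\<^sub>+\<close>-invariant, so
  they are globally defined whatever the spin structure is. If the Dirac current is \<open>\<partial>\<^sub>v\<close>, Fierz
  identities give \<open>F = dx\<^sub>u \<and> l\<close> and \<open>G = dx\<^sub>u \<and> n\<close> where \<open>l\<close> and \<open>n\<close> kill \<open>\<partial>\<^sub>v\<close>, are orthonormal and
  are determined up to multiples of \<open>dx\<^sub>u\<close>. On vectors tangent to \<open>X\<close> this ambiguity disappears:
  \<open>l\<^sub>u(y) = F(\<partial>\<^sub>u, y)\<close> and \<open>n\<^sub>u(y) = G(\<partial>\<^sub>u, y)\<close> form an orthonormal coframe of \<open>q\<^sub>u\<close>.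

  If \<open>\<epsilon>\<close> is parallel then so are \<open>F\<close> and \<open>G\<close>. Since \<open>\<partial>\<^sub>v\<close> is parallel, the equation \<open>\<nabla>F = 0\<close>
  collapses to \<open>D\<^sub>z l(y) = l(\<Gamma>\<^sub>X(z, y))\<close> for \<open>y\<close> tangent to \<open>X\<close>, where \<open>\<Gamma>\<^sub>X\<close> is the component along \<open>X\<close>
  of the Christoffel symbol of the space-time. For \<open>z\<close> tangent to \<open>X\<close> this symbol is the one of
  \<open>q\<^sub>u\<close>, so \<open>l\<^sub>u\<close> and \<open>n\<^sub>u\<close> are parallel on \<open>X\<close>. For \<open>z = \<partial>\<^sub>u\<close> the Koszul formula reads
  \<open>q(\<Gamma>\<^sub>X(\<partial>\<^sub>u, y), a) = (\<partial>\<^sub>u q(y, a) + d\<alpha>(y, a)) / 2\<close>. With \<open>q = l l + n n\<close> both sides are expressed by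
  \<open>l\<close>, \<open>n\<close> and their derivatives in \<open>u\<close>. The symmetric part in \<open>y\<close> and \<open>a\<close> holds automatically, and
  the antisymmetric part is the formula for \<open>d\<alpha>\<close>.

  Read backwards, the same computation shows that the formula for \<open>d\<alpha>\<close> forces
  \<open>D\<^sub>z l(y) = l(\<Gamma>\<^sub>X(z, y))\<close> in all directions \<open>z\<close>. A global coframe on \<open>X\<close> gives a global
  orthonormal frame of the space-time, hence a trivial spin structure. In the frame with
  \<open>e\<^sub>1 + e\<^sub>4 = \<partial>\<^sub>v\<close> and with \<open>e\<^sub>3\<close> and \<open>e\<^sub>2\<close> the horizontal lifts of the vectors dual to \<open>l\<close> and \<open>n\<close>, the
  connection matrix satisfies \<open>\<omega>\<^sub>a\<^sub>1 + \<omega>\<^sub>a\<^sub>4 = 0\<close> because \<open>\<partial>\<^sub>v\<close> is parallel, and \<open>\<omega>\<^sub>2\<^sub>3 = 0\<close> by the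
  equation for \<open>l\<close>. Matrices of this kind are the ones that annihilate the constant spinor
  \<open>(1, 0, 0, 0)\<close>, whose Dirac current is \<open>e\<^sub>1 + e\<^sub>4\<close>. The vector \<open>e\<^sub>2\<close> is taken with the sign that makes
  the frame positively oriented. This sign is constant because \<open>\<real> \<times> X\<close> is connected.

  Flatness holds because a parallel coframe \<open>(l, n)\<close> satisfies \<open>D\<^sub>v l(w) = l(\<Gamma>(v, w))\<close>: one more
  derivative and the symmetry of second derivatives give \<open>l(R) = n(R) = 0\<close>.

  The two directions are carried by \<open>two_form_parallel\<close>, \<open>parallel_two_form_reduces\<close> and
  \<open>coframe_condition\<close>, and by \<open>coframe_lift_derivative\<close> and \<open>adapted_spinor_parallel\<close>.
\<close>

section \<open>Calculus of smooth maps\<close>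

lemma Ck_on_cong:
  assumes "open S" "\<And>y. y \<in> S \<Longrightarrow> f y = g y"
  shows "Ck_on k S f \<longleftrightarrow> Ck_on k S g"
  using assms(2)
proof (induction k arbitrary: f g)
  case 0
  then show ?case by (auto cong: continuous_on_cong)
next
  case (Suc k)
  have d: "f differentiable at y \<longleftrightarrow> g differentiable at y" if "y \<in> S" for y
    unfolding differentiable_def
    using has_derivative_transform_within_open[OF _ \<open>open S\<close> that, of f _ UNIV g]
      has_derivative_transform_within_open[OF _ \<open>open S\<close> that, of g _ UNIV f] Suc.prems
    by auto
  have fd: "frechet_derivative f (at y) = frechet_derivative g (at y)"
    if "y \<in> S" "f differentiable at y" for y
    using frechet_derivative_transform_within_open[OF that(2) \<open>open S\<close> that(1)] Suc.prems by blast
  show ?case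
  proof (cases "\<forall>y\<in>S. f differentiable at y")
    case True
    have "Ck_on k S (\<lambda>y. frechet_derivative f (at y) v) \<longleftrightarrow> Ck_on k S (\<lambda>y. frechet_derivative g (at y) v)" for v
      by (rule Suc.IH) (simp add: fd True)
    with d show ?thesis by simp
  next
    case False
    then show ?thesis using d by auto
  qed
qed

lemma Ck_on_continuous: "Ck_on k S f \<Longrightarrow> continuous_on S f"
proof (cases k)
  case (Suc m)
  assume "Ck_on k S f"
  with Suc have "f differentiable at y" if "y \<in> S" for y using that by simp
  then show ?thesis
    by (meson continuous_at_imp_continuous_on differentiable_imp_continuous_within)
qed simp

lemma Ck_on_Suc_imp: "Ck_on (Suc k) S f \<Longrightarrow> Ck_on k S f"
proof (induction k arbitrary: f)
  case 0
  then show ?case unfolding Ck_on.simps(1) by (rule Ck_on_continuous)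
next
  case (Suc k)
  then show ?case unfolding Ck_on.simps(2) [of "Suc k"] Ck_on.simps(2)[of k S f] by blast
qed

lemma Ck_on_subset: "Ck_on k S f \<Longrightarrow> T \<subseteq> S \<Longrightarrow> Ck_on k T f"
  by (induction k arbitrary: f) (auto intro: continuous_on_subset)

lemma Ck_on_local:
  assumes "\<And>y. y \<in> S \<Longrightarrow> \<exists>T. open T \<and> y \<in> T \<and> Ck_on k T f"
  shows "Ck_on k S f"
  using assms
proof (induction k arbitrary: f)
  case 0
  have "continuous (at y) f" if "y \<in> S" for y
    using 0[OF that] by (auto simp: continuous_on_eq_continuous_at)
  then show ?case by (simp add: continuous_at_imp_continuous_on)
next
  case (Suc k)
  show ?case unfolding Ck_on.simps
  proof (intro conjI allI ballI)
    show "f differentiable at y" if "y \<in> S" for y using Suc.prems[OF that] by auto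
    show "Ck_on k S (\<lambda>y. frechet_derivative f (at y) v)" for v
      by (rule Suc.IH) (use Suc.prems in fastforce)
  qed
qed

lemma Ck_on_const: "Ck_on k S (\<lambda>y. c)"
  by (induction k arbitrary: c) (auto simp: frechet_derivative_const)

text \<open>To show that a map is smooth it suffices to exhibit its derivative; all closure properties follow from this by induction on the order.\<close>

lemma Ck_on_SucI:
  assumes "open S" "\<And>y. y \<in> S \<Longrightarrow> (f has_derivative f' y) (at y)" "\<And>v. Ck_on k S (\<lambda>y. f' y v)"
  shows "Ck_on (Suc k) S f"
proof -
  have "frechet_derivative f (at y) = f' y" if "y \<in> S" for y
    using frechet_derivative_at[OF assms(2)[OF that]] by simp
  then have "Ck_on k S (\<lambda>y. frechet_derivative f (at y) v)" for v
    using Ck_on_cong[OF assms(1), of "\<lambda>y. frechet_derivative f (at y) v" "\<lambda>y. f' y v"] assms(3) by simp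
  then show ?thesis using assms(2) by (auto simp: differentiable_def)
qed

lemma Ck_on_has_derivative:
  "Ck_on (Suc k) S f \<Longrightarrow> y \<in> S \<Longrightarrow> (f has_derivative frechet_derivative f (at y)) (at y)"
  by (simp add: frechet_derivative_works)

lemma Ck_on_linear_image:
  assumes S: "open S" and L: "bounded_linear L" and f: "Ck_on k S f"
  shows "Ck_on k S (\<lambda>y. L (f y))"
  using f
proof (induction k arbitrary: f)
  case 0
  then show ?case using L by (simp add: bounded_linear.continuous_on)
next
  case (Suc k)
  show ?case
    by (rule Ck_on_SucI[OF S bounded_linear.has_derivative[OF L Ck_on_has_derivative[OF Suc.prems]]])
       (use Suc in auto)
qed

lemma Ck_on_add:
  assumes S: "open S" and "Ck_on k S f" "Ck_on k S g"
  shows "Ck_on k S (\<lambda>y. f y + g y)"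
  using assms(2,3)
proof (induction k arbitrary: f g)
  case 0
  then show ?case by (simp add: continuous_on_add)
next
  case (Suc k)
  show ?case
    by (rule Ck_on_SucI[OF S has_derivative_add[OF Ck_on_has_derivative[OF Suc.prems(1)]
          Ck_on_has_derivative[OF Suc.prems(2)]]]) (use Suc in auto)
qed

lemma Ck_on_sum:
  assumes "open S" "\<And>i. i \<in> I \<Longrightarrow> Ck_on k S (f i)"
  shows "Ck_on k S (\<lambda>y. \<Sum>i\<in>I. f i y)"
  using assms(2) by (induction I rule: infinite_finite_induct) (auto simp: Ck_on_const Ck_on_add[OF assms(1)])

lemma Ck_on_bilinear:
  assumes S: "open S" and B: "bounded_bilinear B" and "Ck_on k S f" "Ck_on k S g"
  shows "Ck_on k S (\<lambda>y. B (f y) (g y))"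
  using assms(3,4)
proof (induction k arbitrary: f g)
  case 0
  then show ?case using B by (simp add: bounded_bilinear.continuous_on)
next
  case (Suc k)
  show ?case
    by (rule Ck_on_SucI[OF S bounded_bilinear.FDERIV[OF B Ck_on_has_derivative[OF Suc.prems(1)]
          Ck_on_has_derivative[OF Suc.prems(2)]]])
       (use Suc.IH Suc.prems[THEN Ck_on_Suc_imp] Suc.prems in \<open>auto intro!: Ck_on_add[OF S]\<close>)
qed

text \<open>Restricting a function on \<open>\<real>\<^sup>2 \<times> X\<close> to a slice and pulling a function of \<open>(u, x)\<close> back to \<open>\<real>\<^sup>2 \<times> X\<close> are
  compositions with affine maps.\<close>

lemma Ck_on_compose_affine:
  assumes S: "open S" and T: "open T" and L: "bounded_linear L" and f: "Ck_on k T f"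
    and im: "\<And>y. y \<in> S \<Longrightarrow> L y + c \<in> T"
  shows "Ck_on k S (\<lambda>y. f (L y + c))"
  using f
proof (induction k arbitrary: f)
  case 0
  have "continuous_on S (\<lambda>y. L y + c)"
    by (intro continuous_intros linear_continuous_on L)
  then show ?case using 0 im by (auto intro: continuous_on_compose2)
next
  case (Suc k)
  show ?case
  proof (rule Ck_on_SucI[OF S])
    fix y assume "y \<in> S"
    show "((\<lambda>y. f (L y + c)) has_derivative (\<lambda>v. frechet_derivative f (at (L y + c)) (L v))) (at y)"
      by (rule has_derivative_compose[of "\<lambda>y. L y + c" L])
         (auto intro!: derivative_eq_intros bounded_linear_imp_has_derivative[OF L] Ck_on_has_derivative[OF Suc.prems]
            im \<open>y \<in> S\<close>)
  qed (use Suc in auto)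
qed

lemma Ck_on_inverse:
  fixes f :: "'a::real_normed_vector \<Rightarrow> real"
  assumes S: "open S" and "Ck_on k S f" and nz: "\<And>y. y \<in> S \<Longrightarrow> f y \<noteq> 0"
  shows "Ck_on k S (\<lambda>y. inverse (f y))"
  using assms(2)
proof (induction k)
  case 0
  then show ?case using nz by (auto intro: continuous_on_inverse)
next
  case (Suc k)
  note mult = Ck_on_bilinear[OF S bounded_bilinear_mult]
  have I: "Ck_on k S (\<lambda>y. inverse (f y))" using Suc Ck_on_Suc_imp by blast
  have D: "Ck_on k S (\<lambda>y. frechet_derivative f (at y) v)" for v using Suc.prems by simp
  show ?case
  proof (rule Ck_on_SucI[OF S])
    fix y assume y: "y \<in> S"
    show "((\<lambda>y. inverse (f y)) has_derivative
      (\<lambda>v. (-1) * (inverse (f y) * frechet_derivative f (at y) v * inverse (f y)))) (at y)"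
      using Deriv.has_derivative_inverse[OF nz[OF y] Ck_on_has_derivative[OF Suc.prems y]] by simp
  next
    show "Ck_on k S (\<lambda>y. (-1) * (inverse (f y) * frechet_derivative f (at y) v * inverse (f y)))" for v
      by (intro mult I D Ck_on_const)
  qed
qed

lemma smooth_map_on_cong:
  "open S \<Longrightarrow> (\<And>y. y \<in> S \<Longrightarrow> f y = g y) \<Longrightarrow> smooth_map_on S f \<longleftrightarrow> smooth_map_on S g"
  unfolding smooth_map_on_def by (simp add: Ck_on_cong[of S f g])

lemma smooth_map_on_subset: "smooth_map_on S f \<Longrightarrow> T \<subseteq> S \<Longrightarrow> smooth_map_on T f"
  unfolding smooth_map_on_def by (intro allI Ck_on_subset[of _ S f T]) auto

lemma smooth_map_on_local:
  assumes "\<And>y. y \<in> S \<Longrightarrow> \<exists>T. open T \<and> y \<in> T \<and> smooth_map_on T f"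
  shows "smooth_map_on S f"
  unfolding smooth_map_on_def
proof
  show "Ck_on k S f" for k
    by (rule Ck_on_local) (use assms in \<open>auto simp: smooth_map_on_def\<close>)
qed

lemma smooth_map_on_const: "smooth_map_on S (\<lambda>y. c)"
  by (simp add: smooth_map_on_def Ck_on_const)

lemma smooth_map_on_linear_image:
  "open S \<Longrightarrow> bounded_linear L \<Longrightarrow> smooth_map_on S f \<Longrightarrow> smooth_map_on S (\<lambda>y. L (f y))"
  by (simp add: smooth_map_on_def Ck_on_linear_image)

lemma smooth_map_on_add:
  "open S \<Longrightarrow> smooth_map_on S f \<Longrightarrow> smooth_map_on S g \<Longrightarrow> smooth_map_on S (\<lambda>y. f y + g y)"
  by (simp add: smooth_map_on_def Ck_on_add)

lemma smooth_map_on_sum: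
  "open S \<Longrightarrow> (\<And>i. i \<in> I \<Longrightarrow> smooth_map_on S (f i)) \<Longrightarrow> smooth_map_on S (\<lambda>y. \<Sum>i\<in>I. f i y)"
  by (simp add: smooth_map_on_def Ck_on_sum)

lemma smooth_map_on_bilinear:
  "open S \<Longrightarrow> bounded_bilinear B \<Longrightarrow> smooth_map_on S f \<Longrightarrow> smooth_map_on S g \<Longrightarrow>
    smooth_map_on S (\<lambda>y. B (f y) (g y))"
  by (simp add: smooth_map_on_def Ck_on_bilinear)

lemmas smooth_map_on_mult =
  smooth_map_on_bilinear[OF _ bounded_bilinear_mult[where ?'a = real]]

lemmas smooth_map_on_scaleR = smooth_map_on_bilinear[OF _ bounded_bilinear_scaleR]

lemma smooth_map_on_minus: "open S \<Longrightarrow> smooth_map_on S f \<Longrightarrow> smooth_map_on S (\<lambda>y. - f y)"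
  by (rule smooth_map_on_linear_image[OF _ bounded_linear_minus[OF bounded_linear_ident]])

lemma smooth_map_on_diff:
  "open S \<Longrightarrow> smooth_map_on S f \<Longrightarrow> smooth_map_on S g \<Longrightarrow> smooth_map_on S (\<lambda>y. f y - g y)"
    using smooth_map_on_add[of S f "\<lambda>y. - g y"] smooth_map_on_minus[of S g] by simp

lemma smooth_map_on_inverse:
  fixes f :: "'a::real_normed_vector \<Rightarrow> real"
  shows "open S \<Longrightarrow> smooth_map_on S f \<Longrightarrow> (\<And>y. y \<in> S \<Longrightarrow> f y \<noteq> 0) \<Longrightarrow>
    smooth_map_on S (\<lambda>y. inverse (f y))"
  by (simp add: smooth_map_on_def Ck_on_inverse)

lemma smooth_map_on_compose_affine:
  "open S \<Longrightarrow> open T \<Longrightarrow> bounded_linear L \<Longrightarrow> smooth_map_on T f \<Longrightarrow>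
    (\<And>y. y \<in> S \<Longrightarrow> L y + c \<in> T) \<Longrightarrow> smooth_map_on S (\<lambda>y. f (L y + c))"
  by (simp add: smooth_map_on_def Ck_on_compose_affine)

lemma smooth_map_on_differentiable:
  assumes "smooth_map_on S f" "y \<in> S"
  shows "f differentiable at y"
proof -
  have "Ck_on (Suc 0) S f" using assms(1) by (simp only: smooth_map_on_def)
  then show ?thesis using assms(2) by simp
qed

lemma smooth_map_on_continuous:
  assumes "smooth_map_on S f"
  shows "continuous_on S f"
proof -
  have "Ck_on 0 S f" using assms by (simp only: smooth_map_on_def)
  then show ?thesis by simp
qed

lemma smooth_map_on_derivative:
  assumes "smooth_map_on S f"
  shows "smooth_map_on S (\<lambda>y. frechet_derivative f (at y) v)"
  unfolding smooth_map_on_def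
proof
  fix k
  have "Ck_on (Suc k) S f" using assms by (simp only: smooth_map_on_def)
  then show "Ck_on k S (\<lambda>y. frechet_derivative f (at y) v)" by simp
qed

lemma has_derivative_frechet_eq:
  "(f has_derivative f') (at y) \<Longrightarrow> frechet_derivative f (at y) v = f' v"
  by (drule frechet_derivative_at) simp


text \<open>Unconditional because the derivative is defined by choice from the set of all derivatives, which is
  the same for both functions. It is needed since coordinate expressions built from \<open>chart_inv\<close> are
  meaningful only on the image of the chart.\<close>

lemma frechet_derivative_cong:
  assumes "open S" "y \<in> S" "\<And>p. p \<in> S \<Longrightarrow> f p = g p"
  shows "frechet_derivative f (at y) = frechet_derivative g (at y)"
proof -
  have "(f has_derivative f') (at y) \<longleftrightarrow> (g has_derivative f') (at y)" for f'
    using has_derivative_transform_within_open[OF _ assms(1,2), of f f' UNIV g]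
      has_derivative_transform_within_open[OF _ assms(1,2), of g f' UNIV f] assms(3) by auto
  then show ?thesis unfolding frechet_derivative_def by simp
qed

text \<open>By the mean value theorem in the direction \<open>u\<close>, the second difference over a parallelogram is \<open>t\<close>
  times a difference of values of \<open>D\<^sub>u f\<close>, which is estimated by the derivative of \<open>D\<^sub>u f\<close> at \<open>y\<close>.
  The limit is taken from the right only, which is enough for uniqueness.\<close>

lemma second_difference_tendsto:
  fixes f :: "'a::real_normed_vector \<Rightarrow> real"
  assumes S: "open S" "y \<in> S" and f: "\<And>z. z \<in> S \<Longrightarrow> f differentiable at z"
    and fu: "(\<lambda>z. frechet_derivative f (at z) u) differentiable at y"
  shows "((\<lambda>t. (f (y + t *\<^sub>R u + t *\<^sub>R v) - f (y + t *\<^sub>R u) - f (y + t *\<^sub>R v) + f y) / t^2)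
     \<longlongrightarrow> frechet_derivative (\<lambda>z. frechet_derivative f (at z) u) (at y) v) (at_right 0)"
proof (rule tendstoI)
  fix e :: real assume "e > 0"
  define fu where "fu = (\<lambda>z. frechet_derivative f (at z) u)"
  define L where "L = frechet_derivative fu (at y)"
  have L: "(fu has_derivative L) (at y)"
    using assms(4) unfolding L_def fu_def frechet_derivative_works .
  interpret L: bounded_linear L using L by (rule has_derivative_bounded_linear)
  \<comment> \<open>The distances from \<open>y\<close> of the two points at which \<open>D\<^sub>u f\<close> is compared add up to at most \<open>t C\<close>.\<close>
  define C where "C = 2 * norm u + norm v + 1"
  have "C > 0" unfolding C_def by (simp add: add_nonneg_pos)
  obtain d where d: "d > 0" and
    dL: "\<And>z. norm (z - y) < d \<Longrightarrow> \<bar>fu z - fu y - L (z - y)\<bar> \<le> e / (2 * C) * norm (z - y)"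
  proof -
    have "e / (2 * C) > 0" using \<open>e > 0\<close> \<open>C > 0\<close> by simp
    then show ?thesis using L that unfolding has_derivative_at_alt real_norm_def by blast
  qed
  obtain r where r: "r > 0" "ball y r \<subseteq> S" using S openE by blast
  have "\<forall>\<^sub>F t in at_right 0. t < min d r / C"
    by (rule eventually_at_rightI[of 0 "min d r / C"]) (use d r \<open>C > 0\<close> in auto)
  moreover have "\<forall>\<^sub>F t in at_right (0::real). t > 0"
    by (simp add: eventually_at_right_less)
  ultimately show "\<forall>\<^sub>F t in at_right 0. dist ((f (y + t *\<^sub>R u + t *\<^sub>R v) - f (y + t *\<^sub>R u)
      - f (y + t *\<^sub>R v) + f y) / t^2) (frechet_derivative (\<lambda>z. frechet_derivative f (at z) u) (at y) v) < e"
  proof eventually_elim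
    case (elim t)
    have tC: "t * C < min d r" using elim \<open>C > 0\<close> by (simp add: field_simps)
    have small: "norm (s *\<^sub>R u + k *\<^sub>R v) \<le> t * (norm u + norm v)" if "0 \<le> s" "s \<le> t" "0 \<le> k" "k \<le> t" for s k
    proof -
      have "norm (s *\<^sub>R u + k *\<^sub>R v) \<le> s * norm u + k * norm v"
        using norm_triangle_ineq[of "s *\<^sub>R u" "k *\<^sub>R v"] that by simp
      also have "\<dots> \<le> t * norm u + t * norm v"
        using that by (intro add_mono mult_right_mono) auto
      finally show ?thesis by (simp add: algebra_simps)
    qed
    have "t * (norm u + norm v) \<le> t * C" unfolding C_def using elim by (intro mult_left_mono) auto
    then have near: "norm (s *\<^sub>R u + k *\<^sub>R v) < min d r" if "0 \<le> s" "s \<le> t" "0 \<le> k" "k \<le> t" for s k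
      using small[OF that] tC by linarith
    have inS: "y + s *\<^sub>R u + k *\<^sub>R v \<in> S" if "0 \<le> s" "s \<le> t" "0 \<le> k" "k \<le> t" for s k
    proof -
      have "dist y (y + s *\<^sub>R u + k *\<^sub>R v) = norm (s *\<^sub>R u + k *\<^sub>R v)"
        by (metis add.assoc add_diff_cancel_left' dist_commute dist_norm)
      then show ?thesis using r near[OF that] by auto
    qed
    \<comment> \<open>The opposite sides of the parallelogram in the direction \<open>u\<close>; the summand with factor \<open>0\<close> makes both of them instances of one formula.\<close>
    define \<phi> where "\<phi> = (\<lambda>s. f (y + s *\<^sub>R u + t *\<^sub>R v) - f (y + s *\<^sub>R u + 0 *\<^sub>R v))"
    have fd: "((\<lambda>s. f (y + s *\<^sub>R u + k *\<^sub>R v)) has_derivative (\<lambda>h. h * fu (y + s *\<^sub>R u + k *\<^sub>R v))) (at s)"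
      if "0 \<le> s" "s \<le> t" "0 \<le> k" "k \<le> t" for s k
    proof -
      have *: "(f has_derivative frechet_derivative f (at (y + s *\<^sub>R u + k *\<^sub>R v))) (at (y + s *\<^sub>R u + k *\<^sub>R v))"
        using f[OF inS[OF that]] frechet_derivative_works by blast
      have "((\<lambda>s. f (y + s *\<^sub>R u + k *\<^sub>R v)) has_derivative (\<lambda>h. frechet_derivative f (at (y + s *\<^sub>R u + k *\<^sub>R v)) (h *\<^sub>R u))) (at s)"
        by (rule has_derivative_compose[where f = "\<lambda>s. y + s *\<^sub>R u + k *\<^sub>R v", OF _ *])
          (auto intro!: derivative_eq_intros)
      then show ?thesis unfolding fu_def
        using linear_cmul[OF has_derivative_linear[OF *]] by simp
    qed
    have "\<exists>s\<in>{0..t}. \<phi> t - \<phi> 0 = (t - 0) * (fu (y + s *\<^sub>R u + t *\<^sub>R v) - fu (y + s *\<^sub>R u + 0 *\<^sub>R v))"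
      unfolding \<phi>_def
    proof (rule mvt_very_simple[where f = "\<lambda>s. f (y + s *\<^sub>R u + t *\<^sub>R v) - f (y + s *\<^sub>R u + 0 *\<^sub>R v)"
        and f' = "\<lambda>s h. h * (fu (y + s *\<^sub>R u + t *\<^sub>R v) - fu (y + s *\<^sub>R u + 0 *\<^sub>R v))"])
      fix s assume "0 \<le> s" "s \<le> t"
      then show "((\<lambda>s. f (y + s *\<^sub>R u + t *\<^sub>R v) - f (y + s *\<^sub>R u + 0 *\<^sub>R v)) has_derivative
         (\<lambda>h. h * (fu (y + s *\<^sub>R u + t *\<^sub>R v) - fu (y + s *\<^sub>R u + 0 *\<^sub>R v)))) (at s within {0..t})"
        unfolding right_diff_distrib using elim
        by (intro has_derivative_at_withinI[OF has_derivative_diff[OF fd fd]]) auto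
    qed (use elim in simp)
    then obtain s where s: "0 \<le> s" "s \<le> t"
      and \<phi>: "\<phi> t - \<phi> 0 = t * (fu (y + s *\<^sub>R u + t *\<^sub>R v) - fu (y + s *\<^sub>R u + 0 *\<^sub>R v))" by auto
    define a where "a = s *\<^sub>R u + t *\<^sub>R v"
    define b where "b = s *\<^sub>R u + 0 *\<^sub>R v"
    have a: "\<bar>fu (y + a) - fu y - L a\<bar> \<le> e / (2 * C) * norm a"
      using dL[of "y + a"] near[of s t] s elim by (simp add: a_def)
    have b: "\<bar>fu (y + b) - fu y - L b\<bar> \<le> e / (2 * C) * norm b"
      using dL[of "y + b"] near[of s 0] s elim by (simp add: b_def)
    have "norm b \<le> t * norm u" using s by (simp add: b_def mult_right_mono)
    then have ab: "norm a + norm b \<le> t * C"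
      using small[of s t] s elim unfolding a_def C_def by (simp add: algebra_simps)
    have Lab: "L a - L b = t * L v" unfolding a_def b_def by (simp add: L.add L.scaleR)
    have "\<bar>fu (y + a) - fu (y + b) - t * L v\<bar> \<le> e / (2 * C) * norm a + e / (2 * C) * norm b"
      using a b Lab by linarith
    also have "\<dots> = e / (2 * C) * (norm a + norm b)" by (rule distrib_left[symmetric])
    also have "\<dots> \<le> e / (2 * C) * (t * C)"
      using ab \<open>e > 0\<close> \<open>C > 0\<close> by (intro mult_left_mono) auto
    also have "\<dots> = e / 2 * t" using \<open>C > 0\<close> by simp
    finally have est: "\<bar>fu (y + a) - fu (y + b) - t * L v\<bar> \<le> e / 2 * t" .
    have "f (y + t *\<^sub>R u + t *\<^sub>R v) - f (y + t *\<^sub>R u) - f (y + t *\<^sub>R v) + f y = \<phi> t - \<phi> 0"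
      by (simp add: \<phi>_def)
    also have "\<dots> = t * (fu (y + a) - fu (y + b))"
      unfolding \<phi> a_def b_def by (simp only: add.assoc)
    finally have "(f (y + t *\<^sub>R u + t *\<^sub>R v) - f (y + t *\<^sub>R u) - f (y + t *\<^sub>R v) + f y) / t^2 - L v
       = (fu (y + a) - fu (y + b) - t * L v) / t"
      using elim by (simp add: diff_divide_distrib power2_eq_square)
    moreover have "\<bar>(fu (y + a) - fu (y + b) - t * L v) / t\<bar> \<le> e / 2"
      using est elim by (simp add: pos_divide_le_eq)
    ultimately have "\<bar>(f (y + t *\<^sub>R u + t *\<^sub>R v) - f (y + t *\<^sub>R u) - f (y + t *\<^sub>R v) + f y) / t^2 - L v\<bar> \<le> e / 2"
      by simp
    then show ?case using \<open>e > 0\<close> unfolding dist_real_def L_def fu_def by linarith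
  qed
qed

text \<open>The second difference is symmetric in the two directions.\<close>

lemma second_derivative_symmetric:
  fixes f :: "'a::real_normed_vector \<Rightarrow> real"
  assumes S: "open S" "y \<in> S" and f: "\<And>z. z \<in> S \<Longrightarrow> f differentiable at z"
    and f': "\<And>u. (\<lambda>z. frechet_derivative f (at z) u) differentiable at y"
  shows "frechet_derivative (\<lambda>z. frechet_derivative f (at z) u) (at y) v
       = frechet_derivative (\<lambda>z. frechet_derivative f (at z) v) (at y) u"
proof (rule tendsto_unique[OF _ second_difference_tendsto[OF S f f']])
  show "((\<lambda>t. (f (y + t *\<^sub>R u + t *\<^sub>R v) - f (y + t *\<^sub>R u) - f (y + t *\<^sub>R v) + f y) / t^2)
     \<longlongrightarrow> frechet_derivative (\<lambda>z. frechet_derivative f (at z) v) (at y) u) (at_right 0)"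
    using second_difference_tendsto[OF S f f', of v u]
    by (simp add: algebra_simps)
qed auto

section \<open>Clifford algebra\<close>

lemma cliff_apply:
  "cliff w *v \<psi> = vector
    [w$3 * \<psi>$1 + w$2 * \<psi>$2 + (w$1 + w$4) * \<psi>$3,
     w$2 * \<psi>$1 - w$3 * \<psi>$2 + (w$1 + w$4) * \<psi>$4,
     (w$1 - w$4) * \<psi>$1 - w$3 * \<psi>$3 - w$2 * \<psi>$4,
     (w$1 - w$4) * \<psi>$2 - w$2 * \<psi>$3 + w$3 * \<psi>$4]"
  by (simp add: vec_eq_iff forall_4 cliff_def gamma_def matrix_vector_mult_def sum_4 algebra_simps)

definition volume_element :: "real^4^4" where
  "volume_element = gamma 1 ** gamma 2 ** gamma 3 ** gamma 4"

lemma gamma4_apply: "gamma 4 *v \<psi> = vector [\<psi>$3, \<psi>$4, - \<psi>$1, - \<psi>$2]"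
  by (simp add: vec_eq_iff forall_4 gamma_def matrix_vector_mult_def sum_4)

lemma volume_element_apply: "volume_element *v \<psi> = vector [\<psi>$2, - \<psi>$1, - \<psi>$4, \<psi>$3]"
  by (simp add: vec_eq_iff forall_4 volume_element_def gamma_def matrix_vector_mult_def
      matrix_matrix_mult_def sum_4)

text \<open>The value on \<open>w\<close> of the one-form metrically dual to the Dirac current.\<close>

definition current :: "real^4 \<Rightarrow> real^4 \<Rightarrow> real" where
  "current \<epsilon> w = \<epsilon> \<bullet> (gamma 4 *v (cliff w *v \<epsilon>))"

text \<open>For \<open>P\<close> the identity this is the two-form of the spinor, for \<open>P\<close> the volume element it is its Hodge
  dual up to sign. In both cases the symmetric part \<open>\<langle>w, w'\<rangle> B(\<epsilon>, P \<epsilon>)\<close> vanishes, since \<open>\<gamma>\<^sub>4 P\<close> is a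
  skew matrix.\<close>

definition two_form :: "real^4^4 \<Rightarrow> real^4 \<Rightarrow> real^4 \<Rightarrow> real^4 \<Rightarrow> real" where
  "two_form P \<epsilon> w w' = \<epsilon> \<bullet> (gamma 4 *v (cliff w *v (cliff w' *v (P *v \<epsilon>))))"

lemma inner_4: "(x :: real^4) \<bullet> y = x$1*y$1 + x$2*y$2 + x$3*y$3 + x$4*y$4"
  by (simp add: inner_vec_def sum_4)

lemma mink_4: "mink x y = x$1*y$1 + x$2*y$2 + x$3*y$3 - x$4*y$4"
  by (simp add: mink_def eta_def sum_4)

lemmas spinor_coords = current_def two_form_def inner_4 mink_4 gamma4_apply cliff_apply
  volume_element_apply matrix_vector_mul_lid

text \<open>The wedge product of the current with the two-form is zero. If \<open>current \<epsilon> z = 1\<close>, the two-form is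
  therefore the wedge product of the current with its own contraction by \<open>z\<close>. This is a polynomial
  identity of degree four in the spinor.\<close>

lemma fierz_two_form_simple:
  "current \<epsilon> z * two_form (mat 1) \<epsilon> w w' =
   current \<epsilon> w * two_form (mat 1) \<epsilon> z w' - current \<epsilon> w' * two_form (mat 1) \<epsilon> z w"
  unfolding spinor_coords vector_4_nth by algebra

lemma fierz_dual_two_form_simple:
  "current \<epsilon> z * two_form volume_element \<epsilon> w w' =
   current \<epsilon> w * two_form volume_element \<epsilon> z w' - current \<epsilon> w' * two_form volume_element \<epsilon> z w"
  unfolding spinor_coords vector_4_nth by algebra

text \<open>For \<open>current \<epsilon> e = 1\<close> and \<open>current \<epsilon> w = 0\<close> the right-hand side is \<open>\<langle>w, w\<rangle>\<close>: the contractions of the two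
  forms by \<open>e\<close> are an orthonormal coframe of the screen space of the current.\<close>

lemma fierz_norm:
  "(two_form (mat 1) \<epsilon> e w)^2 + (two_form volume_element \<epsilon> e w)^2 =
   (current \<epsilon> e)^2 * mink w w - 2 * current \<epsilon> e * current \<epsilon> w * mink e w + (current \<epsilon> w)^2 * mink e e"
  unfolding spinor_coords vector_4_nth by algebra


lemma cliff_skew:
  "(cliff w *v \<psi>) \<bullet> (gamma 4 *v (cliff w *v \<phi>)) = - mink w w * (\<psi> \<bullet> (gamma 4 *v \<phi>))"
  unfolding spinor_coords vector_4_nth by algebra

lemma volume_element_cliff:
  "volume_element *v (cliff w *v \<psi>) = - (cliff w *v (volume_element *v \<psi>))"
  by (simp add: vec_eq_iff forall_4 cliff_apply volume_element_apply algebra_simps)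

text \<open>A spacelike unit vector reverses the sign of the pairing and a timelike one preserves it, so that only
  the parity of the number of spacelike factors matters.\<close>

lemma foldr_cliff_pairing:
  assumes "\<And>w. w \<in> set ws \<Longrightarrow> mink w w = 1 \<or> mink w w = -1"
  shows "((foldr (\<lambda>w S. cliff w ** S) ws (mat 1)) *v \<psi>) \<bullet>
      (gamma 4 *v ((foldr (\<lambda>w S. cliff w ** S) ws (mat 1)) *v \<phi>))
    = (-1) ^ length (filter (\<lambda>w. mink w w = 1) ws) * (\<psi> \<bullet> (gamma 4 *v \<phi>))"
  using assms
proof (induction ws)
  case (Cons w ws)
  have "mink w w = 1 \<or> mink w w = -1" using Cons.prems[of w] by simp
  moreover note IH = Cons.IH[OF Cons.prems[OF list.set_intros(2)]]
  ultimately show ?case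
    by (elim disjE) (simp_all add: matrix_vector_mul_assoc[symmetric] cliff_skew IH)
qed (simp add: matrix_vector_mul_lid)

lemma foldr_cliff_volume_element:
  "volume_element *v ((foldr (\<lambda>w S. cliff w ** S) ws (mat 1)) *v \<psi>)
    = (-1) ^ length ws *\<^sub>R ((foldr (\<lambda>w S. cliff w ** S) ws (mat 1)) *v (volume_element *v \<psi>))"
  by (induction ws)
    (simp_all add: matrix_vector_mul_lid matrix_vector_mul_assoc[symmetric] volume_element_cliff
      matrix_vector_mult_scaleR)

lemma Spin_plus_pairing:
  assumes "h \<in> Spin_plus"
  shows "(h *v \<psi>) \<bullet> (gamma 4 *v (h *v \<phi>)) = \<psi> \<bullet> (gamma 4 *v \<phi>)"
  using assms unfolding Spin_plus_def by (auto simp: foldr_cliff_pairing)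

lemma Spin_plus_volume_element:
  assumes "h \<in> Spin_plus"
  shows "volume_element *v (h *v \<psi>) = h *v (volume_element *v \<psi>)"
proof -
  obtain ws where ws: "h = foldr (\<lambda>w S. cliff w ** S) ws (mat 1)"
    "\<forall>w \<in> set ws. mink w w = 1 \<or> mink w w = -1"
    "even (length (filter (\<lambda>w. mink w w = 1) ws))"
    "even (length (filter (\<lambda>w. mink w w = -1) ws))"
    using assms unfolding Spin_plus_def by auto
  have "filter (\<lambda>w. mink w w = -1) ws = filter (\<lambda>w. \<not> mink w w = 1) ws"
    by (rule filter_cong) (use ws(2) in auto)
  then have "even (length (filter (\<lambda>w. mink w w = 1) ws) + length (filter (\<lambda>w. \<not> mink w w = 1) ws))"
    using ws(3,4) by simp
  then have "even (length ws)" unfolding sum_length_filter_compl .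
  then show ?thesis unfolding ws(1) foldr_cliff_volume_element by simp
qed

text \<open>The isomorphism from skew matrices onto the spin Lie algebra, with indices lowered; the connection
  matrix of a frame is mapped to the spin connection.\<close>

definition spin_lift :: "(4 \<Rightarrow> 4 \<Rightarrow> real) \<Rightarrow> real^4^4" where
  "spin_lift M = (1/4) *\<^sub>R (\<Sum>a\<in>UNIV. \<Sum>b\<in>UNIV. (eta a * eta b * M a b) *\<^sub>R (gamma a ** gamma b))"


lemma spin_lift_coords:
  assumes skew: "\<And>a b. M a b = - M b a"
  shows "spin_lift M *v \<psi> = (1/2) *\<^sub>R vector
    [M 1 4 * \<psi>$1 - M 2 3 * \<psi>$2 - (M 1 3 + M 3 4) * \<psi>$3 - (M 1 2 + M 2 4) * \<psi>$4,
     M 2 3 * \<psi>$1 + M 1 4 * \<psi>$2 - (M 1 2 + M 2 4) * \<psi>$3 + (M 1 3 + M 3 4) * \<psi>$4,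
     (M 1 3 - M 3 4) * \<psi>$1 + (M 1 2 - M 2 4) * \<psi>$2 - M 1 4 * \<psi>$3 - M 2 3 * \<psi>$4,
     (M 1 2 - M 2 4) * \<psi>$1 - (M 1 3 - M 3 4) * \<psi>$2 + M 2 3 * \<psi>$3 - M 1 4 * \<psi>$4]"
proof -
  have diag: "M a a = 0" for a using skew[of a a] by simp
  have sw: "M 2 1 = - M 1 2" "M 3 1 = - M 1 3" "M 3 2 = - M 2 3"
    "M 4 1 = - M 1 4" "M 4 2 = - M 2 4" "M 4 3 = - M 3 4"
    using skew by blast+
  have "spin_lift M *v \<psi> = (1/4) *\<^sub>R (\<Sum>a\<in>UNIV. \<Sum>b\<in>UNIV.
      (eta a * eta b * M a b) *\<^sub>R (gamma a *v (gamma b *v \<psi>)))"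
    unfolding spin_lift_def
    by (simp add: sum_4 scaleR_matrix_vector_assoc[symmetric] matrix_vector_mult_add_rdistrib
        matrix_vector_mul_assoc)
  then show ?thesis
    by (simp add: sum_4 diag sw eta_def vec_eq_iff forall_4 gamma_def matrix_vector_mult_def algebra_simps)
qed

lemma spin_lift_pairing:
  assumes skew: "\<And>a b. M a b = - M b a"
  shows "(spin_lift M *v \<psi>) \<bullet> (gamma 4 *v \<phi>) = - (\<psi> \<bullet> (gamma 4 *v (spin_lift M *v \<phi>)))"
  by (simp add: spin_lift_coords[OF skew] spinor_coords algebra_simps)

lemma spin_lift_volume_element:
  assumes skew: "\<And>a b. M a b = - M b a"
  shows "spin_lift M *v (volume_element *v \<psi>) = volume_element *v (spin_lift M *v \<psi>)"
  by (simp add: spin_lift_coords[OF skew] volume_element_apply vec_eq_iff forall_4 algebra_simps)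

text \<open>The commutator with \<open>spin_lift M\<close> is Clifford multiplication by the image of the vector under the
  skew endomorphism with matrix \<open>M\<close>. This is what makes Clifford multiplication parallel.\<close>

lemma spin_lift_commutator:
  assumes skew: "\<And>a b. M a b = - M b a"
  shows "spin_lift M *v (cliff c *v \<psi>) - cliff c *v (spin_lift M *v \<psi>)
    = cliff (\<chi> a. eta a * (\<Sum>b\<in>UNIV. M a b * c $ b)) *v \<psi>"
proof -
  have diag: "M a a = 0" for a using skew[of a a] by simp
  have sw: "M 2 1 = - M 1 2" "M 3 1 = - M 1 3" "M 3 2 = - M 2 3"
    "M 4 1 = - M 1 4" "M 4 2 = - M 2 4" "M 4 3 = - M 3 4"
    using skew by blast+
  show ?thesis
    by (simp add: spin_lift_coords[OF skew] cliff_apply vec_eq_iff forall_4 sum_4 eta_def diag sw field_simps)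
qed

text \<open>The stabilizer of the spinor \<open>(1, 0, 0, 0)\<close>: skew endomorphisms that kill the null vector \<open>e\<^sub>1 + e\<^sub>4\<close>
  and do not rotate its screen space.\<close>

lemma spin_lift_annihilates:
  assumes skew: "\<And>a b. M a b = - M b a" and "\<And>a. M a 1 + M a 4 = 0" and "M 2 3 = 0"
  shows "spin_lift M *v axis 1 1 = 0"
proof -
  have "M 1 1 = 0" using skew[of 1 1] by simp
  then have "M 1 4 = 0" "M 1 2 = M 2 4" "M 1 3 = M 3 4"
    using assms(2)[of 1] assms(2)[of 2] assms(2)[of 3] skew[of 1 2] skew[of 1 3] by auto
  then show ?thesis using assms(3)
    by (simp add: spin_lift_coords[OF skew] vec_eq_iff forall_4 axis_def)
qed

section \<open>Metrics in coordinates\<close>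

lemma bilinear_expand:
  fixes B :: "'a::euclidean_space \<Rightarrow> 'b::euclidean_space \<Rightarrow> real"
  assumes "bilinear B"
  shows "B v w = (\<Sum>b\<in>Basis. \<Sum>c\<in>Basis. (v \<bullet> b) * (w \<bullet> c) * B b c)"
proof -
  have "B v w = B (\<Sum>b\<in>Basis. (v \<bullet> b) *\<^sub>R b) (\<Sum>c\<in>Basis. (w \<bullet> c) *\<^sub>R c)"
    by (simp add: euclidean_representation)
  also have "\<dots> = (\<Sum>(b, c)\<in>Basis \<times> Basis. B ((v \<bullet> b) *\<^sub>R b) ((w \<bullet> c) *\<^sub>R c))"
    by (rule bilinear_sum[OF assms])
  also have "\<dots> = (\<Sum>b\<in>Basis. \<Sum>c\<in>Basis. (v \<bullet> b) * (w \<bullet> c) * B b c)"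
    unfolding sum.cartesian_product[symmetric]
    by (simp add: bilinear_lmul[OF assms] bilinear_rmul[OF assms] mult_ac)
  finally show ?thesis .
qed

text \<open>The product rule for \<open>G p (Y p) (W p)\<close> when only the functions \<open>G p v w\<close> with constant arguments are
  known to be differentiable: expanding in a basis reduces it to finitely many products.\<close>

lemma has_derivative_bilinear_family:
  fixes G :: "'e::real_normed_vector \<Rightarrow> 'a::euclidean_space \<Rightarrow> 'b::euclidean_space \<Rightarrow> real"
  assumes V: "open V" "y \<in> V" and bil: "\<And>p. p \<in> V \<Longrightarrow> bilinear (G p)"
    and G: "\<And>v w. (\<lambda>p. G p v w) differentiable at y"
    and Y: "(Y has_derivative Y') (at y)" and W: "(W has_derivative W') (at y)"
  shows "((\<lambda>p. G p (Y p) (W p)) has_derivative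
    (\<lambda>z. frechet_derivative (\<lambda>p. G p (Y y) (W y)) (at y) z + G y (Y' z) (W y) + G y (Y y) (W' z))) (at y)"
proof -
  define D where "D = (\<lambda>b c. frechet_derivative (\<lambda>p. G p b c) (at y))"
  have D: "((\<lambda>p. G p b c) has_derivative D b c) (at y)" for b c
    unfolding D_def using G frechet_derivative_works by blast
  have E: "((\<lambda>p. G p (A p) (B p)) has_derivative (\<lambda>z. \<Sum>b\<in>Basis. \<Sum>c\<in>Basis.
      (A y \<bullet> b) * (B y \<bullet> c) * D b c z + ((A y \<bullet> b) * (B' z \<bullet> c) + (A' z \<bullet> b) * (B y \<bullet> c)) * G y b c)) (at y)"
    if A: "(A has_derivative A') (at y)" and B: "(B has_derivative B') (at y)" for A A' B B'
  proof (rule has_derivative_transform_within_open[OF _ V])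
    show "((\<lambda>p. \<Sum>b\<in>Basis. \<Sum>c\<in>Basis. (A p \<bullet> b) * (B p \<bullet> c) * G p b c) has_derivative (\<lambda>z. \<Sum>b\<in>Basis. \<Sum>c\<in>Basis.
      (A y \<bullet> b) * (B y \<bullet> c) * D b c z + ((A y \<bullet> b) * (B' z \<bullet> c) + (A' z \<bullet> b) * (B y \<bullet> c)) * G y b c)) (at y)"
      by (rule has_derivative_sum, rule has_derivative_sum)
         (rule has_derivative_mult[OF has_derivative_mult[OF has_derivative_inner_left[OF A]
            has_derivative_inner_left[OF B]] D])
    show "(\<Sum>b\<in>Basis. \<Sum>c\<in>Basis. (A p \<bullet> b) * (B p \<bullet> c) * G p b c) = G p (A p) (B p)" if "p \<in> V" for p
      by (rule bilinear_expand[OF bil[OF that], symmetric])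
  qed
  have *: "frechet_derivative (\<lambda>p. G p (Y y) (W y)) (at y) z =
      (\<Sum>b\<in>Basis. \<Sum>c\<in>Basis. (Y y \<bullet> b) * (W y \<bullet> c) * D b c z)" for z
    using has_derivative_frechet_eq[OF E[OF has_derivative_const[of "Y y"] has_derivative_const[of "W y"]]] by simp
  have eq: "(\<lambda>z. frechet_derivative (\<lambda>p. G p (Y y) (W y)) (at y) z + G y (Y' z) (W y) + G y (Y y) (W' z))
    = (\<lambda>z. \<Sum>b\<in>Basis. \<Sum>c\<in>Basis.
      (Y y \<bullet> b) * (W y \<bullet> c) * D b c z + ((Y y \<bullet> b) * (W' z \<bullet> c) + (Y' z \<bullet> b) * (W y \<bullet> c)) * G y b c)"
    unfolding * bilinear_expand[OF bil[OF V(2)], of "Y' _" "W y"] bilinear_expand[OF bil[OF V(2)], of "Y y" "W' _"]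
    by (simp add: sum.distrib distrib_right add_ac)
  show ?thesis unfolding eq by (rule E[OF Y W])
qed

lemma smooth_map_on_bilinear_family:
  fixes G :: "'e::real_normed_vector \<Rightarrow> 'a::euclidean_space \<Rightarrow> 'b::euclidean_space \<Rightarrow> real"
  assumes V: "open V" and bil: "\<And>p. p \<in> V \<Longrightarrow> bilinear (G p)"
    and G: "\<And>v w. smooth_map_on V (\<lambda>p. G p v w)"
    and Y: "smooth_map_on V Y" and W: "smooth_map_on V W"
  shows "smooth_map_on V (\<lambda>p. G p (Y p) (W p))"
proof -
  have "smooth_map_on V (\<lambda>p. \<Sum>b\<in>Basis. \<Sum>c\<in>Basis. (Y p \<bullet> b) * (W p \<bullet> c) * G p b c)"
    by (intro smooth_map_on_sum[OF V] smooth_map_on_mult[OF V] G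
        smooth_map_on_linear_image[OF V bounded_linear_inner_left] Y W)
  then show ?thesis
    by (subst smooth_map_on_cong[OF V bilinear_expand[OF bil]])
qed

text \<open>The existence behind every definite description in the definitions of Christoffel symbols and of
  metric duals.\<close>

lemma nondegenerate_representation:
  fixes B :: "'e::euclidean_space \<Rightarrow> 'e \<Rightarrow> real"
  assumes B: "bilinear B" and nondeg: "\<And>z. (\<And>a. B z a = 0) \<Longrightarrow> z = 0" and "linear \<omega>"
  shows "\<exists>!z. \<forall>a. B z a = \<omega> a"
proof -
  define T where "T = (\<lambda>z. \<Sum>b\<in>Basis. B z b *\<^sub>R b)"
  have Tb: "T z \<bullet> a = B z a" for z a
  proof -
    have "T z \<bullet> a = (\<Sum>b\<in>Basis. (a \<bullet> b) * B z b)"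
      unfolding T_def inner_sum_left by (simp add: inner_commute mult.commute)
    also have "\<dots> = B z (\<Sum>b\<in>Basis. (a \<bullet> b) *\<^sub>R b)"
      using B by (simp add: bilinear_def linear_sum linear_cmul)
    finally show ?thesis by (simp add: euclidean_representation)
  qed
  have lin: "linear T"
    by (rule linearI) (simp_all add: T_def bilinear_ladd[OF B] bilinear_lmul[OF B] scaleR_add_left
        sum.distrib scaleR_sum_right)
  have inj: "inj T"
  proof (rule linear_injective_0[OF lin, THEN iffD2], intro allI impI)
    fix z assume "T z = 0"
    then show "z = 0" using Tb[of z] nondeg by simp
  qed
  have *: "(\<forall>a. B z a = \<omega> a) \<longleftrightarrow> T z = (\<Sum>b\<in>Basis. \<omega> b *\<^sub>R b)" for z
  proof -
    have "(\<Sum>b\<in>Basis. \<omega> b *\<^sub>R b) \<bullet> a = \<omega> a" for a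
    proof -
      have "(\<Sum>b\<in>Basis. \<omega> b *\<^sub>R b) \<bullet> a = \<omega> (\<Sum>b\<in>Basis. (a \<bullet> b) *\<^sub>R b)"
        using assms(3) unfolding inner_sum_left by (simp add: linear_sum linear_cmul inner_commute mult.commute)
      then show ?thesis by (simp add: euclidean_representation)
    qed
    then have "(\<forall>a. B z a = \<omega> a) \<longleftrightarrow> (\<forall>a. T z \<bullet> a = (\<Sum>b\<in>Basis. \<omega> b *\<^sub>R b) \<bullet> a)"
      using Tb by simp
    then show ?thesis by (simp only: vector_eq_rdot)
  qed
  obtain z where "T z = (\<Sum>b\<in>Basis. \<omega> b *\<^sub>R b)"
    using linear_injective_imp_surjective[OF lin inj] by (metis surjD)
  moreover from this have "z' = z" if "T z' = (\<Sum>b\<in>Basis. \<omega> b *\<^sub>R b)" for z'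
    using injD[OF inj, of z' z] that by simp
  ultimately show ?thesis unfolding * by (rule ex1I)
qed

text \<open>The Christoffel symbol of a metric given in coordinates. The metric is a function on the whole
  vector space, so that \<open>q i (chart_inv A i y)\<close> can be used for it without restriction to the chart.\<close>

definition coord_christoffel ::
  "('e::real_normed_vector \<Rightarrow> 'e \<Rightarrow> 'e \<Rightarrow> real) \<Rightarrow> 'e \<Rightarrow> 'e \<Rightarrow> 'e \<Rightarrow> 'e" where
  "coord_christoffel G y v w = (THE z. \<forall>a. G y z a =
     (frechet_derivative (\<lambda>p. G p w a) (at y) v + frechet_derivative (\<lambda>p. G p v a) (at y) w
      - frechet_derivative (\<lambda>p. G p v w) (at y) a) / 2)"

lemma christoffel_in_chart:
  assumes "chart_inv A i (chart_map A i x) = x"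
  shows "christoffel A g i x v w = coord_christoffel (\<lambda>y. g i (chart_inv A i y)) (chart_map A i x) v w"
  unfolding christoffel_def coord_christoffel_def chart_D_def assms ..

text \<open>A pseudo-Riemannian metric on an open subset of a vector space. It stands for the metrics \<open>q\<^sub>u\<close> on \<open>X\<close> and
  for the Lorentzian metric on \<open>\<real>\<^sup>2 \<times> X\<close> alike.\<close>

locale coordinate_metric =
  fixes V :: "'e::euclidean_space set" and G :: "'e \<Rightarrow> 'e \<Rightarrow> 'e \<Rightarrow> real"
  assumes open_dom: "open V"
    and bilinear: "\<And>y. y \<in> V \<Longrightarrow> bilinear (G y)"
    and symmetric: "\<And>y v w. y \<in> V \<Longrightarrow> G y v w = G y w v"
    and nondegenerate: "\<And>y z. y \<in> V \<Longrightarrow> (\<And>a. G y z a = 0) \<Longrightarrow> z = 0"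
    and differentiable: "\<And>y v w. y \<in> V \<Longrightarrow> (\<lambda>p. G p v w) differentiable at y"
begin

abbreviation dG where "dG y v w \<equiv> frechet_derivative (\<lambda>p. G p v w) (at y)"

lemma has_derivative_metric: "y \<in> V \<Longrightarrow> ((\<lambda>p. G p v w) has_derivative dG y v w) (at y)"
  using differentiable by (simp add: frechet_derivative_works)

lemma linear_dG: "y \<in> V \<Longrightarrow> linear (dG y v w)"
  by (rule has_derivative_linear[OF has_derivative_metric])

lemma dG_add: assumes "y \<in> V" shows "dG y v (w + w') z = dG y v w z + dG y v w' z"
  by (rule has_derivative_frechet_eq, rule has_derivative_transform_within_open[OF
      has_derivative_add[OF has_derivative_metric[OF assms, of v w] has_derivative_metric[OF assms, of v w']] open_dom assms])
     (simp add: bilinear_radd bilinear)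

lemma dG_scale: assumes "y \<in> V" shows "dG y v (c *\<^sub>R w) z = c * dG y v w z"
  by (rule has_derivative_frechet_eq, rule has_derivative_transform_within_open[OF
      has_derivative_mult_right[OF has_derivative_metric[OF assms, of v w]] open_dom assms])
     (simp add: bilinear_rmul bilinear)

lemma dG_sym: assumes "y \<in> V" shows "dG y v w z = dG y w v z"
  by (rule has_derivative_frechet_eq, rule has_derivative_transform_within_open[OF
      has_derivative_metric[OF assms, of w v] open_dom assms])
     (simp add: symmetric)

lemma koszul:
  assumes y: "y \<in> V"
  shows "G y (coord_christoffel G y v w) a = (dG y w a v + dG y v a w - dG y v w a) / 2"
proof -
  have "linear (\<lambda>a. (dG y w a v + dG y v a w - dG y v w a) / 2)"
    by (rule linearI)
       (simp_all add: dG_add[OF y] dG_scale[OF y] linear_add[OF linear_dG[OF y]] linear_cmul[OF linear_dG[OF y]]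
        field_simps)
  from theI'[OF nondegenerate_representation[OF bilinear[OF y] nondegenerate[OF y] this]]
  show ?thesis unfolding coord_christoffel_def by (rule spec)
qed

lemma christoffel_unique:
  assumes y: "y \<in> V" and z: "\<And>a. G y z a = (dG y w a v + dG y v a w - dG y v w a) / 2"
  shows "coord_christoffel G y v w = z"
proof -
  have "G y (coord_christoffel G y v w - z) a = 0" for a
    by (simp add: bilinear_lsub[OF bilinear[OF y]] koszul[OF y] z)
  from nondegenerate[OF y this] show ?thesis by simp
qed

lemma christoffel_sym:
  assumes y: "y \<in> V" shows "coord_christoffel G y v w = coord_christoffel G y w v"
  by (rule christoffel_unique[OF y]) (simp add: koszul[OF y] dG_sym[OF y, of v w])

lemma linear_christoffel:
  assumes y: "y \<in> V" shows "linear (coord_christoffel G y v)"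
proof (rule linearI)
  note lin = dG_add[OF y] dG_scale[OF y] linear_add[OF linear_dG[OF y]] linear_cmul[OF linear_dG[OF y]]
    dG_sym[OF y, of "_ + _"] dG_sym[OF y, of "_ *\<^sub>R _"]
  show "coord_christoffel G y v (a + b) = coord_christoffel G y v a + coord_christoffel G y v b" for a b
    by (rule christoffel_unique[OF y])
       (simp add: bilinear_ladd[OF bilinear[OF y]] koszul[OF y] lin dG_sym[OF y, of a] dG_sym[OF y, of b] field_simps)
  show "coord_christoffel G y v (c *\<^sub>R a) = c *\<^sub>R coord_christoffel G y v a" for c a
    by (rule christoffel_unique[OF y])
       (simp add: bilinear_lmul[OF bilinear[OF y]] koszul[OF y] lin dG_sym[OF y, of a] field_simps)
qed

lemma metric_compatible_const:
  assumes y: "y \<in> V"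
  shows "dG y v w z = G y (coord_christoffel G y z v) w + G y v (coord_christoffel G y z w)"
  by (simp add: symmetric[OF y, of v] koszul[OF y] dG_sym[OF y, of w v] field_simps)

lemma metric_compatible:
  assumes y: "y \<in> V" and Y: "(Y has_derivative Y') (at y)" and W: "(W has_derivative W') (at y)"
  shows "((\<lambda>p. G p (Y p) (W p)) has_derivative
    (\<lambda>z. G y (Y' z + coord_christoffel G y z (Y y)) (W y)
       + G y (Y y) (W' z + coord_christoffel G y z (W y)))) (at y)"
proof -
  have "(\<lambda>z. dG y (Y y) (W y) z + G y (Y' z) (W y) + G y (Y y) (W' z)) =
    (\<lambda>z. G y (Y' z + coord_christoffel G y z (Y y)) (W y)
       + G y (Y y) (W' z + coord_christoffel G y z (W y)))"
    by (simp add: metric_compatible_const[OF y] bilinear_ladd[OF bilinear[OF y]]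
        bilinear_radd[OF bilinear[OF y]] fun_eq_iff)
  with has_derivative_bilinear_family[OF open_dom y bilinear differentiable[OF y] Y W]
  show ?thesis by simp
qed

end

section \<open>Parallel spinors in a frame\<close>

lemma bounded_bilinear_cliff: "bounded_bilinear (\<lambda>c \<psi>. cliff c *v \<psi>)"
  unfolding bilinear_conv_bounded_bilinear[symmetric] bilinear_def
  by (auto simp: linear_iff vec_eq_iff forall_4 cliff_apply algebra_simps)

lemma linear_cliff: "cliff (c + d) *v \<psi> = cliff c *v \<psi> + cliff d *v \<psi>"
  "cliff (c - d) *v \<psi> = cliff c *v \<psi> - cliff d *v \<psi>"
  "cliff (r *\<^sub>R c) *v \<psi> = r *\<^sub>R (cliff c *v \<psi>)"
  "cliff 0 *v \<psi> = 0"
  "cliff c *v (\<psi> + \<phi>) = cliff c *v \<psi> + cliff c *v \<phi>"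
  "cliff c *v (\<psi> - \<phi>) = cliff c *v \<psi> - cliff c *v \<phi>"
  by (simp_all add: bounded_bilinear.add_left[OF bounded_bilinear_cliff] bounded_bilinear.diff_left[OF bounded_bilinear_cliff]
    bounded_bilinear.scaleR_left[OF bounded_bilinear_cliff] bounded_bilinear.zero_left[OF bounded_bilinear_cliff]
    bounded_bilinear.add_right[OF bounded_bilinear_cliff] bounded_bilinear.diff_right[OF bounded_bilinear_cliff])

lemma bounded_linear_matrix: "bounded_linear (\<lambda>\<psi>. (A :: real^'n^'m) *v \<psi>)"
  by simp

text \<open>The identity and the volume element commute with all even elements of the Clifford algebra, and this
  makes \<open>two_form\<close> natural for either of them.\<close>

definition chirality_operators :: "(real^4^4) set" where
  "chirality_operators = {mat 1, volume_element}"

lemma bilinear_two_form: "bilinear (two_form P \<epsilon>)"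
  unfolding bilinear_def two_form_def
  by (auto simp: linear_iff linear_cliff matrix_vector_right_distrib inner_add_right matrix_vector_mult_scaleR
     bounded_bilinear.scaleR_right[OF bounded_bilinear_cliff])

text \<open>The derivative of \<open>two_form P \<psi> c k\<close> when the spinor and both vectors are moved by the same
  infinitesimal rotation \<open>M\<close>, and the vectors in addition by \<open>d\<close> and \<open>e\<close>: the rotation drops out
  by invariance of the pairing.\<close>

lemma two_form_infinitesimal:
  assumes skew: "\<And>a b. M a b = - M b a" and P: "P \<in> chirality_operators"
    and c': "c' = d - (\<chi> a. eta a * (\<Sum>b\<in>UNIV. M a b * c $ b))"
    and k': "k' = e - (\<chi> a. eta a * (\<Sum>b\<in>UNIV. M a b * k $ b))"
    and \<psi>: "\<psi>' = - (spin_lift M *v \<psi>)"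
  shows "\<psi>' \<bullet> (gamma 4 *v (cliff c *v (cliff k *v (P *v \<psi>))))
      + \<psi> \<bullet> (gamma 4 *v (cliff c' *v (cliff k *v (P *v \<psi>))))
      + \<psi> \<bullet> (gamma 4 *v (cliff c *v (cliff k' *v (P *v \<psi>))))
      + \<psi> \<bullet> (gamma 4 *v (cliff c *v (cliff k *v (P *v \<psi>'))))
    = two_form P \<psi> d k + two_form P \<psi> c e"
proof -
  define \<Omega> where "\<Omega> = (\<lambda>\<phi>. spin_lift M *v \<phi>)"
  have C: "cliff (\<chi> a. eta a * (\<Sum>b\<in>UNIV. M a b * c $ b)) *v \<phi> = \<Omega> (cliff c *v \<phi>) - cliff c *v \<Omega> \<phi>" for c \<phi>
    unfolding \<Omega>_def spin_lift_commutator[OF skew] ..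
  have P': "P *v (- \<Omega> \<psi>) = - \<Omega> (P *v \<psi>)"
    using P spin_lift_volume_element[OF skew] unfolding chirality_operators_def \<Omega>_def
    by (auto simp: matrix_vector_mul_lid vec.neg)
  have B: "\<Omega> \<psi> \<bullet> (gamma 4 *v \<phi>) = - (\<psi> \<bullet> (gamma 4 *v \<Omega> \<phi>))" for \<phi>
    unfolding \<Omega>_def by (rule spin_lift_pairing[OF skew])
  have neg: "cliff c *v (- \<phi>) = - (cliff c *v \<phi>)" for c \<phi> by (simp add: vec.neg)
  show ?thesis
    unfolding \<psi> c' k' two_form_def linear_cliff C \<Omega>_def[symmetric] P'
    by (simp add: inner_minus_left B linear_cliff neg vec.neg vec.diff inner_diff_right)
qed

lemma has_derivative_two_form:
  assumes \<psi>: "(\<psi> has_derivative \<psi>') (at y)" and c: "(c has_derivative c') (at y)"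
    and k: "(k has_derivative k') (at y)"
  shows "((\<lambda>p. two_form P (\<psi> p) (c p) (k p)) has_derivative (\<lambda>z.
      \<psi>' z \<bullet> (gamma 4 *v (cliff (c y) *v (cliff (k y) *v (P *v \<psi> y))))
      + \<psi> y \<bullet> (gamma 4 *v (cliff (c' z) *v (cliff (k y) *v (P *v \<psi> y))))
      + \<psi> y \<bullet> (gamma 4 *v (cliff (c y) *v (cliff (k' z) *v (P *v \<psi> y))))
      + \<psi> y \<bullet> (gamma 4 *v (cliff (c y) *v (cliff (k y) *v (P *v \<psi>' z)))))) (at y)"
proof -
  note cl = bounded_bilinear.FDERIV[OF bounded_bilinear_cliff]
  note mv = bounded_linear.has_derivative[OF bounded_linear_matrix]
  show ?thesis unfolding two_form_def
    by (rule has_derivative_eq_rhs[OF bounded_bilinear.FDERIV[OF bounded_bilinear_inner \<psi>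
          mv[OF cl[OF c cl[OF k mv[OF \<psi>]]]]]])
       (simp add: fun_eq_iff matrix_vector_right_distrib linear_cliff inner_add_right add_ac)
qed

lemma smooth_map_on_two_form:
  assumes "open S" "smooth_map_on S \<psi>" "smooth_map_on S c" "smooth_map_on S k"
  shows "smooth_map_on S (\<lambda>p. two_form P (\<psi> p) (c p) (k p))"
  unfolding two_form_def
  by (intro smooth_map_on_bilinear[OF assms(1) bounded_bilinear_inner]
      smooth_map_on_bilinear[OF assms(1) bounded_bilinear_cliff]
      smooth_map_on_linear_image[OF assms(1) bounded_linear_matrix] assms)

text \<open>The coordinates of a vector in an orthonormal frame \<open>e\<close>: the factor \<open>eta a\<close> is the sign of
  \<open>g (e a) (e a)\<close>.\<close>

definition frame_components ::
  "('e \<Rightarrow> 'e \<Rightarrow> real) \<Rightarrow> (4 \<Rightarrow> 'e) \<Rightarrow> 'e \<Rightarrow> real^4" where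
  "frame_components g e w = (\<chi> a. eta a * g (e a) w)"

lemma eta_square [simp]: "eta a * eta a = 1" "eta a * (eta a * x) = x"
  by (simp_all add: eta_def)

locale lorentz_frame =
  fixes g :: "'e::euclidean_space \<Rightarrow> 'e \<Rightarrow> real" and e :: "4 \<Rightarrow> 'e"
  assumes bilinear_g: "bilinear g" and sym_g: "g v w = g w v"
    and orthonormal: "g (e a) (e b) = (if a = b then eta a else 0)"
    and spanning: "\<And>w. \<exists>c. w = (\<Sum>a\<in>UNIV. c a *\<^sub>R e a)"
begin

lemma frame_components_sum: "frame_components g e (\<Sum>a\<in>UNIV. c a *\<^sub>R e a) = (\<chi> a. c a)"
proof -
  have "g (e b) (\<Sum>a\<in>UNIV. c a *\<^sub>R e a) = c b * eta b" for b
  proof -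
    have "g (e b) (\<Sum>a\<in>UNIV. c a *\<^sub>R e a) = (\<Sum>a\<in>UNIV. c a * g (e b) (e a))"
      using bilinear_g by (simp add: bilinear_def linear_sum linear_cmul)
    also have "\<dots> = (\<Sum>a\<in>UNIV. if b = a then c a * eta a else 0)"
      unfolding orthonormal by (intro sum.cong) auto
    finally show ?thesis by simp
  qed
  then show ?thesis by (simp add: frame_components_def vec_eq_iff mult.left_commute)
qed

lemma frame_expansion: "w = (\<Sum>a\<in>UNIV. frame_components g e w $ a *\<^sub>R e a)"
proof -
  obtain c where c: "w = (\<Sum>a\<in>UNIV. c a *\<^sub>R e a)" using spanning by blast
  show ?thesis by (subst (2) c, subst frame_components_sum) (simp add: c)
qed

lemma linear_frame_components: "linear (frame_components g e)"
  by (rule linearI)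
    (simp_all add: frame_components_def vec_eq_iff bilinear_radd[OF bilinear_g] bilinear_rmul[OF bilinear_g] algebra_simps)

lemma metric_expansion: "g v w = (\<Sum>a\<in>UNIV. frame_components g e v $ a * g (e a) w)"
proof -
  have "g v w = g (\<Sum>a\<in>UNIV. frame_components g e v $ a *\<^sub>R e a) w"
    using frame_expansion[of v] by simp
  also have "\<dots> = (\<Sum>a\<in>UNIV. frame_components g e v $ a * g (e a) w)"
    by (simp add: sym_g[of _ w]) (use bilinear_g in \<open>simp add: bilinear_def linear_sum linear_cmul\<close>)
  finally show ?thesis .
qed

lemma mink_frame_components: "mink (frame_components g e v) (frame_components g e w) = g v w"
  unfolding metric_expansion[of v w] mink_def
  by (simp add: frame_components_def mult.assoc mult.left_commute)

end

context coordinate_metric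
begin

lemma frame_connection_skew:
  assumes y: "y \<in> V" and N: "open N" "y \<in> N"
    and ortho: "\<And>p a b. p \<in> N \<Longrightarrow> G p (E a p) (E b p) = (if a = b then eta a else 0)"
    and E: "\<And>a. (E a has_derivative E' a) (at y)"
  shows "G y (E a y) (E' b z + coord_christoffel G y z (E b y))
    = - G y (E b y) (E' a z + coord_christoffel G y z (E a y))"
proof -
  have "((\<lambda>p. G p (E a p) (E b p)) has_derivative (\<lambda>z. 0)) (at y)"
    by (rule has_derivative_transform_within_open[OF has_derivative_const N]) (simp add: ortho)
  from has_derivative_unique[OF this metric_compatible[OF y E E]]
  have "0 = G y (E' a z + coord_christoffel G y z (E a y)) (E b y)
       + G y (E a y) (E' b z + coord_christoffel G y z (E b y))" by (rule fun_cong)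
  then show ?thesis by (simp add: symmetric[OF y, of _ "E b y"])
qed

text \<open>A parallel spinor has a parallel two-form. In an orthonormal frame the derivative of the spinor is the
  infinitesimal rotation by the connection matrix, and the components of a constant coordinate
  vector \<open>w\<close> change by the same rotation and by the components of \<open>\<Gamma>(z, w)\<close>.\<close>

lemma two_form_parallel:
  assumes y: "y \<in> V" and N: "open N" "y \<in> N"
    and frame: "\<And>p. p \<in> N \<Longrightarrow> lorentz_frame (G p) (\<lambda>a. E a p)"
    and E: "\<And>a. (E a has_derivative E' a) (at y)"
    and \<psi>: "(\<psi> has_derivative \<psi>') (at y)"
    and par: "\<And>z. \<psi>' z = - (spin_lift (\<lambda>a b. G y (E a y) (E' b z + coord_christoffel G y z (E b y))) *v \<psi> y)"
    and P: "P \<in> chirality_operators"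
  defines "c \<equiv> \<lambda>p. frame_components (G p) (\<lambda>a. E a p)"
  shows "((\<lambda>p. two_form P (\<psi> p) (c p w) (c p w')) has_derivative (\<lambda>z.
      two_form P (\<psi> y) (c y (coord_christoffel G y z w)) (c y w')
    + two_form P (\<psi> y) (c y w) (c y (coord_christoffel G y z w')))) (at y)"
proof -
  interpret f: lorentz_frame "G y" "\<lambda>a. E a y" using frame N by blast
  define DE where "DE = (\<lambda>a z. E' a z + coord_christoffel G y z (E a y))"
  define M where "M = (\<lambda>z a b. G y (E a y) (DE b z))"
  have skew: "M z a b = - M z b a" for z a b
    unfolding M_def DE_def
    by (rule frame_connection_skew[OF y N lorentz_frame.orthonormal[OF frame] E])
  define c' where "c' = (\<lambda>w z. c y (coord_christoffel G y z w) - (\<chi> a. eta a * (\<Sum>b\<in>UNIV. M z a b * c y w $ b)))"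
  have c: "((\<lambda>p. c p w) has_derivative c' w) (at y)" for w
  proof -
    have "((\<lambda>p. eta a * G p (E a p) w) has_derivative (\<lambda>z. c' w z $ a)) (at y)" for a
    proof (rule has_derivative_eq_rhs)
      show "((\<lambda>p. eta a * G p (E a p) w) has_derivative
        (\<lambda>z. eta a * (G y (DE a z) w + G y (E a y) (0 + coord_christoffel G y z w)))) (at y)"
        unfolding DE_def
        by (rule has_derivative_mult_right[OF metric_compatible[OF y E has_derivative_const]])
      \<comment> \<open>The covariant derivative of a frame vector is expanded in the frame itself.\<close>
      have "G y (DE a z) w = - (\<Sum>b\<in>UNIV. M z a b * c y w $ b)" for z
      proof -
        have "G y (DE a z) w = (\<Sum>b\<in>UNIV. eta b * M z b a * G y (E b y) w)"
          unfolding f.metric_expansion[of "DE a z" w] by (simp add: frame_components_def M_def)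
        also have "\<dots> = (\<Sum>b\<in>UNIV. - (M z a b * c y w $ b))"
          by (intro sum.cong) (simp_all add: c_def frame_components_def skew[of z _ a] mult_ac)
        finally show ?thesis by (simp add: sum_negf)
      qed
      then show "(\<lambda>z. eta a * (G y (DE a z) w + G y (E a y) (0 + coord_christoffel G y z w))) = (\<lambda>z. c' w z $ a)"
        by (simp add: fun_eq_iff c'_def c_def frame_components_def algebra_simps)
    qed
    then have "((\<lambda>p. \<Sum>a\<in>UNIV. (eta a * G p (E a p) w) *\<^sub>R axis a (1::real)) has_derivative
        (\<lambda>z. \<Sum>a\<in>UNIV. (c' w z $ a) *\<^sub>R axis a 1)) (at y)"
      by (intro has_derivative_sum has_derivative_scaleR_left)
    moreover have "(\<Sum>a\<in>UNIV. (x $ a) *\<^sub>R axis a 1) = x" for x :: "real^4"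
      using basis_expansion[of x] by (simp add: scalar_mult_eq_scaleR)
    moreover have "c p w = (\<Sum>a\<in>UNIV. (eta a * G p (E a p) w) *\<^sub>R axis a (1::real))" for p
      using basis_expansion[of "c p w"] by (simp add: scalar_mult_eq_scaleR c_def frame_components_def)
    ultimately show ?thesis by simp
  qed
  show ?thesis
  proof (rule has_derivative_eq_rhs[OF has_derivative_two_form[OF \<psi> c c]], rule ext)
    fix z
    have "\<psi>' z = - (spin_lift (M z) *v \<psi> y)" using par[of z] unfolding M_def DE_def .
    from two_form_infinitesimal[OF skew P c'_def[THEN fun_cong, THEN fun_cong] c'_def[THEN fun_cong, THEN fun_cong] this]
    show "\<psi>' z \<bullet> (gamma 4 *v (cliff (c y w) *v (cliff (c y w') *v (P *v \<psi> y))))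
      + \<psi> y \<bullet> (gamma 4 *v (cliff (c' w z) *v (cliff (c y w') *v (P *v \<psi> y))))
      + \<psi> y \<bullet> (gamma 4 *v (cliff (c y w) *v (cliff (c' w' z) *v (P *v \<psi> y))))
      + \<psi> y \<bullet> (gamma 4 *v (cliff (c y w) *v (cliff (c y w') *v (P *v \<psi>' z))))
     = two_form P (\<psi> y) (c y (coord_christoffel G y z w)) (c y w')
     + two_form P (\<psi> y) (c y w) (c y (coord_christoffel G y z w'))"
      by simp
  qed
qed

end

section \<open>Coframes of the plane\<close>

lemma linear_real2:
  fixes f :: "real^2 \<Rightarrow> 'b::real_vector"
  assumes "linear f"
  shows "f w = (w $ 1) *\<^sub>R f (axis 1 1) + (w $ 2) *\<^sub>R f (axis 2 1)"
proof -
  have "w = (w $ 1) *\<^sub>R axis 1 1 + (w $ 2) *\<^sub>R axis 2 1"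
    by (simp add: vec_eq_iff forall_2 axis_def)
  then have "f w = f ((w $ 1) *\<^sub>R axis 1 1 + (w $ 2) *\<^sub>R axis 2 1)" by simp
  then show ?thesis using assms by (simp add: linear_add linear_cmul)
qed

definition coframe_det :: "(real^2 \<Rightarrow> real) \<Rightarrow> (real^2 \<Rightarrow> real) \<Rightarrow> real" where
  "coframe_det l n = l (axis 1 1) * n (axis 2 1) - l (axis 2 1) * n (axis 1 1)"

text \<open>The vector on which \<open>l\<close> is \<open>1\<close> and \<open>n\<close> is \<open>0\<close>, by Cramer's rule. An explicit formula is used because
  its smooth dependence on \<open>l\<close> and \<open>n\<close> is needed.\<close>

definition dual_vec :: "(real^2 \<Rightarrow> real) \<Rightarrow> (real^2 \<Rightarrow> real) \<Rightarrow> real^2" where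
  "dual_vec l n = inverse (coframe_det l n) *\<^sub>R (n (axis 2 1) *\<^sub>R axis 1 1 - n (axis 1 1) *\<^sub>R axis 2 1)"

lemma coframe_det_swap: "coframe_det n l = - coframe_det l n"
  by (simp add: coframe_det_def)

lemma dual_vec_eval:
  assumes "linear l" "linear n" "coframe_det l n \<noteq> 0"
  shows "l (dual_vec l n) = 1" "n (dual_vec l n) = 0"
    "l (dual_vec n l) = 0" "n (dual_vec n l) = 1"
proof -
  have *: "l (dual_vec l n) = 1 \<and> n (dual_vec l n) = 0"
    if "linear l" "linear n" "coframe_det l n \<noteq> 0" for l n
  proof -
    have "l (dual_vec l n) = inverse (coframe_det l n) * (n (axis 2 1) * l (axis 1 1) - n (axis 1 1) * l (axis 2 1))"
      by (simp add: dual_vec_def linear_cmul linear_diff that)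
    moreover have "n (axis 2 1) * l (axis 1 1) - n (axis 1 1) * l (axis 2 1) = coframe_det l n"
      by (simp add: coframe_det_def mult.commute)
    moreover have "n (dual_vec l n) = 0"
      by (simp add: dual_vec_def linear_cmul linear_diff that mult.commute)
    ultimately show ?thesis using that(3) by simp
  qed
  show "l (dual_vec l n) = 1" "n (dual_vec l n) = 0" "l (dual_vec n l) = 0" "n (dual_vec n l) = 1"
    using *[OF assms] *[OF assms(2,1)] assms(3) coframe_det_swap[of n l] by simp_all
qed

lemma coframe_eq_0:
  assumes "linear l" "linear n" "coframe_det l n \<noteq> 0" "l w = 0" "n w = 0"
  shows "w = 0"
proof -
  have "coframe_det l n * w $ 1 = 0" "coframe_det l n * w $ 2 = 0"
    using assms(4,5) linear_real2[OF assms(1), of w] linear_real2[OF assms(2), of w]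
    unfolding coframe_det_def by (simp_all, algebra+)
  then show ?thesis using assms(3) by (simp add: vec_eq_iff forall_2)
qed

lemma coframe_expansion:
  assumes "linear l" "linear n" "coframe_det l n \<noteq> 0"
  shows "w = l w *\<^sub>R dual_vec l n + n w *\<^sub>R dual_vec n l"
proof -
  have "w - (l w *\<^sub>R dual_vec l n + n w *\<^sub>R dual_vec n l) = 0"
    by (rule coframe_eq_0[OF assms])
       (simp_all add: linear_diff linear_add linear_cmul dual_vec_eval assms)
  then show ?thesis by simp
qed

lemma coframe_det_nonzero:
  assumes "linear l" "linear n" "l v = 1" "n v = 0" "l w = 0" "n w = 1"
  shows "coframe_det l n \<noteq> 0"
proof
  assume "coframe_det l n = 0"
  moreover have "1 = coframe_det l n * (v $ 1 * w $ 2 - v $ 2 * w $ 1)"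
    using assms(3-6) linear_real2[OF assms(1), of v] linear_real2[OF assms(2), of v]
      linear_real2[OF assms(1), of w] linear_real2[OF assms(2), of w]
    unfolding coframe_det_def real_scaleR_def by algebra
  ultimately show False by simp
qed

lemma smooth_dual_vec:
  assumes S: "open S" and "\<And>w. smooth_map_on S (\<lambda>p. l p w)" "\<And>w. smooth_map_on S (\<lambda>p. n p w)"
    and "\<And>p. p \<in> S \<Longrightarrow> coframe_det (l p) (n p) \<noteq> 0"
  shows "smooth_map_on S (\<lambda>p. dual_vec (l p) (n p))"
  using assms(4) unfolding dual_vec_def coframe_det_def
  by (intro smooth_map_on_scaleR[OF S] smooth_map_on_diff[OF S] smooth_map_on_inverse[OF S]
      smooth_map_on_mult[OF S] smooth_map_on_const assms(2,3)) auto

section \<open>Parallel coframes and flatness\<close>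

text \<open>Differentiating \<open>D\<^sub>v l(w) = l(\<Gamma>(v, w))\<close> in the direction \<open>u\<close> gives
  \<open>l(\<Gamma>(u, \<Gamma>(v, w))) + l(D\<^sub>u \<Gamma>(v, w))\<close>, which is symmetric in \<open>u\<close> and \<open>v\<close>.\<close>

lemma parallel_form_annihilates_curvature:
  fixes q :: "'e::euclidean_space \<Rightarrow> 'e \<Rightarrow> 'e \<Rightarrow> real" and l :: "'e \<Rightarrow> 'e \<Rightarrow> real"
  assumes m: "coordinate_metric V q" and y: "y \<in> V"
    and lin: "\<And>p. p \<in> V \<Longrightarrow> linear (l p)" and smooth: "\<And>w. smooth_map_on V (\<lambda>p. l p w)"
    and par: "\<And>p z w. p \<in> V \<Longrightarrow> frechet_derivative (\<lambda>p. l p w) (at p) z = l p (coord_christoffel q p z w)"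
    and diff: "\<And>v w. (\<lambda>p. coord_christoffel q p v w) differentiable at y"
  shows "l y (frechet_derivative (\<lambda>p. coord_christoffel q p v w) (at y) u
     - frechet_derivative (\<lambda>p. coord_christoffel q p u w) (at y) v
     + coord_christoffel q y u (coord_christoffel q y v w)
     - coord_christoffel q y v (coord_christoffel q y u w)) = 0"
proof -
  interpret coordinate_metric V q by (rule m)
  have D: "frechet_derivative (\<lambda>p. frechet_derivative (\<lambda>p. l p w) (at p) v) (at y) u
     = l y (coord_christoffel q y u (coord_christoffel q y v w))
       + l y (frechet_derivative (\<lambda>p. coord_christoffel q p v w) (at y) u)" for u v
  proof -
    have bil: "bilinear (\<lambda>a (b::real). l p a * b)" if "p \<in> V" for p
      using lin[OF that] by (auto simp: bilinear_def linear_iff algebra_simps)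
    have "((\<lambda>p. l p (coord_christoffel q p v w) * 1) has_derivative
      (\<lambda>z. frechet_derivative (\<lambda>p. l p (coord_christoffel q y v w) * 1) (at y) z
        + l y (frechet_derivative (\<lambda>p. coord_christoffel q p v w) (at y) z) * 1
        + l y (coord_christoffel q y v w) * 0)) (at y)"
      by (rule has_derivative_bilinear_family[where G = "\<lambda>p a b. l p a * b" and Y = "\<lambda>p. coord_christoffel q p v w"
            and W = "\<lambda>p. 1", OF open_dom y bil])
         (use diff smooth_map_on_differentiable[OF smooth y] in \<open>auto simp: frechet_derivative_works[symmetric]\<close>)
    then have "((\<lambda>p. l p (coord_christoffel q p v w)) has_derivative
      (\<lambda>z. l y (coord_christoffel q y z (coord_christoffel q y v w))
        + l y (frechet_derivative (\<lambda>p. coord_christoffel q p v w) (at y) z))) (at y)"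
      by (simp add: par[OF y])
    then show ?thesis
      by (intro has_derivative_frechet_eq) (rule has_derivative_transform_within_open[OF _ open_dom y], auto simp: par)
  qed
  have "frechet_derivative (\<lambda>p. frechet_derivative (\<lambda>p. l p w) (at p) v) (at y) u
      = frechet_derivative (\<lambda>p. frechet_derivative (\<lambda>p. l p w) (at p) u) (at y) v"
    by (rule second_derivative_symmetric[OF open_dom y])
       (auto intro: smooth_map_on_differentiable[OF smooth]
          smooth_map_on_differentiable[OF smooth_map_on_derivative[OF smooth] y])
  then show ?thesis unfolding D
    by (simp add: linear_diff[OF lin[OF y]] linear_add[OF lin[OF y]])
qed

text \<open>Both forms of the coframe kill the curvature. The Christoffel symbols are differentiable because the
  coframe expresses them by derivatives of its own components.\<close>

lemma parallel_coframe_flat: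
  fixes q :: "real^2 \<Rightarrow> real^2 \<Rightarrow> real^2 \<Rightarrow> real"
  assumes m: "coordinate_metric V q" and y: "y \<in> V"
    and lin: "\<And>p. p \<in> V \<Longrightarrow> linear (l p)" "\<And>p. p \<in> V \<Longrightarrow> linear (n p)"
    and smooth: "\<And>w. smooth_map_on V (\<lambda>p. l p w)" "\<And>w. smooth_map_on V (\<lambda>p. n p w)"
    and par: "\<And>p z w. p \<in> V \<Longrightarrow> frechet_derivative (\<lambda>p. l p w) (at p) z = l p (coord_christoffel q p z w)"
      "\<And>p z w. p \<in> V \<Longrightarrow> frechet_derivative (\<lambda>p. n p w) (at p) z = n p (coord_christoffel q p z w)"
    and det: "\<And>p. p \<in> V \<Longrightarrow> coframe_det (l p) (n p) \<noteq> 0"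
  shows "frechet_derivative (\<lambda>p. coord_christoffel q p v w) (at y) u
     - frechet_derivative (\<lambda>p. coord_christoffel q p u w) (at y) v
     + coord_christoffel q y u (coord_christoffel q y v w)
     - coord_christoffel q y v (coord_christoffel q y u w) = 0"
proof -
  interpret coordinate_metric V q by (rule m)
  have det': "coframe_det (n p) (l p) \<noteq> 0" if "p \<in> V" for p
    using det[OF that] coframe_det_swap[of "n p"] by simp
  have "smooth_map_on V (\<lambda>p. frechet_derivative (\<lambda>p. l p w) (at p) v *\<^sub>R dual_vec (l p) (n p)
      + frechet_derivative (\<lambda>p. n p w) (at p) v *\<^sub>R dual_vec (n p) (l p))" for v w
    by (intro smooth_map_on_add[OF open_dom] smooth_map_on_scaleR[OF open_dom] smooth_map_on_derivative
        smooth_dual_vec[OF open_dom] smooth det det')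
  moreover have "coord_christoffel q p v w = frechet_derivative (\<lambda>p. l p w) (at p) v *\<^sub>R dual_vec (l p) (n p)
      + frechet_derivative (\<lambda>p. n p w) (at p) v *\<^sub>R dual_vec (n p) (l p)" if "p \<in> V" for p v w
    unfolding par[OF that] by (rule coframe_expansion[OF lin[OF that] det[OF that]])
  ultimately have "smooth_map_on V (\<lambda>p. coord_christoffel q p v w)" for v w
    by (subst smooth_map_on_cong[OF open_dom]) auto
  then have diff: "(\<lambda>p. coord_christoffel q p v w) differentiable at y" for v w
    using smooth_map_on_differentiable y by blast
  show ?thesis
    by (rule coframe_eq_0[OF lin[OF y] det[OF y]])
       (rule parallel_form_annihilates_curvature[OF m y lin(1) smooth(1) par(1) diff],
        assumption+,
        rule parallel_form_annihilates_curvature[OF m y lin(2) smooth(2) par(2) diff])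
qed

section \<open>Brinkmann metrics in coordinates\<close>

lemma has_derivative_slice:
  fixes f :: "real \<times> real \<times> 'e::real_normed_vector \<Rightarrow> 'b::real_normed_vector"
  assumes "(f has_derivative f') (at (u, v, y))"
  shows "((\<lambda>y. f (u, v, y)) has_derivative (\<lambda>z. f' (0, 0, z))) (at y)"
    and "((\<lambda>s. f (s, v, y)) has_derivative (\<lambda>t. f' (t, 0, 0))) (at u)"
    and "((\<lambda>s. f (u, s, y)) has_derivative (\<lambda>t. f' (0, t, 0))) (at v)"
proof -
  show "((\<lambda>y. f (u, v, y)) has_derivative (\<lambda>z. f' (0, 0, z))) (at y)"
    by (rule has_derivative_compose[of "\<lambda>y. (u, v, y)" _ y UNIV f f', OF _ assms])
       (auto intro!: derivative_eq_intros)
  show "((\<lambda>s. f (s, v, y)) has_derivative (\<lambda>t. f' (t, 0, 0))) (at u)"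
    by (rule has_derivative_compose[of "\<lambda>s. (s, v, y)" _ u UNIV f f', OF _ assms])
       (auto intro!: derivative_eq_intros simp: zero_prod_def)
  show "((\<lambda>s. f (u, s, y)) has_derivative (\<lambda>t. f' (0, t, 0))) (at v)"
    by (rule has_derivative_compose[of "\<lambda>s. (u, s, y)" _ v UNIV f f', OF _ assms])
       (auto intro!: derivative_eq_intros simp: zero_prod_def)
qed

lemma deriv_slice:
  fixes f :: "real \<times> real \<times> 'e::real_normed_vector \<Rightarrow> real"
  assumes "(f has_derivative f') (at (u, v, y))"
  shows "deriv (\<lambda>s. f (s, v, y)) u = f' (1, 0, 0)"
proof -
  have "(\<lambda>t. f' (t, 0, 0)) = (*) (f' (1, 0, 0))"
  proof
    fix t
    have "f' (t, 0, 0) = f' (t *\<^sub>R (1, 0, 0))" by simp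
    also have "\<dots> = t *\<^sub>R f' (1, 0, 0)" by (rule linear_cmul[OF has_derivative_linear[OF assms]])
    finally show "f' (t, 0, 0) = f' (1, 0, 0) * t" by (simp only: real_scaleR_def mult.commute)
  qed
  with has_derivative_slice(2)[OF assms]
  have "((\<lambda>s. f (s, v, y)) has_field_derivative f' (1, 0, 0)) (at u)"
    unfolding has_field_derivative_def by simp
  then show ?thesis by (rule DERIV_imp_deriv)
qed

text \<open>The metric in the coordinates \<open>(u, v, y)\<close> given by a chart of \<open>X\<close> with image \<open>V\<close>. The formula for \<open>G\<close> is
  assumed only over \<open>V\<close>, since the inverse of a chart is arbitrary outside its image.\<close>

locale brinkmann_chart =
  fixes V :: "(real^2) set" and h :: "real \<Rightarrow> real^2 \<Rightarrow> real"
    and a :: "real \<Rightarrow> real^2 \<Rightarrow> real^2 \<Rightarrow> real" and Q :: "real \<Rightarrow> real^2 \<Rightarrow> real^2 \<Rightarrow> real^2 \<Rightarrow> real"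
    and G :: "real \<times> real \<times> (real^2) \<Rightarrow> real \<times> real \<times> (real^2) \<Rightarrow> real \<times> real \<times> (real^2) \<Rightarrow> real"
  assumes open_V: "open V"
    and linear_a: "\<And>u y. y \<in> V \<Longrightarrow> linear (a u y)"
    and bilinear_Q: "\<And>u y. y \<in> V \<Longrightarrow> bilinear (Q u y)"
    and sym_Q: "\<And>u y w w'. y \<in> V \<Longrightarrow> Q u y w w' = Q u y w' w"
    and pos_Q: "\<And>u y w. y \<in> V \<Longrightarrow> w \<noteq> 0 \<Longrightarrow> Q u y w w > 0"
    and smooth_h: "smooth_map_on (UNIV \<times> V) (\<lambda>(u, y). h u y)"
    and smooth_a: "\<And>w. smooth_map_on (UNIV \<times> V) (\<lambda>(u, y). a u y w)"
    and smooth_Q: "\<And>w w'. smooth_map_on (UNIV \<times> V) (\<lambda>(u, y). Q u y w w')"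
    and G_eq: "\<And>u v y p s w p' s' w'. y \<in> V \<Longrightarrow> G (u, v, y) (p, s, w) (p', s', w') =
      h u y * p * p' + (p * a u y w' + p' * a u y w) + (p * s' + p' * s) + Q u y w w'"
begin

definition W :: "(real \<times> real \<times> (real^2)) set" where "W = UNIV \<times> UNIV \<times> V"

lemma open_W: "open W" and in_W [simp]: "(u, v, y) \<in> W \<longleftrightarrow> y \<in> V"
  using open_V by (auto simp: W_def intro!: open_Times)

lemma open_UV: "open (UNIV \<times> V :: (real \<times> _) set)"
  using open_V by (auto intro!: open_Times)

lemma smooth_pullback:
  assumes "smooth_map_on (UNIV \<times> V) (\<lambda>(u, y). f u y)"
  shows "smooth_map_on W (\<lambda>p. f (fst p) (snd (snd p)))"
proof -
  have "bounded_linear (\<lambda>p :: real \<times> real \<times> (real^2). (fst p, snd (snd p)))"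
    by (intro bounded_linear_Pair bounded_linear_fst bounded_linear_compose[OF bounded_linear_snd bounded_linear_snd])
  from smooth_map_on_compose_affine[OF open_W open_UV this assms, of 0]
  show ?thesis by (auto simp: W_def zero_prod_def split_beta)
qed

lemma smooth_G: "smooth_map_on W (\<lambda>p. G p w w')"
proof -
  obtain p s x where w: "w = (p, s, x)" by (cases w)
  obtain p' s' x' where w': "w' = (p', s', x')" by (cases w')
  have "smooth_map_on W (\<lambda>P. h (fst P) (snd (snd P)) * p * p' + (p * a (fst P) (snd (snd P)) x' +
      p' * a (fst P) (snd (snd P)) x) + (p * s' + p' * s) + Q (fst P) (snd (snd P)) x x')"
    by (intro smooth_map_on_add[OF open_W] smooth_map_on_mult[OF open_W] smooth_map_on_const
        smooth_pullback[OF smooth_h] smooth_pullback[OF smooth_a] smooth_pullback[OF smooth_Q])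
  then show ?thesis
    by (subst smooth_map_on_cong[OF open_W]) (auto simp: W_def w w' G_eq)
qed

lemma bilinear_G: assumes "P \<in> W" shows "bilinear (G P)"
proof -
  obtain u v y where P: "P = (u, v, y)" "y \<in> V" using assms by (auto simp: W_def)
  note Q = bilinear_ladd[OF bilinear_Q[OF P(2)]] bilinear_radd[OF bilinear_Q[OF P(2)]]
    bilinear_lmul[OF bilinear_Q[OF P(2)]] bilinear_rmul[OF bilinear_Q[OF P(2)]]
    linear_add[OF linear_a[OF P(2)]] linear_cmul[OF linear_a[OF P(2)]]
  show ?thesis unfolding bilinear_def P(1)
    by (auto intro!: linearI simp: G_eq[OF P(2)] Q algebra_simps)
qed

lemma G_null: "P \<in> W \<Longrightarrow> G P w (0, 1, 0) = fst w"
  by (cases w) (auto simp: W_def G_eq linear_0[OF linear_a] bilinear_rzero[OF bilinear_Q])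

lemma G_tangent: "y \<in> V \<Longrightarrow> G (u, v, y) (0, s, w) (0, s', w') = Q u y w w'"
  by (simp add: G_eq)

lemma G_mixed: "y \<in> V \<Longrightarrow> G (u, v, y) (1, 0, 0) (0, 0, w) = a u y w"
  by (simp add: G_eq bilinear_lzero[OF bilinear_Q])

sublocale coordinate_metric W G
proof
  show "open W" by (rule open_W)
  show "bilinear (G y)" if "y \<in> W" for y using bilinear_G[OF that] .
  show "G y v w = G y w v" if "y \<in> W" for y v w
    using that by (cases v; cases w) (auto simp: W_def G_eq sym_Q)
  show "(\<lambda>p. G p v w) differentiable at y" if "y \<in> W" for y v w
    using smooth_G that by (rule smooth_map_on_differentiable)
  fix P z assume P: "P \<in> W" and z: "\<And>a. G P z a = 0"
  obtain u v y where P': "P = (u, v, y)" "y \<in> V" using P by (auto simp: W_def)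
  obtain p s x where zz: "z = (p, s, x)" by (cases z)
  have p: "p = 0" using z[of "(0, 1, 0)"] G_null[OF P] zz by simp
  have "Q u y x x = 0" using z[of "(0, 0, x)"] unfolding zz p P'(1) G_tangent[OF P'(2)] .
  then have x: "x = 0" using pos_Q[OF P'(2), of x u] by force
  have "s = 0" using z[of "(1, 0, 0)"] unfolding zz p x P'(1)
    by (simp add: G_eq[OF P'(2)] linear_0[OF linear_a[OF P'(2)]] bilinear_lzero[OF bilinear_Q[OF P'(2)]])
  then show "z = 0" using p x zz by (simp add: zero_prod_def)
qed

lemma slice_metric: "coordinate_metric V (Q u)"
proof
  show "open V" by (rule open_V)
  show "bilinear (Q u y)" if "y \<in> V" for y using bilinear_Q[OF that] .
  show "Q u y v w = Q u y w v" if "y \<in> V" for y v w using sym_Q[OF that] .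
  show "z = 0" if "y \<in> V" "\<And>a. Q u y z a = 0" for y z
    using pos_Q[OF that(1), of z u] that(2)[of z] by force
  show "(\<lambda>p. Q u p v w) differentiable at y" if y: "y \<in> V" for y v w
  proof -
    have "((\<lambda>p. G p (0, 0, v) (0, 0, w)) has_derivative dG (u, 0, y) (0, 0, v) (0, 0, w)) (at (u, 0, y))"
      by (rule has_derivative_metric) (simp add: y)
    from has_derivative_transform_within_open[OF has_derivative_slice(1)[OF this] open_V y]
    have "((\<lambda>p. Q u p v w) has_derivative (\<lambda>z. dG (u, 0, y) (0, 0, v) (0, 0, w) (0, 0, z))) (at y)"
      by (simp add: G_tangent)
    then show ?thesis by (rule Derivative.differentiableI)
  qed
qed

context
  fixes u v :: real and y :: "real^2"
  assumes y: "y \<in> V"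
begin

lemma dG_along_v: "dG (u, v, y) w w' (0, 1, 0) = 0"
proof -
  have P: "(u, v, y) \<in> W" by (simp add: y)
  have "((\<lambda>s. G (u, s, y) w w') has_derivative (\<lambda>t. dG (u, v, y) w w' (0, t, 0))) (at v)"
    by (rule has_derivative_slice(3)[OF has_derivative_metric[OF P]])
  moreover have "(\<lambda>s. G (u, s, y) w w') = (\<lambda>s. G (u, v, y) w w')"
    by (cases w; cases w') (simp add: G_eq[OF y])
  ultimately have "((\<lambda>s. G (u, v, y) w w') has_derivative (\<lambda>t. dG (u, v, y) w w' (0, t, 0))) (at v)"
    by (simp only:)
  from has_derivative_unique[OF this has_derivative_const] show ?thesis by (rule fun_cong)
qed

lemma dG_null: "dG (u, v, y) w (0, 1, 0) z = 0"
  by (rule has_derivative_frechet_eq, rule has_derivative_transform_within_open[OF has_derivative_const[of "fst w"] open_W])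
     (auto simp: y G_null)

lemma dG_null': "dG (u, v, y) (0, 1, 0) w z = 0"
  by (subst dG_sym) (simp_all add: y dG_null)

lemma dG_tangent: "dG (u, v, y) (0, 0, w) (0, 0, w') (0, 0, z) = frechet_derivative (\<lambda>y. Q u y w w') (at y) z"
proof -
  have P: "(u, v, y) \<in> W" by (simp add: y)
  from has_derivative_transform_within_open[OF has_derivative_slice(1)[OF has_derivative_metric[OF P]] open_V y, of "(0, 0, w)" "(0, 0, w')"]
  have "((\<lambda>p. Q u p w w') has_derivative (\<lambda>z. dG (u, v, y) (0, 0, w) (0, 0, w') (0, 0, z))) (at y)"
    by (simp add: G_tangent)
  from has_derivative_frechet_eq[OF this] show ?thesis by simp
qed

lemma dG_mixed: "dG (u, v, y) (1, 0, 0) (0, 0, w) (0, 0, z) = frechet_derivative (\<lambda>y. a u y w) (at y) z"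
proof -
  have P: "(u, v, y) \<in> W" by (simp add: y)
  from has_derivative_transform_within_open[OF has_derivative_slice(1)[OF has_derivative_metric[OF P]] open_V y, of "(1, 0, 0)" "(0, 0, w)"]
  have "((\<lambda>p. a u p w) has_derivative (\<lambda>z. dG (u, v, y) (1, 0, 0) (0, 0, w) (0, 0, z))) (at y)"
    by (simp add: G_mixed)
  from has_derivative_frechet_eq[OF this] show ?thesis by simp
qed

lemma dG_along_u: "dG (u, v, y) (0, 0, w) (0, 0, w') (1, 0, 0) = deriv (\<lambda>s. Q s y w w') u"
  using deriv_slice[OF has_derivative_metric, of u v y "(0, 0, w)" "(0, 0, w')"] y by (simp add: G_tangent)

lemma fst_christoffel: "fst (coord_christoffel G (u, v, y) z w) = 0"
proof -
  have P: "(u, v, y) \<in> W" by (simp add: y)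
  show ?thesis using koszul[OF P, of z w "(0, 1, 0)"]
    by (simp add: G_null[OF P] dG_null dG_along_v)
qed

text \<open>The null vector field \<open>\<partial>\<^sub>v\<close> is parallel.\<close>

lemma christoffel_null: "coord_christoffel G (u, v, y) z (0, 1, 0) = 0"
proof -
  have P: "(u, v, y) \<in> W" by (simp add: y)
  show ?thesis
    by (rule christoffel_unique[OF P])
       (simp add: dG_null dG_null' dG_along_v bilinear_lzero[OF bilinear_G[OF P]])
qed

text \<open>The component along \<open>X\<close> of \<open>\<Gamma>(z, w)\<close> for \<open>w\<close> tangent to \<open>X\<close>. All that the Levi-Civita connection of
  the space-time says about one-forms on \<open>X\<close> is contained in it.\<close>

definition tangential_christoffel where
  "tangential_christoffel z w = snd (snd (coord_christoffel G (u, v, y) z (0, 0, w)))"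

lemma Q_tangential_christoffel:
  "Q u y (tangential_christoffel z w) x
    = (dG (u, v, y) (0, 0, w) (0, 0, x) z + dG (u, v, y) z (0, 0, x) (0, 0, w) - dG (u, v, y) z (0, 0, w) (0, 0, x)) / 2"
proof -
  have P: "(u, v, y) \<in> W" by (simp add: y)
  obtain s k where "coord_christoffel G (u, v, y) z (0, 0, w) = (0, s, k)"
    using fst_christoffel[of z "(0, 0, w)"] by (cases "coord_christoffel G (u, v, y) z (0, 0, w)") auto
  then show ?thesis using koszul[OF P, of z "(0, 0, w)" "(0, 0, x)"]
    unfolding tangential_christoffel_def by (simp add: G_tangent[OF y])
qed

lemma tangential_christoffel_tangent:
  "tangential_christoffel (0, 0, z) w = coord_christoffel (Q u) y z w"
proof -
  interpret X: coordinate_metric V "Q u" by (rule slice_metric)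
  show ?thesis
    by (rule X.christoffel_unique[OF y, symmetric])
       (simp add: Q_tangential_christoffel dG_tangent)
qed

text \<open>This is where \<open>d\<alpha>\<close> enters: it is the antisymmetric part of the covariant derivative of tangent vectors
  in the direction \<open>\<partial>\<^sub>u\<close>, while \<open>\<partial>\<^sub>u q\<close> is the symmetric part.\<close>

lemma Q_tangential_christoffel_u:
  "Q u y (tangential_christoffel (1, 0, 0) w) x = (deriv (\<lambda>s. Q s y w x) u
     + frechet_derivative (\<lambda>y. a u y x) (at y) w - frechet_derivative (\<lambda>y. a u y w) (at y) x) / 2"
  by (simp add: Q_tangential_christoffel dG_along_u dG_mixed)

lemma tangential_christoffel_v: "tangential_christoffel (0, 1, 0) w = 0"
proof -
  have "Q u y (tangential_christoffel (0, 1, 0) w) x = 0" for x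
    by (simp add: Q_tangential_christoffel dG_along_v dG_null')
  then show ?thesis using coordinate_metric.nondegenerate[OF slice_metric y] by blast
qed

lemma linear_tangential_christoffel: "linear (\<lambda>z. tangential_christoffel z w)"
proof -
  have P: "(u, v, y) \<in> W" by (simp add: y)
  have "(\<lambda>z. coord_christoffel G (u, v, y) z (0, 0, w)) = coord_christoffel G (u, v, y) (0, 0, w)"
    by (rule ext) (rule christoffel_sym[OF P])
  then have "linear (\<lambda>z. coord_christoffel G (u, v, y) z (0, 0, w))"
    using linear_christoffel[OF P, of "(0, 0, w)"] by (simp only:)
  then show ?thesis unfolding tangential_christoffel_def
    by (simp add: linear_iff)
qed

text \<open>A parallel two-form \<open>du \<and> l\<close>, contracted with \<open>\<partial>\<^sub>u\<close> and a constant tangent vector. As \<open>\<Gamma>\<close> has no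
  \<open>\<partial>\<^sub>u\<close>-component and \<open>l\<close> kills \<open>\<partial>\<^sub>v\<close>, only the tangential component survives.\<close>

lemma parallel_two_form_reduces:
  fixes F :: "real \<times> real \<times> (real^2) \<Rightarrow> real \<times> real \<times> (real^2) \<Rightarrow> real \<times> real \<times> (real^2) \<Rightarrow> real"
  assumes D: "((\<lambda>p. F p (1, 0, 0) (0, 0, w)) has_derivative
      (\<lambda>z. F (u, v, y) (coord_christoffel G (u, v, y) z (1, 0, 0)) (0, 0, w)
         + F (u, v, y) (1, 0, 0) (coord_christoffel G (u, v, y) z (0, 0, w)))) (at (u, v, y))"
    and simple: "\<And>w w'. F (u, v, y) w w' = fst w * F (u, v, y) (1, 0, 0) w' - fst w' * F (u, v, y) (1, 0, 0) w"
    and null: "F (u, v, y) (1, 0, 0) (0, 1, 0) = 0" and lin: "linear (F (u, v, y) (1, 0, 0))"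
  shows "((\<lambda>p. F p (1, 0, 0) (0, 0, w)) has_derivative
      (\<lambda>z. F (u, v, y) (1, 0, 0) (0, 0, tangential_christoffel z w))) (at (u, v, y))"
proof -
  have "F (u, v, y) (1, 0, 0) (0, s, x) = F (u, v, y) (1, 0, 0) (0, 0, x)" for s x
  proof -
    have "F (u, v, y) (1, 0, 0) (0, s, x) = F (u, v, y) (1, 0, 0) (s *\<^sub>R (0, 1, 0) + (0, 0, x))" by simp
    also have "\<dots> = s *\<^sub>R F (u, v, y) (1, 0, 0) (0, 1, 0) + F (u, v, y) (1, 0, 0) (0, 0, x)"
      by (simp only: linear_add[OF lin] linear_cmul[OF lin])
    finally show ?thesis by (simp only: null) simp
  qed
  have "F (u, v, y) (1, 0, 0) (coord_christoffel G (u, v, y) z (0, 0, w))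
      = F (u, v, y) (1, 0, 0) (0, 0, tangential_christoffel z w)" for z
  proof -
    obtain s k where "coord_christoffel G (u, v, y) z (0, 0, w) = (0, s, k)"
      using fst_christoffel[of z "(0, 0, w)"] by (cases "coord_christoffel G (u, v, y) z (0, 0, w)") auto
    then show ?thesis unfolding tangential_christoffel_def
      using \<open>\<And>s x. F (u, v, y) (1, 0, 0) (0, s, x) = F (u, v, y) (1, 0, 0) (0, 0, x)\<close>[of s k] by simp
  qed
  moreover have "F (u, v, y) (coord_christoffel G (u, v, y) z (1, 0, 0)) (0, 0, w) = 0" for z
    by (subst simple) (simp add: fst_christoffel)
  ultimately show ?thesis using D by simp
qed


lemma parallel_on_slice:
  assumes "((\<lambda>p. L p w) has_derivative (\<lambda>z. L (u, v, y) (tangential_christoffel z w))) (at (u, v, y))"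
  shows "frechet_derivative (\<lambda>y. L (u, v, y) w) (at y) z = L (u, v, y) (coord_christoffel (Q u) y z w)"
  using has_derivative_frechet_eq[OF has_derivative_slice(1)[OF assms]] by (simp add: tangential_christoffel_tangent)

lemma deriv_coframe_metric:
  fixes l n :: "real \<Rightarrow> real^2 \<Rightarrow> real"
  assumes Q: "\<And>s w x. Q s y w x = l s w * l s x + n s w * n s x"
    and l: "\<And>w. ((\<lambda>s. l s w) has_field_derivative l' w) (at u)"
    and n: "\<And>w. ((\<lambda>s. n s w) has_field_derivative n' w) (at u)"
  shows "deriv (\<lambda>s. Q s y w x) u = l' w * l u x + l u w * l' x + n' w * n u x + n u w * n' x"
  unfolding Q by (rule DERIV_imp_deriv) (auto intro!: derivative_eq_intros l n)

text \<open>Inserting \<open>Q = L L + N N\<close> into the formula for \<open>\<Gamma>(\<partial>\<^sub>u, w)\<close>, where \<open>L(\<Gamma>)\<close> and \<open>N(\<Gamma>)\<close> are the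
  derivatives of \<open>L\<close> and \<open>N\<close> in \<open>u\<close>, and solving for \<open>d\<alpha>\<close>.\<close>

lemma coframe_condition:
  fixes L N :: "real \<times> real \<times> (real^2) \<Rightarrow> real^2 \<Rightarrow> real"
  assumes L: "\<And>w. ((\<lambda>p. L p w) has_derivative (\<lambda>z. L (u, v, y) (tangential_christoffel z w))) (at (u, v, y))"
    and N: "\<And>w. ((\<lambda>p. N p w) has_derivative (\<lambda>z. N (u, v, y) (tangential_christoffel z w))) (at (u, v, y))"
    and Q: "\<And>s w x. Q s y w x = L (s, v, y) w * L (s, v, y) x + N (s, v, y) w * N (s, v, y) x"
  shows "frechet_derivative (\<lambda>y. a u y x) (at y) w - frechet_derivative (\<lambda>y. a u y w) (at y) x
    = (deriv (\<lambda>s. N (s, v, y) w) u * N (u, v, y) x - deriv (\<lambda>s. N (s, v, y) x) u * N (u, v, y) w)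
    + (deriv (\<lambda>s. L (s, v, y) w) u * L (u, v, y) x - deriv (\<lambda>s. L (s, v, y) x) u * L (u, v, y) w)"
proof -
  have D: "((\<lambda>s. K (s, v, y) w) has_field_derivative K (u, v, y) (tangential_christoffel (1, 0, 0) w)) (at u)"
    if K: "((\<lambda>p. K p w) has_derivative (\<lambda>z. K (u, v, y) (tangential_christoffel z w))) (at (u, v, y))"
    for K :: "real \<times> real \<times> (real^2) \<Rightarrow> real^2 \<Rightarrow> real" and w
  proof -
    have "(\<lambda>s. K (s, v, y) w) differentiable at u"
      using has_derivative_slice(2)[OF K] by (rule Derivative.differentiableI)
    then have "((\<lambda>s. K (s, v, y) w) has_field_derivative deriv (\<lambda>s. K (s, v, y) w) u) (at u)"
      by (simp add: DERIV_deriv_iff_real_differentiable)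
    then show ?thesis using deriv_slice[OF K] by simp
  qed
  have "Q u y (tangential_christoffel (1, 0, 0) w) x
      = L (u, v, y) (tangential_christoffel (1, 0, 0) w) * L (u, v, y) x
      + N (u, v, y) (tangential_christoffel (1, 0, 0) w) * N (u, v, y) x"
    by (rule Q)
  moreover note deriv_coframe_metric[OF Q D[OF L] D[OF N], of w x]
  ultimately show ?thesis
    unfolding Q_tangential_christoffel_u deriv_slice[OF L] deriv_slice[OF N] by (simp add: algebra_simps)
qed

text \<open>The pull-back of \<open>l\<close> to the space-time, evaluated on vectors tangent to \<open>X\<close>, behaves as if it were
  parallel. By linearity only the directions \<open>\<partial>\<^sub>u\<close>, \<open>\<partial>\<^sub>v\<close> and those tangent to \<open>X\<close> matter: the first
  uses the formula for \<open>d\<alpha>\<close>, in the second both sides vanish, and the third is parallelism on \<open>X\<close>.\<close>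

lemma coframe_lift_derivative:
  fixes l n :: "real \<Rightarrow> real^2 \<Rightarrow> real^2 \<Rightarrow> real"
  assumes l: "\<And>w. smooth_map_on (UNIV \<times> V) (\<lambda>(u, y). l u y w)"
    and n: "\<And>w. smooth_map_on (UNIV \<times> V) (\<lambda>(u, y). n u y w)"
    and lin: "linear (l u y)" "linear (n u y)" and det: "coframe_det (l u y) (n u y) \<noteq> 0"
    and Q: "\<And>s w x. Q s y w x = l s y w * l s y x + n s y w * n s y x"
    and par: "\<And>z w. frechet_derivative (\<lambda>y. l u y w) (at y) z = l u y (coord_christoffel (Q u) y z w)"
    and cond: "\<And>w x. frechet_derivative (\<lambda>y. a u y x) (at y) w - frechet_derivative (\<lambda>y. a u y w) (at y) x
      = (deriv (\<lambda>s. n s y w) u * n u y x - deriv (\<lambda>s. n s y x) u * n u y w)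
      + (deriv (\<lambda>s. l s y w) u * l u y x - deriv (\<lambda>s. l s y x) u * l u y w)"
  shows "((\<lambda>p. l (fst p) (snd (snd p)) w) has_derivative (\<lambda>z. l u y (tangential_christoffel z w))) (at (u, v, y))"
proof -
  have P: "(u, v, y) \<in> W" by (simp add: y)
  define f where "f = (\<lambda>p :: real \<times> real \<times> (real^2). l (fst p) (snd (snd p)) w)"
  define f' where "f' = frechet_derivative f (at (u, v, y))"
  have lift: "((\<lambda>p. k (fst p) (snd (snd p)) w) has_derivative
      frechet_derivative (\<lambda>p. k (fst p) (snd (snd p)) w) (at (u, v, y))) (at (u, v, y))"
    if "\<And>w. smooth_map_on (UNIV \<times> V) (\<lambda>(u, y). k u y w)" for k :: "real \<Rightarrow> real^2 \<Rightarrow> real^2 \<Rightarrow> real" and w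
    using smooth_map_on_differentiable[OF smooth_pullback[OF that] P, of w]
    by (simp add: frechet_derivative_works)
  have f: "(f has_derivative f') (at (u, v, y))" unfolding f'_def f_def by (rule lift[OF l])
  have D: "((\<lambda>s. k s y w) has_field_derivative deriv (\<lambda>s. k s y w) u) (at u)"
    if "\<And>w. smooth_map_on (UNIV \<times> V) (\<lambda>(u, y). k u y w)" for k :: "real \<Rightarrow> real^2 \<Rightarrow> real^2 \<Rightarrow> real" and w
  proof -
    have "(\<lambda>s. k s y w) differentiable at u"
      using has_derivative_slice(2)[OF lift[of k w]] that by (auto intro: Derivative.differentiableI)
    then show ?thesis by (simp add: DERIV_deriv_iff_real_differentiable)
  qed
  note lift = linear_add[OF has_derivative_linear[OF f]] linear_cmul[OF has_derivative_linear[OF f]]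
  note T = linear_add[OF linear_tangential_christoffel] linear_cmul[OF linear_tangential_christoffel]
  let ?d = "dual_vec (l u y) (n u y)"
  have dual: "l u y ?d = 1" "n u y ?d = 0" using dual_vec_eval[OF lin det] by simp_all
  have dQ: "deriv (\<lambda>s. Q s y w x) u = deriv (\<lambda>s. l s y w) u * l u y x + l u y w * deriv (\<lambda>s. l s y x) u
      + deriv (\<lambda>s. n s y w) u * n u y x + n u y w * deriv (\<lambda>s. n s y x) u" for w x
    by (rule deriv_coframe_metric[where l = "\<lambda>s. l s y" and n = "\<lambda>s. n s y"]) (rule Q D[OF l] D[OF n])+
  have fu: "f' (1, 0, 0) = l u y (tangential_christoffel (1, 0, 0) w)"
  proof -
    have "l u y (tangential_christoffel (1, 0, 0) w) = Q u y (tangential_christoffel (1, 0, 0) w) ?d"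
      by (simp add: Q dual)
    also have "\<dots> = deriv (\<lambda>s. l s y w) u"
      unfolding Q_tangential_christoffel_u
      using cond[of ?d w] dQ[of w ?d] by (simp add: dual)
    also have "\<dots> = f' (1, 0, 0)" using deriv_slice[OF f] by (simp add: f_def)
    finally show ?thesis by simp
  qed
  have fv: "f' (0, 1, 0) = l u y (tangential_christoffel (0, 1, 0) w)"
  proof -
    have "((\<lambda>s. l u y w) has_derivative (\<lambda>t. f' (0, t, 0))) (at v)"
      using has_derivative_slice(3)[OF f] by (simp add: f_def)
    from fun_cong[OF has_derivative_unique[OF this has_derivative_const], of 1]
    show ?thesis by (simp add: tangential_christoffel_v linear_0[OF lin(1)])
  qed
  have fz: "f' (0, 0, z) = l u y (tangential_christoffel (0, 0, z) w)" for z
    using has_derivative_frechet_eq[OF has_derivative_slice(1)[OF f], of z]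
    unfolding tangential_christoffel_tangent par[symmetric] by (simp add: f_def)
  have "f' z = l u y (tangential_christoffel z w)" for z
  proof -
    obtain p s x where z: "z = (p, s, x)" by (cases z)
    have z': "z = p *\<^sub>R (1, 0, 0) + s *\<^sub>R (0, 1, 0) + (0, 0, x)" by (simp add: z)
    show ?thesis unfolding z' lift T
      by (simp only: linear_add[OF lin(1)] linear_cmul[OF lin(1)] fu fv fz)
  qed
  then have "f' = (\<lambda>z. l u y (tangential_christoffel z w))" by (rule ext)
  with f show ?thesis unfolding f_def by simp
qed

end

end

section \<open>The frame adapted to a coframe\<close>

lemma det_4:
  fixes A :: "real^4^4"
  shows "det A =
    A$1$1 * (A$2$2 * (A$3$3 * A$4$4 - A$3$4 * A$4$3) - A$2$3 * (A$3$2 * A$4$4 - A$3$4 * A$4$2) + A$2$4 * (A$3$2 * A$4$3 - A$3$3 * A$4$2))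
  - A$1$2 * (A$2$1 * (A$3$3 * A$4$4 - A$3$4 * A$4$3) - A$2$3 * (A$3$1 * A$4$4 - A$3$4 * A$4$1) + A$2$4 * (A$3$1 * A$4$3 - A$3$3 * A$4$1))
  + A$1$3 * (A$2$1 * (A$3$2 * A$4$4 - A$3$4 * A$4$2) - A$2$2 * (A$3$1 * A$4$4 - A$3$4 * A$4$1) + A$2$4 * (A$3$1 * A$4$2 - A$3$2 * A$4$1))
  - A$1$4 * (A$2$1 * (A$3$2 * A$4$3 - A$3$3 * A$4$2) - A$2$2 * (A$3$1 * A$4$3 - A$3$3 * A$4$1) + A$2$3 * (A$3$1 * A$4$2 - A$3$2 * A$4$1))"
proof -
  have f: "finite {2::4, 3, 4}" "1 \<notin> {2::4, 3, 4}" "finite {3::4, 4}" "2 \<notin> {3::4, 4}" "finite {4::4}" "3 \<notin> {4::4}"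
    by auto
  show ?thesis
    unfolding det_def UNIV_4
    unfolding sum_over_permutations_insert[OF f(1,2)]
    unfolding sum_over_permutations_insert[OF f(3,4)]
    unfolding sum_over_permutations_insert[OF f(5,6)]
    unfolding permutes_sing
    apply (simp add: sign_swap_id permutation_swap_id permutation_compose sign_compose sign_id swap_id_eq)
    apply (simp add: algebra_simps)
    done
qed

text \<open>With the null vectors \<open>\<partial>\<^sub>v\<close> and \<open>N = \<partial>\<^sub>u - (h/2) \<partial>\<^sub>v\<close>, for which \<open>g(N, \<partial>\<^sub>v) = 1\<close>, the first and last vectors
  are \<open>\<partial>\<^sub>v/2 + N\<close> and \<open>\<partial>\<^sub>v/2 - N\<close>, which avoids square roots. The other two are the vectors tangent to
  \<open>X\<close> dual to \<open>n\<close> and \<open>l\<close>, made orthogonal to \<open>N\<close> by a multiple of \<open>\<partial>\<^sub>v\<close>. The sign \<open>s\<close> adjusts the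
  orientation.\<close>

definition adapted_frame ::
  "real \<Rightarrow> (real^2 \<Rightarrow> real) \<Rightarrow> (real^2 \<Rightarrow> real) \<Rightarrow> (real^2 \<Rightarrow> real) \<Rightarrow> real \<Rightarrow> 4 \<Rightarrow> real \<times> real \<times> (real^2)" where
  "adapted_frame h a l n s k =
    (if k = 1 then (1, 1/2 - h/2, 0)
     else if k = 2 then (0, - s * a (dual_vec n l), s *\<^sub>R dual_vec n l)
     else if k = 3 then (0, - a (dual_vec l n), dual_vec l n)
     else (-1, 1/2 + h/2, 0))"

lemma adapted_frame_simps:
  "adapted_frame h a l n s 1 = (1, 1/2 - h/2, 0)"
  "adapted_frame h a l n s 2 = (0, - s * a (dual_vec n l), s *\<^sub>R dual_vec n l)"
  "adapted_frame h a l n s 3 = (0, - a (dual_vec l n), dual_vec l n)"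
  "adapted_frame h a l n s 4 = (-1, 1/2 + h/2, 0)"
  by (simp_all add: adapted_frame_def)

lemma adapted_frame_null: "adapted_frame h a l n s 1 + adapted_frame h a l n s 4 = (0, 1, 0)"
  by (simp add: adapted_frame_simps)

lemma det_adapted_frame:
  assumes "coframe_det l n \<noteq> 0"
  shows "det (\<chi> k. coord_vec (adapted_frame h a l n s k)) = - s / coframe_det l n"
proof -
  have "det (\<chi> k. coord_vec (adapted_frame h a l n s k))
      = s * (dual_vec n l $ 1 * dual_vec l n $ 2 - dual_vec n l $ 2 * dual_vec l n $ 1)"
    by (simp add: det_4 adapted_frame_simps coord_vec_def algebra_simps)
  also have "dual_vec n l $ 1 * dual_vec l n $ 2 - dual_vec n l $ 2 * dual_vec l n $ 1
      = inverse (coframe_det l n) * inverse (coframe_det l n) * (- coframe_det l n)"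
  proof -
    have "(axis 1 1 :: real^2) $ 1 = 1" "(axis 1 1 :: real^2) $ 2 = 0"
      "(axis 2 1 :: real^2) $ 1 = 0" "(axis 2 1 :: real^2) $ 2 = 1" by (simp_all add: axis_def)
    then have "dual_vec n l $ 1 = - inverse (coframe_det l n) * l (axis 2 1)"
      "dual_vec n l $ 2 = inverse (coframe_det l n) * l (axis 1 1)"
      "dual_vec l n $ 1 = inverse (coframe_det l n) * n (axis 2 1)"
      "dual_vec l n $ 2 = - inverse (coframe_det l n) * n (axis 1 1)"
      unfolding dual_vec_def coframe_det_swap[of n l] by simp_all
    moreover have "- coframe_det l n = l (axis 2 1) * n (axis 1 1) - l (axis 1 1) * n (axis 2 1)"
      by (simp add: coframe_det_def)
    ultimately show ?thesis by algebra
  qed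
  finally show ?thesis using assms by (simp add: field_simps)
qed

context brinkmann_chart
begin

context
  fixes l n :: "real \<Rightarrow> real^2 \<Rightarrow> real^2 \<Rightarrow> real" and s :: real
  assumes smooth_l: "\<And>w. smooth_map_on (UNIV \<times> V) (\<lambda>(u, y). l u y w)"
    and smooth_n: "\<And>w. smooth_map_on (UNIV \<times> V) (\<lambda>(u, y). n u y w)"
    and lin_l: "\<And>u y. y \<in> V \<Longrightarrow> linear (l u y)" and lin_n: "\<And>u y. y \<in> V \<Longrightarrow> linear (n u y)"
    and det_ln: "\<And>u y. y \<in> V \<Longrightarrow> coframe_det (l u y) (n u y) \<noteq> 0"
    and Q_ln: "\<And>u y w x. y \<in> V \<Longrightarrow> Q u y w x = l u y w * l u y x + n u y w * n u y x"
    and s: "s * s = 1"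
begin

abbreviation E :: "4 \<Rightarrow> real \<times> real \<times> (real^2) \<Rightarrow> real \<times> real \<times> (real^2)" where
  "E k p \<equiv> adapted_frame (h (fst p) (snd (snd p))) (a (fst p) (snd (snd p)))
     (l (fst p) (snd (snd p))) (n (fst p) (snd (snd p))) s k"

lemma E_orthonormal:
  assumes "p \<in> W" shows "G p (E j p) (E k p) = (if j = k then eta j else 0)"
proof -
  obtain u v y where p: "p = (u, v, y)" "y \<in> V" using assms by (auto simp: W_def)
  note dual = dual_vec_eval[OF lin_l[OF p(2)] lin_n[OF p(2)] det_ln[OF p(2)]]
  note [simp] = linear_0[OF linear_a[OF p(2)]] linear_cmul[OF linear_a[OF p(2)]] bilinear_lzero[OF bilinear_Q[OF p(2)]]
    bilinear_rzero[OF bilinear_Q[OF p(2)]] bilinear_lmul[OF bilinear_Q[OF p(2)]] bilinear_rmul[OF bilinear_Q[OF p(2)]]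
    linear_0[OF lin_l[OF p(2)]] linear_0[OF lin_n[OF p(2)]] linear_cmul[OF lin_l[OF p(2)]] linear_cmul[OF lin_n[OF p(2)]]
  have "\<forall>j k. G p (E j p) (E k p) = (if j = k then eta j else 0)"
    unfolding forall_4 p(1)
    by (simp add: adapted_frame_simps G_eq[OF p(2)] Q_ln[OF p(2)] dual eta_def s field_simps)
  then show ?thesis by blast
qed

text \<open>The vector \<open>e\<^sub>3\<close> is metrically dual to the pull-back of \<open>l\<close>. This links the connection matrix to
  \<open>coframe_lift_derivative\<close>.\<close>

lemma G_E3:
  assumes "y \<in> V" shows "G (u, v, y) (E 3 (u, v, y)) (0, b, w) = l u y w"
  using dual_vec_eval[OF lin_l[OF assms] lin_n[OF assms] det_ln[OF assms]]
  by (simp add: adapted_frame_simps G_eq[OF assms] Q_ln[OF assms])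

lemma smooth_E: "smooth_map_on W (E k)"
proof -
  have det': "coframe_det (n (fst p) (snd (snd p))) (l (fst p) (snd (snd p))) \<noteq> 0"
    "coframe_det (l (fst p) (snd (snd p))) (n (fst p) (snd (snd p))) \<noteq> 0" if "p \<in> W" for p
    using that det_ln[of "snd (snd p)" "fst p"]
      coframe_det_swap[of "n (fst p) (snd (snd p))" "l (fst p) (snd (snd p))"] by (auto simp: W_def)
  note dual = smooth_dual_vec[OF open_W smooth_pullback[OF smooth_n] smooth_pullback[OF smooth_l] det'(1)]
    smooth_dual_vec[OF open_W smooth_pullback[OF smooth_l] smooth_pullback[OF smooth_n] det'(2)]
  have bl: "bounded_linear (\<lambda>w :: real^2. (0 :: real, 0 :: real, w))"
    by (intro bounded_linear_Pair bounded_linear_zero bounded_linear_ident)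
  have horizontal: "smooth_map_on W (\<lambda>p. (- a (fst p) (snd (snd p)) (D p)) *\<^sub>R (0 :: real, 1 :: real, 0) + (0, 0, D p))"
    if D: "smooth_map_on W D" for D
  proof -
    have bil: "bilinear (\<lambda>w b. a (fst p) (snd (snd p)) w * b)" if "p \<in> W" for p
    proof -
      have "linear (a (fst p) (snd (snd p)))" using that by (auto simp: W_def intro: linear_a)
      then show ?thesis by (simp add: bilinear_def linear_iff distrib_left distrib_right)
    qed
    have ad: "smooth_map_on W (\<lambda>p. a (fst p) (snd (snd p)) (D p) * 1)"
      by (rule smooth_map_on_bilinear_family[where G = "\<lambda>p w b. a (fst p) (snd (snd p)) w * b" and W = "\<lambda>p. 1::real",
            OF open_W bil smooth_map_on_mult[OF open_W smooth_pullback[OF smooth_a] smooth_map_on_const] D smooth_map_on_const])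
    have emb: "smooth_map_on W (\<lambda>p. (0 :: real, 0 :: real, D p))"
      by (rule smooth_map_on_linear_image[OF open_W bl D])
    show ?thesis
      by (intro smooth_map_on_add[OF open_W] smooth_map_on_scaleR[OF open_W] smooth_map_on_minus[OF open_W]
          smooth_map_on_const emb ad[unfolded mult_1_right])
  qed
  have e1: "E 1 = (\<lambda>p. (1, 1/2, 0) + h (fst p) (snd (snd p)) *\<^sub>R (0, - 1/2, 0))"
    and e4: "E 4 = (\<lambda>p. (- 1, 1/2, 0) + h (fst p) (snd (snd p)) *\<^sub>R (0, 1/2, 0))"
    by (auto simp: fun_eq_iff adapted_frame_simps)
  have e3: "E 3 = (\<lambda>p. (- a (fst p) (snd (snd p)) (dual_vec (l (fst p) (snd (snd p))) (n (fst p) (snd (snd p))))) *\<^sub>R (0, 1, 0)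
       + (0, 0, dual_vec (l (fst p) (snd (snd p))) (n (fst p) (snd (snd p)))))"
    and e2: "E 2 = (\<lambda>p. s *\<^sub>R ((- a (fst p) (snd (snd p)) (dual_vec (n (fst p) (snd (snd p))) (l (fst p) (snd (snd p))))) *\<^sub>R (0, 1, 0)
       + (0, 0, dual_vec (n (fst p) (snd (snd p))) (l (fst p) (snd (snd p))))))"
    by (auto simp: fun_eq_iff adapted_frame_simps)
  have "smooth_map_on W (E 1)" "smooth_map_on W (E 4)" unfolding e1 e4
    by (intro smooth_map_on_add[OF open_W] smooth_map_on_scaleR[OF open_W] smooth_map_on_const smooth_pullback[OF smooth_h])+
  moreover have "smooth_map_on W (E 2)" unfolding e2
    by (rule smooth_map_on_scaleR[OF open_W smooth_map_on_const horizontal[OF dual(1)]])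
  moreover have "smooth_map_on W (E 3)" unfolding e3
    by (rule horizontal[OF dual(2)])
  ultimately have "\<forall>k. smooth_map_on W (E k)" unfolding forall_4 by (intro conjI)
  then show ?thesis by (rule spec)
qed

text \<open>The entries \<open>\<omega>\<^sub>a\<^sub>1 + \<omega>\<^sub>a\<^sub>4\<close> of the connection matrix vanish since \<open>e\<^sub>1 + e\<^sub>4 = \<partial>\<^sub>v\<close> is parallel, and
  \<open>\<omega>\<^sub>2\<^sub>3 = g(e\<^sub>2, \<nabla>e\<^sub>3)\<close> vanishes since \<open>e\<^sub>3\<close> is dual to \<open>l\<close>.\<close>

lemma adapted_spinor_parallel:
  assumes p: "p \<in> W"
    and par: "\<And>u y z w. y \<in> V \<Longrightarrow> frechet_derivative (\<lambda>y. l u y w) (at y) z = l u y (coord_christoffel (Q u) y z w)"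
    and cond: "\<And>u y w x. y \<in> V \<Longrightarrow> frechet_derivative (\<lambda>y. a u y x) (at y) w - frechet_derivative (\<lambda>y. a u y w) (at y) x
      = (deriv (\<lambda>s. n s y w) u * n u y x - deriv (\<lambda>s. n s y x) u * n u y w)
      + (deriv (\<lambda>s. l s y w) u * l u y x - deriv (\<lambda>s. l s y x) u * l u y w)"
  shows "spin_lift (\<lambda>j k. G p (E j p) (frechet_derivative (E k) (at p) z + coord_christoffel G p z (E k p))) *v axis 1 1 = 0"
proof -
  obtain u v y where P: "p = (u, v, y)" and y: "y \<in> V" using p by (auto simp: W_def)
  define DE where "DE = (\<lambda>k z. frechet_derivative (E k) (at p) z + coord_christoffel G p z (E k p))"
  have E: "((E k) has_derivative frechet_derivative (E k) (at p)) (at p)" for k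
    using smooth_map_on_differentiable[OF smooth_E p] by (simp add: frechet_derivative_works)
  have skew: "G p (E j p) (DE k z) = - G p (E k p) (DE j z)" for j k z
    unfolding DE_def by (rule frame_connection_skew[OF p open_W p E_orthonormal E])
  have null: "DE 1 z + DE 4 z = 0"
  proof -
    have "((\<lambda>p. E 1 p + E 4 p) has_derivative (\<lambda>z. frechet_derivative (E 1) (at p) z + frechet_derivative (E 4) (at p) z)) (at p)"
      by (rule has_derivative_add[OF E E])
    from fun_cong[OF has_derivative_unique[OF this[unfolded adapted_frame_null] has_derivative_const]]
    have "frechet_derivative (E 1) (at p) z + frechet_derivative (E 4) (at p) z = 0" .
    moreover have "coord_christoffel G p z (E 1 p) + coord_christoffel G p z (E 4 p) = 0"
    proof -
      have "coord_christoffel G p z (E 1 p) + coord_christoffel G p z (E 4 p) = coord_christoffel G p z (E 1 p + E 4 p)"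
        by (rule linear_add[OF linear_christoffel[OF p], symmetric])
      also have "\<dots> = coord_christoffel G p z (0, 1, 0)" by (simp only: adapted_frame_null)
      also have "\<dots> = 0" unfolding P by (rule christoffel_null[OF y])
      finally show ?thesis .
    qed
    moreover have "DE 1 z + DE 4 z = (frechet_derivative (E 1) (at p) z + frechet_derivative (E 4) (at p) z)
        + (coord_christoffel G p z (E 1 p) + coord_christoffel G p z (E 4 p))"
      unfolding DE_def by (simp only: add_ac)
    ultimately show ?thesis by simp
  qed
  have e3: "G p (E 2 p) (DE 3 z) = 0"
  proof -
    \<comment> \<open>The value of \<open>e\<^sub>2\<close> at \<open>p\<close> is kept constant, and \<open>g(e\<^sub>3, e\<^sub>2)\<close> is differentiated in two ways.\<close>
    obtain b w where e2: "E 2 p = (0, b, w)" by (simp add: adapted_frame_simps)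
    have D1: "((\<lambda>p'. G p' (E 3 p') (0, b, w)) has_derivative
        (\<lambda>z. G p (DE 3 z) (0, b, w) + G p (E 3 p) (0 + coord_christoffel G p z (0, b, w)))) (at p)"
      unfolding DE_def by (rule metric_compatible[OF p E has_derivative_const])
    have D2: "((\<lambda>p'. G p' (E 3 p') (0, b, w)) has_derivative (\<lambda>z. l u y (tangential_christoffel u v y z w))) (at p)"
    proof (rule has_derivative_transform_within_open[OF _ open_W p])
      show "((\<lambda>p. l (fst p) (snd (snd p)) w) has_derivative (\<lambda>z. l u y (tangential_christoffel u v y z w))) (at p)"
        unfolding P
        by (rule coframe_lift_derivative[OF y smooth_l smooth_n lin_l[OF y] lin_n[OF y] det_ln[OF y] Q_ln[OF y] par[OF y] cond[OF y]])
      show "l (fst p') (snd (snd p')) w = G p' (E 3 p') (0, b, w)" if "p' \<in> W" for p'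
        using that G_E3 by (cases p') (auto simp: W_def)
    qed
    from fun_cong[OF has_derivative_unique[OF D1 D2]] have "G p (DE 3 z) (0, b, w) + G p (E 3 p) (0 + coord_christoffel G p z (0, b, w))
        = l u y (tangential_christoffel u v y z w)" .
    moreover have "G p (E 3 p) (coord_christoffel G p z (0, b, w)) = l u y (tangential_christoffel u v y z w)"
    proof -
      have "coord_christoffel G p z (0, b, w) = coord_christoffel G p z (b *\<^sub>R (0, 1, 0) + (0, 0, w))" by simp
      also have "\<dots> = coord_christoffel G p z (0, 0, w)"
        unfolding linear_add[OF linear_christoffel[OF p]] linear_cmul[OF linear_christoffel[OF p]]
        unfolding P christoffel_null[OF y] by simp
      finally have eq: "coord_christoffel G p z (0, b, w) = coord_christoffel G p z (0, 0, w)" .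
      obtain c x where c: "coord_christoffel G p z (0, 0, w) = (0, c, x)"
        using fst_christoffel[OF y, of u v z "(0, 0, w)"] by (cases "coord_christoffel G p z (0, 0, w)") (auto simp: P)
      then have "tangential_christoffel u v y z w = x" by (simp add: tangential_christoffel_def[OF y] P)
      then show ?thesis unfolding eq c unfolding P G_E3[OF y] by simp
    qed
    ultimately have "G p (DE 3 z) (E 2 p) = 0" unfolding e2 by simp
    then show ?thesis by (simp add: symmetric[OF p, of "E 2 p"])
  qed
  have "spin_lift (\<lambda>j k. G p (E j p) (DE k z)) *v axis 1 1 = 0"
  proof (rule spin_lift_annihilates)
    show "G p (E j p) (DE k z) = - G p (E k p) (DE j z)" for j k by (rule skew)
    show "G p (E 2 p) (DE 3 z) = 0" by (rule e3)
    show "G p (E k p) (DE 1 z) + G p (E k p) (DE 4 z) = 0" for k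
      unfolding bilinear_radd[OF bilinear[OF p], symmetric] null by (rule bilinear_rzero[OF bilinear[OF p]])
  qed
  then show ?thesis unfolding DE_def .
qed

end

end

section \<open>Charts of the space-time\<close>

lemma smooth_atlasD:
  assumes "smooth_atlas A"
  shows "open (chart_dom A i)" "open (chart_map A i ` chart_dom A i)"
    "x \<in> chart_dom A i \<Longrightarrow> chart_inv A i (chart_map A i x) = x"
    "y \<in> chart_map A i ` chart_dom A i \<Longrightarrow> chart_map A i (chart_inv A i y) = y"
    "y \<in> chart_map A i ` chart_dom A i \<Longrightarrow> chart_inv A i y \<in> chart_dom A i"
    "continuous_on (chart_map A i ` chart_dom A i) (chart_inv A i)"
    "continuous_on (chart_dom A i) (chart_map A i)"
    "\<exists>i. x \<in> chart_dom A i"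
    "smooth_map_on (chart_map A i ` (chart_dom A i \<inter> chart_dom A j)) (transition A i j)"
proof -
  note A = assms[unfolded smooth_atlas_def, THEN conjunct2, THEN conjunct1, rule_format, of i]
  show "open (chart_dom A i)" "open (chart_map A i ` chart_dom A i)" using A by simp_all
  have hom: "homeomorphism (chart_dom A i) (chart_map A i ` chart_dom A i) (chart_map A i) (chart_inv A i)"
    using A by simp
  show "chart_inv A i (chart_map A i x) = x" if "x \<in> chart_dom A i"
    by (rule homeomorphism_apply1[OF hom that])
  show "chart_map A i (chart_inv A i y) = y" if "y \<in> chart_map A i ` chart_dom A i"
    by (rule homeomorphism_apply2[OF hom that])
  show "chart_inv A i y \<in> chart_dom A i" if "y \<in> chart_map A i ` chart_dom A i"
    using homeomorphism_image2[OF hom] that by (metis imageI)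
  show "continuous_on (chart_map A i ` chart_dom A i) (chart_inv A i)"
    by (rule homeomorphism_cont2[OF hom])
  show "continuous_on (chart_dom A i) (chart_map A i)"
    by (rule homeomorphism_cont1[OF hom])
  have "x \<in> (\<Union>i. chart_dom A i)"
    using assms[unfolded smooth_atlas_def, THEN conjunct1] by (simp only: UNIV_I)
  then show "\<exists>i. x \<in> chart_dom A i" by simp
  show "smooth_map_on (chart_map A i ` (chart_dom A i \<inter> chart_dom A j)) (transition A i j)"
    using assms[unfolded smooth_atlas_def, THEN conjunct2, THEN conjunct2] by (elim allE)
qed

lemma open_chart_image:
  assumes "open (chart_map A i ` chart_dom A i)" "continuous_on (chart_map A i ` chart_dom A i) (chart_inv A i)"
    "\<And>x. x \<in> chart_dom A i \<Longrightarrow> chart_inv A i (chart_map A i x) = x" "open U"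
  shows "open (chart_map A i ` (chart_dom A i \<inter> U))"
proof -
  have "chart_map A i ` (chart_dom A i \<inter> U) = (chart_map A i ` chart_dom A i) \<inter> chart_inv A i -` U"
    using assms(3) by force
  then show ?thesis using continuous_open_preimage[OF assms(2,1,4)] by simp
qed

lemma coord_vec_nth [simp]:
  "coord_vec w $ 1 = fst w" "coord_vec w $ 2 = fst (snd w)"
  "coord_vec w $ 3 = snd (snd w) $ 1" "coord_vec w $ 4 = snd (snd w) $ 2"
  by (simp_all add: coord_vec_def split_beta)

lemma linear_coord_vec: "linear coord_vec"
  by (rule linearI) (simp_all add: vec_eq_iff forall_4)

lemma coord_vec_inject: "coord_vec w = coord_vec w' \<Longrightarrow> w = w'"
  by (simp add: vec_eq_iff forall_4 forall_2 prod_eq_iff)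

lemma spanning_of_det:
  fixes e :: "4 \<Rightarrow> real \<times> real \<times> (real^2)"
  assumes "det (\<chi> a. coord_vec (e a)) \<noteq> 0"
  shows "\<exists>c. w = (\<Sum>a\<in>UNIV. c a *\<^sub>R e a)"
proof -
  define A where "A = (\<chi> a. coord_vec (e a))"
  have "invertible (transpose A)" using assms by (simp add: invertible_det_nz A_def)
  then obtain B where B: "transpose A ** B = mat 1" unfolding invertible_def by blast
  define x where "x = B *v coord_vec w"
  have "transpose A *v x = coord_vec w"
    by (simp add: x_def matrix_vector_mul_assoc B)
  then have "coord_vec w = (\<Sum>a\<in>UNIV. x $ a *\<^sub>R coord_vec (e a))"
    by (simp add: vec_eq_iff matrix_vector_mult_def transpose_def A_def mult.commute)
  also have "\<dots> = coord_vec (\<Sum>a\<in>UNIV. x $ a *\<^sub>R e a)"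
    by (simp add: linear_sum[OF linear_coord_vec] linear_cmul[OF linear_coord_vec])
  finally show ?thesis using coord_vec_inject by blast
qed

lemma brinkmann_atlas_simps [simp]:
  "(u, v, x) \<in> chart_dom (brinkmann_atlas X) i \<longleftrightarrow> x \<in> chart_dom X i"
  "chart_map (brinkmann_atlas X) i (u, v, x) = (u, v, chart_map X i x)"
  by (simp_all add: brinkmann_atlas_def)

locale brinkmann_data =
  fixes X :: "('i, 'x::{t2_space,second_countable_topology}, real^2) atlas"
    and H :: "real \<Rightarrow> 'x \<Rightarrow> real" and \<alpha> :: "real \<Rightarrow> ('i, 'x, real^2) one_form"
    and q :: "real \<Rightarrow> ('i, 'x, real^2) two_tensor"
  assumes atlas: "smooth_atlas X" and H: "smooth_fun_family X H"
    and \<alpha>: "smooth_form_family X \<alpha>" and q: "smooth_riemannian_family X q"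
begin

abbreviation M where "M \<equiv> brinkmann_atlas X"
abbreviation g where "g \<equiv> brinkmann_metric H \<alpha> q"
abbreviation V where "V i \<equiv> chart_map X i ` chart_dom X i"

lemma M_inv_chart [simp]:
  assumes "x \<in> chart_dom X i"
  shows "chart_inv M i (u, v, chart_map X i x) = (u, v, x)"
proof -
  have inj: "inj_on (chart_map X i) (chart_dom X i)"
    by (rule inj_on_inverseI[of _ "chart_inv X i"]) (rule smooth_atlasD(3)[OF atlas])
  have "inj_on (chart_map M i) (chart_dom M i)"
    by (auto simp: inj_on_def dest: inj_onD[OF inj])
  from inv_into_f_f[OF this, of "(u, v, x)"] show ?thesis
    using assms by (simp add: chart_inv_def)
qed

text \<open>Outside the image of the chart the two sides may differ, because there \<open>chart_inv\<close> is an arbitrary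
  choice for \<open>M\<close> and for \<open>X\<close> independently.\<close>

lemma M_inv: "y \<in> V i \<Longrightarrow> chart_inv M i (u, v, y) = (u, v, chart_inv X i y)"
  by (auto simp: smooth_atlasD(3)[OF atlas])

sublocale C: brinkmann_chart "V i" "\<lambda>u y. H u (chart_inv X i y)" "\<lambda>u y. \<alpha> u i (chart_inv X i y)"
  "\<lambda>u y. q u i (chart_inv X i y)" "\<lambda>p. g i (chart_inv M i p)" for i
proof (rule brinkmann_chart.intro)
  show "open (V i)" by (rule smooth_atlasD(2)[OF atlas])
  note inv = smooth_atlasD(5)[OF atlas]
  show "linear (\<alpha> u i (chart_inv X i y))" if "y \<in> V i" for u y
    using \<alpha> inv[OF that] unfolding smooth_form_family_def is_one_form_def by blast
  have Q: "is_riemannian X (q u)" for u using q unfolding smooth_riemannian_family_def by blast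
  show "bilinear (q u i (chart_inv X i y))" if "y \<in> V i" for u y
    using Q[of u] inv[OF that] unfolding is_riemannian_def by blast
  show "q u i (chart_inv X i y) w w' = q u i (chart_inv X i y) w' w" if "y \<in> V i" for u y w w'
    using Q[of u] inv[OF that] unfolding is_riemannian_def by blast
  show "q u i (chart_inv X i y) w w > 0" if "y \<in> V i" "w \<noteq> 0" for u y w
    using Q[of u] inv[OF that(1)] that(2) unfolding is_riemannian_def by blast
  show "smooth_map_on (UNIV \<times> V i) (\<lambda>(u, y). H u (chart_inv X i y))"
    using H unfolding smooth_fun_family_def by blast
  show "smooth_map_on (UNIV \<times> V i) (\<lambda>(u, y). \<alpha> u i (chart_inv X i y) w)" for w
    using \<alpha> unfolding smooth_form_family_def by blast
  show "smooth_map_on (UNIV \<times> V i) (\<lambda>(u, y). q u i (chart_inv X i y) w w')" for w w'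
    using q unfolding smooth_riemannian_family_def by blast
  show "g i (chart_inv M i (u, v, y)) (p, s, w) (p', s', w') = H u (chart_inv X i y) * p * p' +
     (p * \<alpha> u i (chart_inv X i y) w' + p' * \<alpha> u i (chart_inv X i y) w) + (p * s' + p' * s) +
     q u i (chart_inv X i y) w w'" if "y \<in> V i" for u v y p s w p' s' w'
    by (simp add: M_inv[OF that] brinkmann_metric_def)
qed

lemma image_M: "chart_map M i ` chart_dom M i = C.W i"
  by (auto simp: C.W_def image_iff brinkmann_atlas_def)

lemma M_inv_map: "m \<in> chart_dom M i \<Longrightarrow> chart_inv M i (chart_map M i m) = m"
  by (cases m) auto

lemma M_map_in: "m \<in> chart_dom M i \<Longrightarrow> chart_map M i m \<in> C.W i"
  using image_M by blast

lemma M_inv_in: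
  assumes "p \<in> C.W i" shows "chart_inv M i p \<in> chart_dom M i" "chart_map M i (chart_inv M i p) = p"
proof -
  obtain m where "m \<in> chart_dom M i" "p = chart_map M i m" using assms image_M by blast
  then show "chart_inv M i p \<in> chart_dom M i" "chart_map M i (chart_inv M i p) = p"
    by (simp_all add: M_inv_map)
qed

lemma continuous_M_inv: "continuous_on (C.W i) (chart_inv M i)"
proof -
  have "continuous_on (C.W i) (\<lambda>p. (fst p, fst (snd p), chart_inv X i (snd (snd p))))"
    by (intro continuous_intros continuous_on_compose2[OF smooth_atlasD(6)[OF atlas, of i]])
       (auto simp: C.W_def)
  then show ?thesis
    by (rule continuous_on_cong[THEN iffD1, rotated -1]) (auto simp: C.W_def M_inv)
qed

lemma open_M_image: "open U \<Longrightarrow> open (chart_map M i ` (chart_dom M i \<inter> U))"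
  by (rule open_chart_image) (auto simp: image_M C.open_W continuous_M_inv M_inv_map)

lemma christoffel_M:
  "m \<in> chart_dom M i \<Longrightarrow> christoffel M g i m = coord_christoffel (\<lambda>p. g i (chart_inv M i p)) (chart_map M i m)"
  by (intro ext christoffel_in_chart M_inv_map)

lemma christoffel_X:
  "x \<in> chart_dom X i \<Longrightarrow> christoffel X (q u) i x = coord_christoffel (\<lambda>y. q u i (chart_inv X i y)) (chart_map X i x)"
  by (intro ext christoffel_in_chart smooth_atlasD(3)[OF atlas])

lemma transition_has_derivative:
  assumes "x \<in> chart_dom X i" "x \<in> chart_dom X j"
  shows "(transition X i j has_derivative jac X i j x) (at (chart_map X i x))"
proof -
  have x: "chart_map X i x \<in> chart_map X i ` (chart_dom X i \<inter> chart_dom X j)" using assms by auto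
  show ?thesis
    using smooth_map_on_differentiable[OF smooth_atlasD(9)[OF atlas] x]
    unfolding frechet_derivative_works jac_def[abs_def] chart_D_def transition_def[abs_def] .
qed

lemma linear_jac: "x \<in> chart_dom X i \<Longrightarrow> x \<in> chart_dom X j \<Longrightarrow> linear (jac X i j x)"
  by (rule has_derivative_linear[OF transition_has_derivative])

lemma jac_M:
  assumes "x \<in> chart_dom X i" "x \<in> chart_dom X j"
  shows "jac M i j (u, v, x) (p, s, w) = (p, s, jac X i j x w)"
proof -
  define S where "S = chart_map X i ` (chart_dom X i \<inter> chart_dom X j)"
  have S: "open S" unfolding S_def
    by (rule open_chart_image) (simp_all add: smooth_atlasD[OF atlas])
  have x: "chart_map X i x \<in> S" using assms by (auto simp: S_def)
  have "(transition X i j has_derivative jac X i j x) (at (chart_map X i x))"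
    by (rule transition_has_derivative[OF assms])
  then have "((\<lambda>p. transition X i j (snd (snd p))) has_derivative (\<lambda>w. jac X i j x (snd (snd w)))) (at (u, v, chart_map X i x))"
    by (intro has_derivative_compose[of "\<lambda>p. snd (snd p)" "\<lambda>p. snd (snd p)" "(u, v, chart_map X i x)" UNIV "transition X i j"])
       (auto intro!: derivative_eq_intros)
  then have D: "((\<lambda>p. (fst p, fst (snd p), transition X i j (snd (snd p)))) has_derivative
      (\<lambda>w. (fst w, fst (snd w), jac X i j x (snd (snd w))))) (at (u, v, chart_map X i x))"
    by (auto intro!: derivative_eq_intros)
  have "((\<lambda>p. chart_map M j (chart_inv M i p)) has_derivative
      (\<lambda>w. (fst w, fst (snd w), jac X i j x (snd (snd w))))) (at (u, v, chart_map X i x))"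
  proof (rule has_derivative_transform_within_open[OF D])
    show "open (UNIV \<times> UNIV \<times> S)" using S by (intro open_Times) auto
    show "(u, v, chart_map X i x) \<in> UNIV \<times> UNIV \<times> S" using x by simp
    show "(fst p, fst (snd p), transition X i j (snd (snd p))) = chart_map M j (chart_inv M i p)"
      if "p \<in> UNIV \<times> UNIV \<times> S" for p
      using that by (auto simp: S_def transition_def smooth_atlasD(3)[OF atlas])
  qed
  from has_derivative_frechet_eq[OF this] show ?thesis
    unfolding jac_def[of M] chart_D_def by simp
qed

lemma metric_jac:
  assumes "m \<in> chart_dom M i" "m \<in> chart_dom M j"
  shows "g i m w w' = g j m (jac M i j m w) (jac M i j m w')"
proof -
  obtain u v x where m: "m = (u, v, x)" "x \<in> chart_dom X i" "x \<in> chart_dom X j"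
    using assms by (cases m) auto
  have "is_one_form X (\<alpha> u)" "is_riemannian X (q u)"
    using \<alpha> q by (simp_all add: smooth_form_family_def smooth_riemannian_family_def)
  then have "\<alpha> u i x w = \<alpha> u j x (jac X i j x w)" "q u i x w w' = q u j x (jac X i j x w) (jac X i j x w')" for w w'
    using m(2,3) unfolding is_one_form_def is_riemannian_def by blast+
  then show ?thesis unfolding m(1) by (cases w; cases w') (simp add: jac_M[OF m(2,3)] brinkmann_metric_def)
qed

end

section \<open>From a parallel spinor to a parallel coframe\<close>

text \<open>Passing to another local section of the spin bundle changes the spinor by \<open>h\<close> and the frame by the
  Lorentz matrix covered by \<open>h\<close>; the two-forms do not change, since \<open>h\<close> preserves the pairing and
  commutes with \<open>P\<close>.\<close>

lemma spinor_frame_change: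
  assumes h: "h \<in> Spin_plus" and P: "P \<in> chirality_operators"
    and lorentz: "lorentz_frame g e" "lorentz_frame g e'"
    and e': "\<And>b. e' b = (\<Sum>a\<in>UNIV. \<Lambda> $ a $ b *\<^sub>R e a)"
    and lift: "\<And>b. h ** gamma b = (\<Sum>a\<in>UNIV. \<Lambda> $ a $ b *\<^sub>R gamma a) ** h"
  shows "two_form P (h *v \<psi>) (frame_components g e w) (frame_components g e w')
    = two_form P \<psi> (frame_components g e' w) (frame_components g e' w')"
proof -
  interpret e: lorentz_frame g e by (rule lorentz)
  interpret e': lorentz_frame g e' by (rule lorentz)
  have comp: "frame_components g e w = (\<chi> a. \<Sum>b\<in>UNIV. frame_components g e' w $ b * \<Lambda> $ a $ b)" for w
  proof -
    have "w = (\<Sum>b\<in>UNIV. frame_components g e' w $ b *\<^sub>R (\<Sum>a\<in>UNIV. \<Lambda> $ a $ b *\<^sub>R e a))"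
      using e'.frame_expansion[of w] unfolding e' .
    also have "\<dots> = (\<Sum>a\<in>UNIV. (\<Sum>b\<in>UNIV. frame_components g e' w $ b * \<Lambda> $ a $ b) *\<^sub>R e a)"
      unfolding scaleR_sum_right scaleR_sum_left scaleR_scaleR by (rule sum.swap)
    finally have "frame_components g e w
        = frame_components g e (\<Sum>a\<in>UNIV. (\<Sum>b\<in>UNIV. frame_components g e' w $ b * \<Lambda> $ a $ b) *\<^sub>R e a)"
      by (rule arg_cong)
    then show ?thesis unfolding e.frame_components_sum .
  qed
  have cl: "cliff (frame_components g e w) *v (h *v \<phi>) = h *v (cliff (frame_components g e' w) *v \<phi>)" for w \<phi>
  proof -
    have "h *v (cliff (frame_components g e' w) *v \<phi>)
        = (\<Sum>b\<in>UNIV. frame_components g e' w $ b *\<^sub>R ((h ** gamma b) *v \<phi>))"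
      by (simp add: cliff_def sum_4 matrix_vector_mult_add_rdistrib scaleR_matrix_vector_assoc[symmetric]
          matrix_vector_right_distrib matrix_vector_mult_scaleR matrix_vector_mul_assoc)
    also have "\<dots> = cliff (frame_components g e w) *v (h *v \<phi>)"
      unfolding lift comp[of w]
      by (simp add: cliff_def sum_4 matrix_vector_mult_add_rdistrib scaleR_matrix_vector_assoc[symmetric]
          matrix_vector_mul_assoc[symmetric] scaleR_add_right scaleR_add_left add_ac)
    finally show ?thesis by simp
  qed
  have "P *v (h *v \<psi>) = h *v (P *v \<psi>)"
    using P Spin_plus_volume_element[OF h] by (auto simp: chirality_operators_def matrix_vector_mul_lid)
  then show ?thesis unfolding two_form_def by (simp add: cl Spin_plus_pairing[OF h])
qed

lemma coframe_det_of_metric: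
  assumes "linear l" "linear n" and pos: "\<And>w. w \<noteq> 0 \<Longrightarrow> l w * l w + n w * n w > (0::real)"
  shows "coframe_det l n \<noteq> 0"
proof
  assume d: "coframe_det l n = 0"
  define v where "v = n (axis 2 1) *\<^sub>R axis 1 1 - n (axis 1 1) *\<^sub>R (axis 2 1 :: real^2)"
  define v' where "v' = l (axis 2 1) *\<^sub>R axis 1 1 - l (axis 1 1) *\<^sub>R (axis 2 1 :: real^2)"
  have "l v = 0" "n v = 0" "l v' = 0" "n v' = 0"
    using d by (simp_all add: v_def v'_def linear_diff linear_cmul assms coframe_det_def mult.commute)
  then have "v = 0" "v' = 0" using pos[of v] pos[of v'] by force+
  then have "n (axis 1 1) = 0" "l (axis 1 1) = 0"
    by (simp_all add: v_def v'_def vec_eq_iff forall_2 axis_def)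
  moreover have "axis 1 1 \<noteq> (0 :: real^2)" by (simp add: axis_eq_0_iff)
  ultimately show False using pos[of "axis 1 1"] by simp
qed

lemma sharp_coframe:
  fixes q :: "('i, 'x, real^2) two_tensor"
  assumes lin: "linear (l i x)" "linear (n i x)" and det: "coframe_det (l i x) (n i x) \<noteq> 0"
    and q: "\<And>w w'. q i x w w' = l i x w * l i x w' + n i x w * n i x w'"
  shows "sharp q l i x = dual_vec (l i x) (n i x)" "sharp q n i x = dual_vec (n i x) (l i x)"
proof -
  note dual = dual_vec_eval[OF lin det]
  have eq: "z = z'" if "\<And>w. q i x z w = q i x z' w" for z z'
  proof -
    have "l i x z = l i x z'" "n i x z = n i x z'"
      using that[of "dual_vec (l i x) (n i x)"] that[of "dual_vec (n i x) (l i x)"] by (simp_all add: q dual)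
    then show ?thesis using coframe_expansion[OF lin det, of z] coframe_expansion[OF lin det, of z'] by simp
  qed
  have l: "q i x (dual_vec (l i x) (n i x)) w = l i x w" and n: "q i x (dual_vec (n i x) (l i x)) w = n i x w" for w
    by (simp_all add: q dual)
  show "sharp q l i x = dual_vec (l i x) (n i x)" unfolding sharp_def
    by (rule the_equality) (auto intro!: eq simp: l)
  show "sharp q n i x = dual_vec (n i x) (l i x)" unfolding sharp_def
    by (rule the_equality) (auto intro!: eq simp: n)
qed

text \<open>Polarization.\<close>

lemma orthonormal_pair_metric:
  fixes Q :: "'e::real_vector \<Rightarrow> 'e \<Rightarrow> real"
  assumes Q: "bilinear Q" "\<And>v w. Q v w = Q w v" and l: "linear l" and n: "linear n"
    and sq: "\<And>w. Q w w = l w * l w + n w * n w"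
  shows "Q v w = l v * l w + n v * n w"
proof -
  have "Q (v + w) (v + w) = Q v v + 2 * Q v w + Q w w"
    by (simp add: bilinear_ladd[OF Q(1)] bilinear_radd[OF Q(1)] Q(2)[of w v])
  then show ?thesis unfolding sq by (simp add: linear_add[OF l] linear_add[OF n] algebra_simps)
qed

locale adapted_spinor = brinkmann_data X H \<alpha> q
  for X :: "('i, 'x::{t2_space,second_countable_topology}, real^2) atlas"
    and H :: "real \<Rightarrow> 'x \<Rightarrow> real" and \<alpha> :: "real \<Rightarrow> ('i, 'x, real^2) one_form"
    and q :: "real \<Rightarrow> ('i, 'x, real^2) two_tensor" +
  fixes U e h \<epsilon>
  assumes spin: "spin_structure M g U e h" and parallel: "parallel_spinor M g U e h \<epsilon>"
    and adapted: "\<And>p i x. x \<in> U p \<inter> chart_dom M i \<Longrightarrow> dirac_current (e p) (\<epsilon> p x) i x = d_v"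
begin

lemma open_U: "open (U p)" and in_U: "p \<in> U p" and oriented: "oriented_frame_on M g (U p) (e p)"
  using spin[unfolded spin_structure_def, THEN conjunct1, THEN spec, of p] by simp_all

lemma frame_transition:
  assumes "x \<in> U p" "x \<in> U p'"
  shows "h p p' x \<in> Spin_plus" "\<exists>\<Lambda>::real^4^4. \<forall>b.
      (\<forall>i. x \<in> chart_dom M i \<longrightarrow> e p' b i x = (\<Sum>a\<in>UNIV. \<Lambda> $ a $ b *\<^sub>R e p a i x)) \<and>
      h p p' x ** gamma b = (\<Sum>a\<in>UNIV. \<Lambda> $ a $ b *\<^sub>R gamma a) ** h p p' x"
  using spin[unfolded spin_structure_def, THEN conjunct2, THEN conjunct1, THEN spec, THEN spec,
      THEN conjunct2, THEN bspec, OF IntI[OF assms]] by simp_all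

lemma spinor_transition: "x \<in> U p \<Longrightarrow> x \<in> U p' \<Longrightarrow> \<epsilon> p x = h p p' x *v \<epsilon> p' x"
  by (rule parallel[unfolded parallel_spinor_def spinor_field_def, THEN conjunct1, THEN conjunct2,
      THEN spec, THEN spec, THEN bspec, OF IntI])

lemma spinor_smooth: "smooth_fun_on M (U p) (\<epsilon> p)"
  by (rule parallel[unfolded parallel_spinor_def spinor_field_def, THEN conjunct1, THEN conjunct1, THEN spec])

lemma spinor_parallel:
  "x \<in> U p \<Longrightarrow> x \<in> chart_dom M i \<Longrightarrow>
    chart_D M i (\<epsilon> p) x v + spin_connection M g (e p) i x v *v \<epsilon> p x = 0"
  by (rule parallel[unfolded parallel_spinor_def, THEN conjunct2, THEN conjunct2, THEN spec, THEN spec,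
      THEN bspec, THEN spec, OF IntI])

lemma lorentz_frame_e:
  assumes "m \<in> U p" "m \<in> chart_dom M i"
  shows "lorentz_frame (g i m) (\<lambda>a. e p a i m)"
proof
  have f: "g i m (e p a i m) (e p b i m) = (if a = b then eta a else 0)"
    "det (\<chi> a. coord_vec (e p a i m)) > 0" for a b
    using oriented[of p, unfolded oriented_frame_on_def, THEN conjunct2, THEN spec, THEN bspec, OF IntI[OF assms]]
    by simp_all
  have m: "chart_map M i m \<in> C.W i" "chart_inv M i (chart_map M i m) = m"
    by (simp_all add: M_map_in M_inv_map assms(2))
  show "bilinear (g i m)" using C.bilinear[OF m(1)] by (simp add: m(2))
  show "g i m v w = g i m w v" for v w using C.symmetric[OF m(1)] by (simp add: m(2))
  show "g i m (e p a i m) (e p b i m) = (if a = b then eta a else 0)" for a b by (rule f)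
  show "\<exists>c. w = (\<Sum>a\<in>UNIV. c a *\<^sub>R e p a i m)" for w
    by (rule spanning_of_det) (use f(2) in simp)
qed

definition components where
  "components p i m = frame_components (g i m) (\<lambda>a. e p a i m)"

text \<open>The two-form at \<open>m\<close> is computed in the local section that belongs to the point \<open>m\<close> itself; near \<open>m\<close>
  any fixed section gives the same result, and this is how it is differentiated.\<close>

definition spinor_form where
  "spinor_form P i m w w' = two_form P (\<epsilon> m m) (components m i m w) (components m i m w')"

lemma spinor_form_local:
  assumes m: "m \<in> U p" "m \<in> chart_dom M i" and P: "P \<in> chirality_operators"
  shows "spinor_form P i m w w' = two_form P (\<epsilon> p m) (components p i m w) (components p i m w')"
proof -
  obtain \<Lambda> :: "real^4^4" where "\<And>b. e m b i m = (\<Sum>a\<in>UNIV. \<Lambda> $ a $ b *\<^sub>R e p a i m)"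
    "\<And>b. h p m m ** gamma b = (\<Sum>a\<in>UNIV. \<Lambda> $ a $ b *\<^sub>R gamma a) ** h p m m"
    using frame_transition(2)[OF m(1) in_U] m(2) by blast
  note change = spinor_frame_change[OF frame_transition(1)[OF m(1) in_U] P lorentz_frame_e[OF m] lorentz_frame_e[OF in_U m(2)] this]
  have "\<epsilon> p m = h p m m *v \<epsilon> m m"
    by (rule spinor_transition[OF m(1) in_U])
  then show ?thesis unfolding spinor_form_def components_def by (simp add: change)
qed

lemma current_components:
  assumes m: "m \<in> chart_dom M i"
  shows "current (\<epsilon> m m) (components m i m w) = fst w"
proof -
  interpret f: lorentz_frame "g i m" "\<lambda>a. e m a i m" by (rule lorentz_frame_e[OF in_U m])
  define J where "J = (\<lambda>a. eta a * (\<epsilon> m m \<bullet> (gamma 4 *v (gamma a *v \<epsilon> m m))))"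
  have d_v: "d_v = (\<Sum>a\<in>UNIV. J a *\<^sub>R e m a i m)"
    using adapted[of m m i] in_U[of m] m unfolding dirac_current_def J_def by simp
  have J: "components m i m d_v = (\<chi> a. J a)"
    unfolding components_def d_v by (rule f.frame_components_sum)
  have "current (\<epsilon> m m) c = mink (\<chi> a. J a) c" for c
    by (simp add: current_def mink_def J_def cliff_def sum_4 matrix_vector_mult_add_rdistrib
        scaleR_matrix_vector_assoc[symmetric] matrix_vector_right_distrib matrix_vector_mult_scaleR
        inner_add_right mult_ac)
  then have "current (\<epsilon> m m) (components m i m w) = g i m d_v w"
    using f.mink_frame_components[of d_v w] J by (simp add: components_def)
  also have "\<dots> = fst w"
    using C.G_null[OF M_map_in[OF m], of w] C.symmetric[OF M_map_in[OF m], of w "(0, 1, 0)"]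
    by (simp add: M_inv_map[OF m] d_v_def)
  finally show ?thesis .
qed

lemma spinor_form_bilinear:
  assumes "m \<in> chart_dom M i" shows "bilinear (spinor_form P i m)"
proof -
  interpret f: lorentz_frame "g i m" "\<lambda>a. e m a i m" by (rule lorentz_frame_e[OF in_U assms])
  have "linear (components m i m)" unfolding components_def by (rule f.linear_frame_components)
  then show ?thesis unfolding spinor_form_def[abs_def]
    by (simp add: bilinear_def linear_iff bilinear_ladd[OF bilinear_two_form] bilinear_radd[OF bilinear_two_form]
        bilinear_lmul[OF bilinear_two_form] bilinear_rmul[OF bilinear_two_form])
qed

lemma spinor_form_simple:
  assumes m: "m \<in> chart_dom M i" and P: "P \<in> chirality_operators"
  shows "spinor_form P i m w w' = fst w * spinor_form P i m (1, 0, 0) w' - fst w' * spinor_form P i m (1, 0, 0) w"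
  using P fierz_two_form_simple[of "\<epsilon> m m" "components m i m (1, 0, 0)" "components m i m w" "components m i m w'"]
    fierz_dual_two_form_simple[of "\<epsilon> m m" "components m i m (1, 0, 0)" "components m i m w" "components m i m w'"]
  unfolding chirality_operators_def spinor_form_def current_components[OF m] by auto

lemma spinor_form_norm:
  assumes m: "m \<in> chart_dom M i" and w: "fst w = 0"
  shows "(spinor_form (mat 1) i m (1, 0, 0) w)^2 + (spinor_form volume_element i m (1, 0, 0) w)^2 = g i m w w"
proof -
  interpret f: lorentz_frame "g i m" "\<lambda>a. e m a i m" by (rule lorentz_frame_e[OF in_U m])
  show ?thesis
    using fierz_norm[of "\<epsilon> m m" "components m i m (1, 0, 0)" "components m i m w"]
    unfolding spinor_form_def current_components[OF m] w
    by (simp add: components_def f.mink_frame_components)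
qed

lemma g_on_slice: "x \<in> chart_dom X i \<Longrightarrow> g i (u, v, x) (0, s, w) (0, s', w') = q u i x w w'"
  by (simp add: brinkmann_metric_def)

text \<open>For \<open>w = \<partial>\<^sub>v\<close> the sum of two squares in \<open>spinor_form_norm\<close> is zero because \<open>\<partial>\<^sub>v\<close> is null.\<close>

lemma spinor_form_null:
  assumes m: "m \<in> chart_dom M i" and P: "P \<in> chirality_operators"
  shows "spinor_form P i m (1, 0, 0) (0, 1, 0) = 0"
proof -
  have "g i m (0, 1, 0) (0, 1, 0) = 0"
    using C.G_null[OF M_map_in[OF m], of "(0, 1, 0)"] by (simp add: M_inv_map[OF m])
  then have "(spinor_form (mat 1) i m (1, 0, 0) (0, 1, 0))^2 + (spinor_form volume_element i m (1, 0, 0) (0, 1, 0))^2 = 0"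
    using spinor_form_norm[OF m, of "(0, 1, 0)"] by simp
  then show ?thesis using P unfolding chirality_operators_def by (auto simp: sum_power2_eq_zero_iff)
qed

lemma spinor_form_jac:
  assumes m: "m \<in> chart_dom M i" "m \<in> chart_dom M j"
  shows "spinor_form P i m w w' = spinor_form P j m (jac M i j m w) (jac M i j m w')"
proof -
  have "e m a j m = jac M i j m (e m a i m)" for a
    by (rule oriented[of m, unfolded oriented_frame_on_def smooth_vec_field_on_def, THEN conjunct1, THEN spec,
      THEN conjunct1, THEN spec, THEN spec, THEN bspec, OF IntI[OF IntI[OF in_U m(1)] m(2)]])
  then have "components m j m (jac M i j m w) = components m i m w" for w
    unfolding components_def frame_components_def by (simp add: metric_jac[OF m])
  then show ?thesis unfolding spinor_form_def by simp
qed

lemma local_chart: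
  assumes p: "p \<in> C.W i"
  defines "m \<equiv> chart_inv M i p"
  defines "N \<equiv> chart_map M i ` (chart_dom M i \<inter> U m)"
  shows "open N" "p \<in> N" "N \<subseteq> C.W i" "\<And>p'. p' \<in> N \<Longrightarrow> chart_inv M i p' \<in> U m \<and> chart_inv M i p' \<in> chart_dom M i"
    "\<And>a. smooth_map_on N (\<lambda>p. e m a i (chart_inv M i p))" "smooth_map_on N (\<lambda>p. \<epsilon> m (chart_inv M i p))"
proof -
  show "open N" unfolding N_def by (rule open_M_image[OF open_U])
  show "p \<in> N" unfolding N_def m_def
    by (rule image_eqI[of _ _ "chart_inv M i p"]) (use M_inv_in[OF p] in_U in auto)
  show "N \<subseteq> C.W i" unfolding N_def using M_map_in by blast
  show "chart_inv M i p' \<in> U m \<and> chart_inv M i p' \<in> chart_dom M i" if "p' \<in> N" for p'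
    using that unfolding N_def by (auto simp: M_inv_map)
  show "smooth_map_on N (\<lambda>p. e m a i (chart_inv M i p))" for a
    using oriented[of m, unfolded oriented_frame_on_def smooth_vec_field_on_def, THEN conjunct1, THEN spec,
      THEN conjunct2, THEN spec] unfolding N_def .
  show "smooth_map_on N (\<lambda>p. \<epsilon> m (chart_inv M i p))"
    using spinor_smooth[of m, unfolded smooth_fun_on_def, THEN spec, of i] unfolding N_def .
qed

lemma smooth_spinor_form:
  assumes P: "P \<in> chirality_operators"
  shows "smooth_map_on (C.W i) (\<lambda>p. spinor_form P i (chart_inv M i p) w w')"
proof (rule smooth_map_on_local)
  fix p assume p: "p \<in> C.W i"
  define m where "m = chart_inv M i p"
  define N where "N = chart_map M i ` (chart_dom M i \<inter> U m)"
  note N = local_chart[OF p, folded m_def, folded N_def]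
  have comp: "smooth_map_on N (\<lambda>p. components m i (chart_inv M i p) w)" for w
  proof -
    have "smooth_map_on N (\<lambda>p. \<Sum>a\<in>UNIV. (eta a * g i (chart_inv M i p) (e m a i (chart_inv M i p)) w) *\<^sub>R axis a (1::real))"
    proof (intro smooth_map_on_sum[OF N(1)] smooth_map_on_scaleR[OF N(1)] smooth_map_on_mult[OF N(1)] smooth_map_on_const)
      show "smooth_map_on N (\<lambda>p. g i (chart_inv M i p) (e m a i (chart_inv M i p)) w)" for a
        by (rule smooth_map_on_bilinear_family[where G = "\<lambda>p. g i (chart_inv M i p)" and W = "\<lambda>p. w",
              OF N(1) C.bilinear smooth_map_on_subset[OF C.smooth_G N(3)] N(5) smooth_map_on_const]) (use N(3) in auto)
    qed
    moreover have "(\<Sum>a\<in>UNIV. (eta a * g i (chart_inv M i p) (e m a i (chart_inv M i p)) w) *\<^sub>R axis a (1::real))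
        = components m i (chart_inv M i p) w" for p
      using basis_expansion[of "components m i (chart_inv M i p) w"]
      by (simp add: scalar_mult_eq_scaleR components_def frame_components_def)
    ultimately show ?thesis by simp
  qed
  have "smooth_map_on N (\<lambda>p. two_form P (\<epsilon> m (chart_inv M i p)) (components m i (chart_inv M i p) w) (components m i (chart_inv M i p) w'))"
    by (rule smooth_map_on_two_form[OF N(1) N(6) comp comp])
  then have "smooth_map_on N (\<lambda>p. spinor_form P i (chart_inv M i p) w w')"
    by (subst smooth_map_on_cong[OF N(1)]) (use N(4) spinor_form_local[OF _ _ P] in auto)
  with N(1,2) show "\<exists>T. open T \<and> p \<in> T \<and> smooth_map_on T (\<lambda>p. spinor_form P i (chart_inv M i p) w w')" by blast
qed

lemma spinor_form_parallel:
  assumes p: "p \<in> C.W i" and P: "P \<in> chirality_operators"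
  shows "((\<lambda>p. spinor_form P i (chart_inv M i p) w w') has_derivative (\<lambda>z.
      spinor_form P i (chart_inv M i p) (coord_christoffel (\<lambda>p. g i (chart_inv M i p)) p z w) w'
    + spinor_form P i (chart_inv M i p) w (coord_christoffel (\<lambda>p. g i (chart_inv M i p)) p z w'))) (at p)"
proof -
  define m where "m = chart_inv M i p"
  define N where "N = chart_map M i ` (chart_dom M i \<inter> U m)"
  note N = local_chart[OF p, folded m_def, folded N_def]
  have m: "m \<in> chart_dom M i" "chart_map M i m = p" "chart_inv M i p = m" unfolding m_def using M_inv_in[OF p] by auto
  define E where "E = (\<lambda>a p. e m a i (chart_inv M i p))"
  define \<psi> where "\<psi> = (\<lambda>p. \<epsilon> m (chart_inv M i p))"
  have E: "(E a has_derivative frechet_derivative (E a) (at p)) (at p)" for a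
    using smooth_map_on_differentiable[OF N(5,2)] by (simp add: frechet_derivative_works E_def)
  have \<psi>: "(\<psi> has_derivative frechet_derivative \<psi> (at p)) (at p)"
    using smooth_map_on_differentiable[OF N(6,2)] by (simp add: frechet_derivative_works \<psi>_def)
  have par: "frechet_derivative \<psi> (at p) z = - (spin_lift (\<lambda>a b. g i (chart_inv M i p) (E a p)
      (frechet_derivative (E b) (at p) z + coord_christoffel (\<lambda>p. g i (chart_inv M i p)) p z (E b p))) *v \<psi> p)" for z
  proof -
    have "chart_D M i (\<epsilon> m) m z + spin_connection M g (e m) i m z *v \<epsilon> m m = 0"
      by (rule spinor_parallel[OF in_U m(1)])
    then have "frechet_derivative \<psi> (at p) z + spin_connection M g (e m) i m z *v \<epsilon> m m = 0"
      unfolding chart_D_def m(2) \<psi>_def .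
    moreover have "spin_connection M g (e m) i m z = spin_lift (\<lambda>a b. g i (chart_inv M i p) (E a p)
      (frechet_derivative (E b) (at p) z + coord_christoffel (\<lambda>p. g i (chart_inv M i p)) p z (E b p)))"
      unfolding spin_connection_def spin_lift_def nabla_vec_def christoffel_M[OF m(1)] chart_D_def m(2,3) E_def ..
    ultimately show ?thesis by (simp add: \<psi>_def m(3) eq_neg_iff_add_eq_0)
  qed
  have frame: "lorentz_frame (g i (chart_inv M i p')) (\<lambda>a. E a p')" if "p' \<in> N" for p'
    unfolding E_def using N(4)[OF that] by (auto intro: lorentz_frame_e)
  have loc: "spinor_form P i (chart_inv M i p') w w' = two_form P (\<psi> p')
     (frame_components (g i (chart_inv M i p')) (\<lambda>a. E a p') w) (frame_components (g i (chart_inv M i p')) (\<lambda>a. E a p') w')"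
    if "p' \<in> N" for p' w w'
    using spinor_form_local[OF _ _ P] N(4)[OF that] by (simp add: \<psi>_def E_def components_def)
  show ?thesis unfolding loc[OF N(2)]
    by (rule has_derivative_transform_within_open[OF C.two_form_parallel[OF p N(1,2) frame E \<psi> par P] N(1,2)])
       (auto simp: loc)
qed

text \<open>The contraction with \<open>\<partial>\<^sub>u\<close> on the slice \<open>v = 0\<close>. Its derivatives along the slice are those of the
  two-form, so one slice is enough.\<close>

definition spinor_coframe where
  "spinor_coframe P u i x w = spinor_form P i (u, 0, x) (1, 0, 0) (0, 0, w)"

lemma linear_spinor_coframe:
  assumes "x \<in> chart_dom X i" shows "linear (spinor_coframe P u i x)"
proof -
  have "bilinear (spinor_form P i (u, 0, x))" by (rule spinor_form_bilinear) (simp add: assms)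
  from bilinear_radd[OF this, of _ "(0, 0, _)" "(0, 0, _)"] bilinear_rmul[OF this, of _ _ "(0, 0, _)"]
  show ?thesis unfolding spinor_coframe_def linear_iff by simp
qed

lemma smooth_spinor_coframe:
  assumes P: "P \<in> chirality_operators"
  shows "smooth_map_on (UNIV \<times> V i) (\<lambda>(u, y). spinor_coframe P u i (chart_inv X i y) w)"
proof -
  have "bounded_linear (\<lambda>p :: real \<times> (real^2). (fst p, 0 :: real, snd p))"
    by (intro bounded_linear_Pair bounded_linear_fst bounded_linear_snd bounded_linear_zero)
  from smooth_map_on_compose_affine[OF C.open_UV C.open_W this smooth_spinor_form[OF P], of i 0]
  have "smooth_map_on (UNIV \<times> V i) (\<lambda>p. spinor_form P i (chart_inv M i (fst p, 0, snd p)) (1, 0, 0) (0, 0, w))"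
    by (auto simp: zero_prod_def)
  then show ?thesis
    by (subst smooth_map_on_cong[OF C.open_UV]) (auto simp: spinor_coframe_def M_inv)
qed

lemma smooth_spinor_coframe_family:
  assumes P: "P \<in> chirality_operators"
  shows "smooth_form_family X (spinor_coframe P)"
  unfolding smooth_form_family_def is_one_form_def
proof (intro conjI allI ballI)
  show "linear (spinor_coframe P u i x)" if "x \<in> chart_dom X i" for u i x by (rule linear_spinor_coframe[OF that])
  show "spinor_coframe P u i x w = spinor_coframe P u j x (jac X i j x w)" if "x \<in> chart_dom X i \<inter> chart_dom X j" for u i j x w
    using spinor_form_jac[of "(u, 0, x)" i j P "(1, 0, 0)" "(0, 0, w)"] that
    unfolding spinor_coframe_def by (simp add: jac_M linear_0[OF linear_jac])
  show "smooth_map_on (UNIV \<times> V i) (\<lambda>(u, y). spinor_coframe P u i (chart_inv X i y) w)" for i w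
    by (rule smooth_spinor_coframe[OF P])
qed

lemma spinor_coframe_metric:
  assumes x: "x \<in> chart_dom X i"
  shows "q u i x w w' = spinor_coframe (mat 1) u i x w * spinor_coframe (mat 1) u i x w'
    + spinor_coframe volume_element u i x w * spinor_coframe volume_element u i x w'"
proof (rule orthonormal_pair_metric)
  have q: "is_riemannian X (q u)" using q by (simp add: smooth_riemannian_family_def)
  show "bilinear (q u i x)" using q x unfolding is_riemannian_def by blast
  show "q u i x v w = q u i x w v" for v w using q x unfolding is_riemannian_def by blast
  show "linear (spinor_coframe P u i x)" "linear (spinor_coframe P u i x)" for P by (rule linear_spinor_coframe[OF x])+
  show "q u i x w w = spinor_coframe (mat 1) u i x w * spinor_coframe (mat 1) u i x w
    + spinor_coframe volume_element u i x w * spinor_coframe volume_element u i x w" for w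
    using spinor_form_norm[of "(u, 0, x)" i "(0, 0, w)"] x
    by (simp add: spinor_coframe_def g_on_slice power2_eq_square)
qed

lemma spinor_coframe_det:
  assumes x: "x \<in> chart_dom X i"
  shows "coframe_det (spinor_coframe (mat 1) u i x) (spinor_coframe volume_element u i x) \<noteq> 0"
proof (rule coframe_det_of_metric[OF linear_spinor_coframe[OF x] linear_spinor_coframe[OF x]])
  fix w :: "real^2" assume "w \<noteq> 0"
  then have "q u i x w w > 0"
    using q x unfolding smooth_riemannian_family_def is_riemannian_def by blast
  then show "spinor_coframe (mat 1) u i x w * spinor_coframe (mat 1) u i x w
    + spinor_coframe volume_element u i x w * spinor_coframe volume_element u i x w > 0"
    using spinor_coframe_metric[OF x] by simp
qed

lemma spinor_coframe_orthonormal: "orthonormal_coframe X (q u) (spinor_coframe (mat 1) u) (spinor_coframe volume_element u)"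
  unfolding orthonormal_coframe_def cometric_def
proof (intro allI ballI)
  fix i x assume x: "x \<in> chart_dom X i"
  note lin = linear_spinor_coframe[OF x, of "mat 1" u] linear_spinor_coframe[OF x, of volume_element u]
  note dual = dual_vec_eval[OF lin spinor_coframe_det[OF x]]
  show "q u i x (sharp (q u) (spinor_coframe (mat 1) u) i x) (sharp (q u) (spinor_coframe (mat 1) u) i x) = 1 \<and>
    q u i x (sharp (q u) (spinor_coframe volume_element u) i x) (sharp (q u) (spinor_coframe volume_element u) i x) = 1 \<and>
    q u i x (sharp (q u) (spinor_coframe (mat 1) u) i x) (sharp (q u) (spinor_coframe volume_element u) i x) = 0"
    unfolding sharp_coframe[where q = "q u" and l = "spinor_coframe (mat 1) u" and n = "spinor_coframe volume_element u" and i = i and x = x,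
        OF lin spinor_coframe_det[OF x] spinor_coframe_metric[OF x]]
    by (simp add: spinor_coframe_metric[OF x] dual)
qed

lemma spinor_coframe_lift:
  assumes y: "y \<in> V i" and P: "P \<in> chirality_operators"
  defines "L \<equiv> \<lambda>p w. spinor_form P i (chart_inv M i p) (1, 0, 0) (0, 0, w)"
  shows "((\<lambda>p. L p w) has_derivative (\<lambda>z. L (u, v, y) (C.tangential_christoffel i u v y z w))) (at (u, v, y))"
proof -
  have p: "(u, v, y) \<in> C.W i" using y by simp
  have m: "chart_inv M i (u, v, y) \<in> chart_dom M i" using M_inv_in[OF p] by simp
  show ?thesis unfolding L_def
    by (rule C.parallel_two_form_reduces[OF y spinor_form_parallel[OF p P] spinor_form_simple[OF m P] spinor_form_null[OF m P]])
       (use spinor_form_bilinear[OF m] in \<open>simp add: bilinear_def\<close>)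
qed

lemma spinor_coframe_coord: "y \<in> V i \<Longrightarrow> spinor_form P i (chart_inv M i (u, 0, y)) (1, 0, 0) (0, 0, w) = spinor_coframe P u i (chart_inv X i y) w"
  by (simp add: spinor_coframe_def M_inv)

lemma spinor_coframe_parallel:
  assumes P: "P \<in> chirality_operators"
  shows "parallel_form X (q u) (spinor_coframe P u)"
  unfolding parallel_form_def nabla_form_def
proof (intro allI ballI)
  fix i x v w assume x: "x \<in> chart_dom X i"
  define y where "y = chart_map X i x"
  have y: "y \<in> V i" "chart_inv X i y = x" using x by (auto simp: y_def smooth_atlasD(3)[OF atlas])
  define L where "L = (\<lambda>p w. spinor_form P i (chart_inv M i p) (1, 0, 0) (0, 0, w))"
  have "chart_D X i (\<lambda>z. spinor_coframe P u i z w) x v = frechet_derivative (\<lambda>y. L (u, 0, y) w) (at y) v"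
    unfolding chart_D_def y_def[symmetric]
    by (rule fun_cong[OF frechet_derivative_cong[OF C.open_V y(1)]]) (simp add: L_def spinor_coframe_coord)
  also have "\<dots> = L (u, 0, y) (coord_christoffel (\<lambda>y. q u i (chart_inv X i y)) y v w)"
    by (rule C.parallel_on_slice[OF y(1), where L = L], unfold L_def, rule spinor_coframe_lift[OF y(1) P])
  also have "\<dots> = spinor_coframe P u i x (christoffel X (q u) i x v w)"
    unfolding L_def spinor_coframe_coord[OF y(1)] christoffel_X[OF x] y_def[symmetric] y(2) ..
  finally show "chart_D X i (\<lambda>z. spinor_coframe P u i z w) x v - spinor_coframe P u i x (christoffel X (q u) i x v w) = 0"
    by simp
qed

lemma spinor_coframe_exterior_derivative:
  assumes x: "x \<in> chart_dom X i"
  shows "ext_deriv X (\<alpha> u) i x v w =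
      wedge (dt_form (spinor_coframe volume_element) u) (spinor_coframe volume_element u) i x v w
    + wedge (dt_form (spinor_coframe (mat 1)) u) (spinor_coframe (mat 1) u) i x v w"
proof -
  define y where "y = chart_map X i x"
  have y: "y \<in> V i" "chart_inv X i y = x" using x by (auto simp: y_def smooth_atlasD(3)[OF atlas])
  define L where "L = (\<lambda>P p w. spinor_form P i (chart_inv M i p) (1, 0, 0) (0, 0, w))"
  have L: "((\<lambda>p. L P p w) has_derivative (\<lambda>z. L P (u, 0, y) (C.tangential_christoffel i u 0 y z w))) (at (u, 0, y))"
    if "P \<in> chirality_operators" for P w
    unfolding L_def by (rule spinor_coframe_lift[OF y(1) that])
  have Lx: "L P (s, 0, y) w = spinor_coframe P s i x w" for P s w
    by (simp add: L_def spinor_coframe_coord[OF y(1)] y(2))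
  have par: "mat 1 \<in> chirality_operators" "volume_element \<in> chirality_operators" by (simp_all add: chirality_operators_def)
  have "frechet_derivative (\<lambda>y. \<alpha> u i (chart_inv X i y) w) (at y) v - frechet_derivative (\<lambda>y. \<alpha> u i (chart_inv X i y) v) (at y) w
    = (deriv (\<lambda>s. L volume_element (s, 0, y) v) u * L volume_element (u, 0, y) w - deriv (\<lambda>s. L volume_element (s, 0, y) w) u * L volume_element (u, 0, y) v)
    + (deriv (\<lambda>s. L (mat 1) (s, 0, y) v) u * L (mat 1) (u, 0, y) w - deriv (\<lambda>s. L (mat 1) (s, 0, y) w) u * L (mat 1) (u, 0, y) v)"
    by (rule C.coframe_condition[OF y(1) L[OF par(1)] L[OF par(2)]]) (simp add: Lx y(2) spinor_coframe_metric[OF x])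
  then show ?thesis
    unfolding Lx ext_deriv_def wedge_def dt_form_def chart_D_def y_def[symmetric] .
qed

end

section \<open>From a parallel coframe to a parallel spinor\<close>

text \<open>A family of parallel orthonormal coframes; the equation for \<open>d\<alpha>\<close> is added below, where a spinor is
  constructed.\<close>

locale parallel_coframe = brinkmann_data X H \<alpha> q
  for X :: "('i, 'x::{t2_space,second_countable_topology}, real^2) atlas"
    and H :: "real \<Rightarrow> 'x \<Rightarrow> real" and \<alpha> :: "real \<Rightarrow> ('i, 'x, real^2) one_form"
    and q :: "real \<Rightarrow> ('i, 'x, real^2) two_tensor" +
  fixes l n :: "real \<Rightarrow> ('i, 'x, real^2) one_form"
  assumes l: "smooth_form_family X l" and n: "smooth_form_family X n"
    and par_l: "\<And>u. parallel_form X (q u) (l u)" and par_n: "\<And>u. parallel_form X (q u) (n u)"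
    and orthonormal: "\<And>u. orthonormal_coframe X (q u) (l u) (n u)"
begin

lemma linear_l: "x \<in> chart_dom X i \<Longrightarrow> linear (l u i x)" and linear_n: "x \<in> chart_dom X i \<Longrightarrow> linear (n u i x)"
  using l n unfolding smooth_form_family_def is_one_form_def by simp_all

lemma coframe_jac:
  assumes "x \<in> chart_dom X i" "x \<in> chart_dom X j"
  shows "l u i x w = l u j x (jac X i j x w)" "n u i x w = n u j x (jac X i j x w)"
    "\<alpha> u i x w = \<alpha> u j x (jac X i j x w)"
  using l[unfolded smooth_form_family_def is_one_form_def, THEN conjunct1, THEN spec, of u,
      THEN conjunct2, THEN spec, THEN spec, THEN bspec, OF IntI[OF assms]]
    n[unfolded smooth_form_family_def is_one_form_def, THEN conjunct1, THEN spec, of u,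
      THEN conjunct2, THEN spec, THEN spec, THEN bspec, OF IntI[OF assms]]
    \<alpha>[unfolded smooth_form_family_def is_one_form_def, THEN conjunct1, THEN spec, of u,
      THEN conjunct2, THEN spec, THEN spec, THEN bspec, OF IntI[OF assms]]
  by blast+

lemma riemannian:
  assumes "x \<in> chart_dom X i"
  shows "bilinear (q u i x)" "q u i x v w = q u i x w v" "v \<noteq> 0 \<Longrightarrow> q u i x v v > 0"
  using q[unfolded smooth_riemannian_family_def, THEN conjunct1, THEN spec, of u, unfolded is_riemannian_def,
      THEN conjunct1, THEN spec, THEN bspec, OF assms] by simp_all

text \<open>The vectors metrically dual to \<open>l\<close> and \<open>n\<close> exist because the metric is nondegenerate, and
  orthonormality of the coframe says that they are also its dual basis.\<close>

lemma det_nonzero_and_metric: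
  assumes x: "x \<in> chart_dom X i"
  shows "coframe_det (l u i x) (n u i x) \<noteq> 0"
    and "q u i x w w' = l u i x w * l u i x w' + n u i x w * n u i x w'"
proof -
  have nondeg: "z = 0" if "\<And>a. q u i x z a = 0" for z
    using that[of z] riemannian(3)[OF x, of z u] by force
  have sharp: "q u i x (sharp (q u) \<omega> i x) a = \<omega> i x a" if "linear (\<omega> i x)" for \<omega> a
    using theI'[OF nondegenerate_representation[OF riemannian(1)[OF x] nondeg that], THEN spec]
    unfolding sharp_def .
  let ?L = "sharp (q u) (l u) i x" and ?N = "sharp (q u) (n u) i x"
  note sl = sharp[of "l u", OF linear_l[OF x]] and sn = sharp[of "n u", OF linear_n[OF x]]
  have "q u i x ?L ?L = 1" "q u i x ?N ?N = 1" "q u i x ?L ?N = 0"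
    using orthonormal[of u] x unfolding orthonormal_coframe_def cometric_def by blast+
  then have dual: "l u i x ?L = 1" "n u i x ?N = 1" "l u i x ?N = 0" "n u i x ?L = 0"
    using riemannian(2)[OF x, of u ?N ?L] by (simp_all add: sl sn)
  show det: "coframe_det (l u i x) (n u i x) \<noteq> 0"
    by (rule coframe_det_nonzero[OF linear_l[OF x] linear_n[OF x] dual(1,4,3,2)])
  have "w - (l u i x w *\<^sub>R ?L + n u i x w *\<^sub>R ?N) = 0"
    by (rule coframe_eq_0[OF linear_l[OF x] linear_n[OF x] det])
       (simp_all add: linear_diff linear_add linear_cmul linear_l[OF x] linear_n[OF x] dual)
  then have w: "w = l u i x w *\<^sub>R ?L + n u i x w *\<^sub>R ?N" by simp
  have "q u i x w w' = q u i x (l u i x w *\<^sub>R ?L + n u i x w *\<^sub>R ?N) w'"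
    by (rule arg_cong[OF w])
  also have "\<dots> = l u i x w * l u i x w' + n u i x w * n u i x w'"
    by (simp add: bilinear_ladd[OF riemannian(1)[OF x]] bilinear_lmul[OF riemannian(1)[OF x]] sl sn)
  finally show "q u i x w w' = l u i x w * l u i x w' + n u i x w * n u i x w'" .
qed

lemma smooth_coords:
  "smooth_map_on (UNIV \<times> V i) (\<lambda>(u, y). l u i (chart_inv X i y) w)"
  "smooth_map_on (UNIV \<times> V i) (\<lambda>(u, y). n u i (chart_inv X i y) w)"
  using l n unfolding smooth_form_family_def by simp_all

lemma parallel_coords:
  assumes y: "y \<in> V i"
  shows "frechet_derivative (\<lambda>y. l u i (chart_inv X i y) w) (at y) z
      = l u i (chart_inv X i y) (coord_christoffel (\<lambda>y. q u i (chart_inv X i y)) y z w)"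
    and "frechet_derivative (\<lambda>y. n u i (chart_inv X i y) w) (at y) z
      = n u i (chart_inv X i y) (coord_christoffel (\<lambda>y. q u i (chart_inv X i y)) y z w)"
proof -
  note x = smooth_atlasD(5)[OF atlas y] and yx = smooth_atlasD(4)[OF atlas y]
  have "nabla_form X (q u) \<omega> i (chart_inv X i y) z w = 0 \<Longrightarrow> frechet_derivative (\<lambda>y. \<omega> i (chart_inv X i y) w) (at y) z
      = \<omega> i (chart_inv X i y) (coord_christoffel (\<lambda>y. q u i (chart_inv X i y)) y z w)" for \<omega>
    unfolding nabla_form_def chart_D_def christoffel_X[OF x] yx by simp
  from this[of "l u"] this[of "n u"]
  show "frechet_derivative (\<lambda>y. l u i (chart_inv X i y) w) (at y) z
      = l u i (chart_inv X i y) (coord_christoffel (\<lambda>y. q u i (chart_inv X i y)) y z w)"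
    "frechet_derivative (\<lambda>y. n u i (chart_inv X i y) w) (at y) z
      = n u i (chart_inv X i y) (coord_christoffel (\<lambda>y. q u i (chart_inv X i y)) y z w)"
    using par_l[of u] par_n[of u] x unfolding parallel_form_def by blast+
qed

lemma flat: "flat_metric X (q u)"
  unfolding flat_metric_def
proof (intro allI ballI)
  fix i x and a b c :: "real^2" assume x: "x \<in> chart_dom X i"
  define y where "y = chart_map X i x"
  have y: "y \<in> V i" "chart_inv X i y = x" using x by (auto simp: y_def smooth_atlasD(3)[OF atlas])
  note dom = smooth_atlasD(5)[OF atlas]
  have bl: "bounded_linear (\<lambda>y :: real^2. (0 :: real, y))"
    by (intro bounded_linear_Pair bounded_linear_zero bounded_linear_ident)
  have slice: "smooth_map_on (V i) (\<lambda>y. f u y)" if "smooth_map_on (UNIV \<times> V i) (\<lambda>(u, y). f u y)" for f :: "real \<Rightarrow> real^2 \<Rightarrow> real"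
    using smooth_map_on_compose_affine[OF C.open_V C.open_UV bl that, of i "(u, 0)"] by simp
  have D: "chart_D X i (\<lambda>p. christoffel X (q u) i p v w) x z
      = frechet_derivative (\<lambda>y. coord_christoffel (\<lambda>y. q u i (chart_inv X i y)) y v w) (at y) z" for v w z
    unfolding chart_D_def y_def[symmetric]
    by (rule fun_cong[OF frechet_derivative_cong[OF C.open_V y(1)]])
       (simp add: christoffel_X[OF dom] smooth_atlasD(4)[OF atlas])
  show "curvature X (q u) i x a b c = 0"
    unfolding curvature_def D christoffel_X[OF x] y_def[symmetric]
    by (rule parallel_coframe_flat[OF C.slice_metric y(1), where l = "\<lambda>y. l u i (chart_inv X i y)" and n = "\<lambda>y. n u i (chart_inv X i y)"])
       (rule linear_l linear_n dom slice[OF smooth_coords(1)] slice[OF smooth_coords(2)] parallel_coords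
          det_nonzero_and_metric(1) | assumption)+
qed


lemma coframe_det_jac:
  assumes x: "x \<in> chart_dom X i" "x \<in> chart_dom X j"
  shows "coframe_det (l u i x) (n u i x) = det (matrix (jac X i j x)) * coframe_det (l u j x) (n u j x)"
proof -
  have m: "matrix (jac X i j x) $ a $ b = jac X i j x (axis b 1) $ a" for a b
    by (simp add: matrix_def)
  show ?thesis
    unfolding coframe_det_def det_2 m coframe_jac[OF x]
      linear_real2[OF linear_l[OF x(2), of u], of "jac X i j x _"]
      linear_real2[OF linear_n[OF x(2), of u], of "jac X i j x _"]
    by (simp add: algebra_simps)
qed

lemma coframe_det_continuous:
  "continuous_on (UNIV \<times> chart_dom X i) (\<lambda>(u, x). coframe_det (l u i x) (n u i x))"
proof -
  have "smooth_map_on (UNIV \<times> V i) (\<lambda>p. coframe_det (l (fst p) i (chart_inv X i (snd p))) (n (fst p) i (chart_inv X i (snd p))))"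
    using smooth_coords[of i] unfolding coframe_det_def split_beta
    by (intro smooth_map_on_diff[OF C.open_UV] smooth_map_on_mult[OF C.open_UV]) auto
  then have F: "continuous_on (UNIV \<times> V i) (\<lambda>p. coframe_det (l (fst p) i (chart_inv X i (snd p))) (n (fst p) i (chart_inv X i (snd p))))"
    by (rule smooth_map_on_continuous)
  have "continuous_on (UNIV \<times> chart_dom X i) (\<lambda>p. (fst p, chart_map X i (snd p)))"
    by (intro continuous_intros continuous_on_compose2[OF smooth_atlasD(7)[OF atlas, of i]]) auto
  from continuous_on_compose2[OF F this] show ?thesis
    by (rule continuous_on_cong[THEN iffD1, rotated -1]) (auto simp: smooth_atlasD(3)[OF atlas])
qed

text \<open>The pairs \<open>(u, x)\<close> at which the coframe has a given orientation form an open set, and the two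
  orientations cover the connected space \<open>\<real> \<times> X\<close>. The orientation does not depend on the chart,
  because the atlas is oriented.\<close>

lemma coframe_orientation:
  assumes "oriented_atlas X" and conn: "connected (UNIV :: 'x set)"
  obtains s :: real where "s * s = 1"
    "\<And>u i x. x \<in> chart_dom X i \<Longrightarrow> s * coframe_det (l u i x) (n u i x) < 0"
proof -
  define A where "A = (\<lambda>s. \<Union>i. {(u, x). x \<in> chart_dom X i \<and> s * coframe_det (l u i x) (n u i x) < 0})"
  have op: "open (A s)" for s
    unfolding A_def
  proof (intro open_UN ballI)
    fix i
    have "continuous_on (UNIV \<times> chart_dom X i) (\<lambda>p. s * (case p of (u, x) \<Rightarrow> coframe_det (l u i x) (n u i x)))"
      by (intro continuous_intros coframe_det_continuous)
    from continuous_open_preimage[OF this open_Times[OF open_UNIV smooth_atlasD(1)[OF atlas]] open_lessThan[of 0]]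
    show "open {(u, x). x \<in> chart_dom X i \<and> s * coframe_det (l u i x) (n u i x) < 0}"
      by (rule back_subst[where P = "open"]) auto
  qed
  have same: "s * coframe_det (l u i x) (n u i x) < 0"
    if ux: "(u, x) \<in> A s" and x: "x \<in> chart_dom X i" for s u i x
  proof -
    obtain j where j: "x \<in> chart_dom X j" "s * coframe_det (l u j x) (n u j x) < 0"
      using ux unfolding A_def by auto
    have "det (matrix (jac X i j x)) > 0"
      using assms(1) x j(1) unfolding oriented_atlas_def by blast
    then have "det (matrix (jac X i j x)) * (s * coframe_det (l u j x) (n u j x)) < 0"
      using j(2) by (simp add: mult_pos_neg)
    then show ?thesis unfolding coframe_det_jac[OF x j(1)] by (simp add: mult.left_commute)
  qed
  have "connected (UNIV :: (real \<times> 'x) set)"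
    unfolding UNIV_Times_UNIV[symmetric] using conn by (simp only: connected_Times connected_UNIV simp_thms)
  moreover have "A 1 \<inter> A (-1) \<inter> UNIV = {}"
  proof -
    have False if ux: "(u, x) \<in> A 1" "(u, x) \<in> A (-1)" for u x
    proof -
      obtain i where "x \<in> chart_dom X i" using smooth_atlasD(8)[OF atlas] by blast
      from same[OF ux(1) this] same[OF ux(2) this] show False by simp
    qed
    then show ?thesis by auto
  qed
  moreover have cover: "UNIV \<subseteq> A 1 \<union> A (-1)"
  proof
    fix p :: "real \<times> 'x"
    obtain u x where p: "p = (u, x)" by (cases p)
    obtain i where i: "x \<in> chart_dom X i" using smooth_atlasD(8)[OF atlas] by blast
    have "coframe_det (l u i x) (n u i x) < 0 \<or> coframe_det (l u i x) (n u i x) > 0"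
      using det_nonzero_and_metric(1)[OF i, of u] by linarith
    then show "p \<in> A 1 \<union> A (-1)" unfolding A_def p using i by auto
  qed
  ultimately have "A 1 \<inter> UNIV = {} \<or> A (-1) \<inter> UNIV = {}"
    using op by (intro connectedD) auto
  then have "A 1 = UNIV \<or> A (-1) = UNIV" using cover by auto
  then have "\<exists>s :: real. s * s = 1 \<and> A s = UNIV"
    by (elim disjE) (rule exI[of _ 1], simp, rule exI[of _ "-1"], simp)
  then obtain s :: real where "s * s = 1" "A s = UNIV" by blast
  show ?thesis by (rule that[OF \<open>s * s = 1\<close>], rule same) (simp_all add: \<open>A s = UNIV\<close>)
qed

end

lemma mat_1_Spin_plus: "mat 1 \<in> Spin_plus"
  unfolding Spin_plus_def by (rule CollectI, rule exI[of _ "[]"]) simp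

lemma sum_mat_1:
  fixes f :: "'n::finite \<Rightarrow> 'c::real_vector"
  shows "(\<Sum>a\<in>UNIV. (mat 1 :: real^'n^'n) $ a $ b *\<^sub>R f a) = f b"
proof -
  have "(mat 1 :: real^'n^'n) $ a $ b *\<^sub>R f a = (if a = b then f a else 0)" for a
    by (simp add: mat_def)
  then show ?thesis by (simp only:) simp
qed

locale oriented_parallel_coframe = parallel_coframe X H \<alpha> q l n
  for X :: "('i, 'x::{t2_space,second_countable_topology}, real^2) atlas"
    and H :: "real \<Rightarrow> 'x \<Rightarrow> real" and \<alpha> :: "real \<Rightarrow> ('i, 'x, real^2) one_form"
    and q :: "real \<Rightarrow> ('i, 'x, real^2) two_tensor" and l n :: "real \<Rightarrow> ('i, 'x, real^2) one_form" +
  fixes s :: real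
  assumes s: "s * s = 1" "\<And>u i x. x \<in> chart_dom X i \<Longrightarrow> s * coframe_det (l u i x) (n u i x) < 0"
    and condition: "\<And>u i x v w. x \<in> chart_dom X i \<Longrightarrow> ext_deriv X (\<alpha> u) i x v w =
      wedge (dt_form n u) (n u) i x v w + wedge (dt_form l u) (l u) i x v w"
begin

definition global_frame :: "4 \<Rightarrow> ('i, real \<times> real \<times> 'x, real \<times> real \<times> (real^2)) vec_field" where
  "global_frame k i m = adapted_frame (H (fst m) (snd (snd m))) (\<alpha> (fst m) i (snd (snd m)))
     (l (fst m) i (snd (snd m))) (n (fst m) i (snd (snd m))) s k"

abbreviation E where
  "E i k p \<equiv> adapted_frame (H (fst p) (chart_inv X i (snd (snd p)))) (\<alpha> (fst p) i (chart_inv X i (snd (snd p))))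
     (l (fst p) i (chart_inv X i (snd (snd p)))) (n (fst p) i (chart_inv X i (snd (snd p)))) s k"

lemma global_frame_coord: "p \<in> C.W i \<Longrightarrow> global_frame k i (chart_inv M i p) = E i k p"
  by (cases p) (simp add: global_frame_def M_inv)

lemmas coords = smooth_coords[of i for i] linear_l[OF smooth_atlasD(5)[OF atlas]] linear_n[OF smooth_atlasD(5)[OF atlas]]
  det_nonzero_and_metric[OF smooth_atlasD(5)[OF atlas]]

lemma smooth_frame: "smooth_map_on (C.W i) (E i k)"
  by (rule C.smooth_E) (rule coords s(1) | assumption)+

text \<open>A vector of the plane is determined by the values of the coframe on it, and these do not depend on the chart.\<close>

lemma dual_vec_jac:
  assumes x: "x \<in> chart_dom X i" "x \<in> chart_dom X j"
  shows "dual_vec (l u j x) (n u j x) = jac X i j x (dual_vec (l u i x) (n u i x))"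
    "dual_vec (n u j x) (l u j x) = jac X i j x (dual_vec (n u i x) (l u i x))"
proof -
  note di = dual_vec_eval[OF linear_l[OF x(1)] linear_n[OF x(1)] det_nonzero_and_metric(1)[OF x(1)]]
  note dj = dual_vec_eval[OF linear_l[OF x(2)] linear_n[OF x(2)] det_nonzero_and_metric(1)[OF x(2)]]
  have "w - jac X i j x w' = 0" if "l u j x w = l u i x w'" "n u j x w = n u i x w'" for w w'
    by (rule coframe_eq_0[OF linear_l[OF x(2)] linear_n[OF x(2)] det_nonzero_and_metric(1)[OF x(2)], of u])
       (simp_all add: linear_diff linear_l[OF x(2)] linear_n[OF x(2)] that coframe_jac[OF x, symmetric])
  from this[of "dual_vec (l u j x) (n u j x)" "dual_vec (l u i x) (n u i x)"]
    this[of "dual_vec (n u j x) (l u j x)" "dual_vec (n u i x) (l u i x)"]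
  show "dual_vec (l u j x) (n u j x) = jac X i j x (dual_vec (l u i x) (n u i x))"
    "dual_vec (n u j x) (l u j x) = jac X i j x (dual_vec (n u i x) (l u i x))"
    by (simp_all add: di dj)
qed

lemma global_frame_jac:
  assumes "m \<in> chart_dom M i" "m \<in> chart_dom M j"
  shows "global_frame k j m = jac M i j m (global_frame k i m)"
proof -
  obtain u v x where m: "m = (u, v, x)" and x: "x \<in> chart_dom X i" "x \<in> chart_dom X j"
    using assms by (cases m) auto
  show ?thesis
    unfolding global_frame_def m
    by (simp add: adapted_frame_def jac_M[OF x] linear_0[OF linear_jac[OF x]] linear_cmul[OF linear_jac[OF x]]
        dual_vec_jac[OF x] coframe_jac(3)[OF x, symmetric])
qed

lemma global_frame_oriented: "oriented_frame_on M g UNIV global_frame"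
  unfolding oriented_frame_on_def smooth_vec_field_on_def
proof (intro conjI allI ballI)
  show "global_frame k j m = jac M i j m (global_frame k i m)"
    if "m \<in> UNIV \<inter> chart_dom M i \<inter> chart_dom M j" for k i j m
    using that by (intro global_frame_jac) auto
  show "smooth_map_on (chart_map M i ` (chart_dom M i \<inter> UNIV)) (\<lambda>p. global_frame k i (chart_inv M i p))" for k i
    unfolding Int_UNIV_right image_M
    by (subst smooth_map_on_cong[OF C.open_W global_frame_coord], assumption, rule smooth_frame)
  fix i m assume "m \<in> UNIV \<inter> chart_dom M i"
  then have m: "m \<in> chart_dom M i" by simp
  define p where "p = chart_map M i m"
  have p: "p \<in> C.W i" "chart_inv M i p = m" using m by (simp_all add: p_def M_map_in M_inv_map)
  obtain u v x where m': "m = (u, v, x)" and x: "x \<in> chart_dom X i" using m by (cases m) auto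
  show "g i m (global_frame a i m) (global_frame b i m) = (if a = b then eta a else 0)" for a b
  proof -
    have "g i (chart_inv M i p) (E i a p) (E i b p) = (if a = b then eta a else 0)"
      by (rule C.E_orthonormal) (rule coords s(1) p | assumption)+
    then show ?thesis using global_frame_coord[OF p(1)] unfolding p(2) by simp
  qed
  show "det (\<chi> a. coord_vec (global_frame a i m)) > 0"
    unfolding global_frame_def det_adapted_frame[OF det_nonzero_and_metric(1)[OF x]] m'
    using det_adapted_frame[OF det_nonzero_and_metric(1)[OF x, of u]] s(2)[OF x, of u]
    by (simp add: divide_less_0_iff mult_less_0_iff)
  show "g i m (global_frame 4 i m) d_v < 0"
    using C.G_null[OF p(1), of "global_frame 4 i m"]
    by (simp add: p(2) d_v_def global_frame_def adapted_frame_simps)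
qed

lemma trivial_spin_structure: "spin_structure M g (\<lambda>_. UNIV) (\<lambda>_. global_frame) (\<lambda>_ _ _. mat 1)"
  unfolding spin_structure_def
proof (intro conjI allI ballI)
  show "oriented_frame_on M g UNIV global_frame" by (rule global_frame_oriented)
  show "smooth_fun_on M (UNIV \<inter> UNIV) (\<lambda>_. mat 1 :: real^4^4)"
    by (simp add: smooth_fun_on_def smooth_map_on_const)
  show "mat 1 \<in> Spin_plus" by (rule mat_1_Spin_plus)
  show "\<exists>\<Lambda>::real^4^4. \<forall>b. (\<forall>i. m \<in> chart_dom M i \<longrightarrow> global_frame b i m = (\<Sum>a\<in>UNIV. \<Lambda> $ a $ b *\<^sub>R global_frame a i m)) \<and>
      mat 1 ** gamma b = (\<Sum>a\<in>UNIV. \<Lambda> $ a $ b *\<^sub>R gamma a) ** mat 1" for m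
  proof (rule exI[of _ "mat 1"], intro allI conjI impI)
    fix b i
    show "global_frame b i m = (\<Sum>a\<in>UNIV. (mat 1 :: real^4^4) $ a $ b *\<^sub>R global_frame a i m)"
      "mat 1 ** gamma b = (\<Sum>a\<in>UNIV. (mat 1 :: real^4^4) $ a $ b *\<^sub>R gamma a) ** mat 1"
      by (simp_all add: sum_mat_1)
  qed
  show "mat 1 ** mat 1 = (mat 1 :: real^4^4)" by simp
qed auto

lemma spin_connection_annihilates:
  assumes m: "m \<in> chart_dom M i"
  shows "spin_connection M g global_frame i m z *v axis 1 1 = 0"
proof -
  define p where "p = chart_map M i m"
  have p: "p \<in> C.W i" "chart_inv M i p = m" using m by (simp_all add: p_def M_map_in M_inv_map)
  have D: "chart_D M i (global_frame k i) m z = frechet_derivative (E i k) (at p) z" for k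
    unfolding chart_D_def p_def[symmetric]
    by (rule fun_cong[OF frechet_derivative_cong[OF C.open_W p(1)]]) (rule global_frame_coord)
  have fr: "global_frame k i m = E i k p" for k using global_frame_coord[OF p(1)] p(2) by simp
  have "spin_connection M g global_frame i m z = spin_lift (\<lambda>j k. g i (chart_inv M i p) (E i j p)
      (frechet_derivative (E i k) (at p) z + coord_christoffel (\<lambda>p. g i (chart_inv M i p)) p z (E i k p)))"
    unfolding spin_connection_def spin_lift_def nabla_vec_def D christoffel_M[OF m] p_def[symmetric] p(2) fr ..
  also have "\<dots> *v axis 1 1 = 0"
  proof (rule C.adapted_spinor_parallel[OF _ _ _ _ _ _ _ p(1)])
    fix u y v w assume y: "y \<in> V i"
    show "frechet_derivative (\<lambda>y. \<alpha> u i (chart_inv X i y) w) (at y) v - frechet_derivative (\<lambda>y. \<alpha> u i (chart_inv X i y) v) (at y) w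
      = (deriv (\<lambda>s. n s i (chart_inv X i y) v) u * n u i (chart_inv X i y) w - deriv (\<lambda>s. n s i (chart_inv X i y) w) u * n u i (chart_inv X i y) v)
      + (deriv (\<lambda>s. l s i (chart_inv X i y) v) u * l u i (chart_inv X i y) w - deriv (\<lambda>s. l s i (chart_inv X i y) w) u * l u i (chart_inv X i y) v)"
      using condition[OF smooth_atlasD(5)[OF atlas y], of u v w]
      unfolding ext_deriv_def wedge_def dt_form_def chart_D_def smooth_atlasD(4)[OF atlas y] .
  qed (rule coords s(1) parallel_coords | assumption)+
  finally show ?thesis .
qed

lemma admits: "admits_adapted_parallel_spinor M g"
  unfolding admits_adapted_parallel_spinor_def
proof (intro exI conjI allI ballI)
  show "spin_structure M g (\<lambda>_. UNIV) (\<lambda>_. global_frame) (\<lambda>_ _ _. mat 1)" by (rule trivial_spin_structure)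
  show "parallel_spinor M g (\<lambda>_. UNIV) (\<lambda>_. global_frame) (\<lambda>_ _ _. mat 1) (\<lambda>_ _. axis 1 1)"
    unfolding parallel_spinor_def spinor_field_def
  proof (intro conjI allI ballI)
    show "smooth_fun_on M UNIV (\<lambda>_. axis 1 1 :: real^4)" by (simp add: smooth_fun_on_def smooth_map_on_const)
    show "\<exists>p. \<exists>x\<in>UNIV. axis 1 1 \<noteq> (0 :: real^4)" by (simp add: axis_eq_0_iff)
    show "chart_D M i (\<lambda>_. axis 1 1) m z + spin_connection M g global_frame i m z *v axis 1 1 = 0"
      if "m \<in> UNIV \<inter> chart_dom M i" for i m z
      using that spin_connection_annihilates[of m i z] by (simp add: chart_D_def)
  qed simp
  fix p i m assume "m \<in> UNIV \<inter> chart_dom M i"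
  have "dirac_current global_frame (axis 1 1) i m = global_frame 1 i m + global_frame 4 i m"
    by (simp add: dirac_current_def sum_4 eta_def inner_4 gamma4_apply gamma_def matrix_vector_mult_def axis_def)
  then show "dirac_current global_frame (axis 1 1) i m = d_v"
    by (simp add: global_frame_def adapted_frame_null d_v_def)
qed

end

theorem proposition2p5:
  fixes X :: "('i, 'x::{t2_space,second_countable_topology}, real^2) atlas"
    and H :: "real \<Rightarrow> 'x \<Rightarrow> real"
    and \<alpha> :: "real \<Rightarrow> ('i, 'x, real^2) one_form"
    and q :: "real \<Rightarrow> ('i, 'x, real^2) two_tensor"
  assumes "smooth_atlas X" and "oriented_atlas X" and "connected (UNIV :: 'x set)"
    and "smooth_fun_family X H"
    and "smooth_form_family X \<alpha>"
    and "smooth_riemannian_family X q" and "\<And>u. complete_metric X (q u)"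
  shows "(admits_adapted_parallel_spinor (brinkmann_atlas X) (brinkmann_metric H \<alpha> q) \<longleftrightarrow>
      (\<exists>l n. smooth_form_family X l \<and> smooth_form_family X n \<and>
        (\<forall>u. parallel_form X (q u) (l u) \<and> parallel_form X (q u) (n u) \<and>
             orthonormal_coframe X (q u) (l u) (n u) \<and>
             (\<forall>i. \<forall>x \<in> chart_dom X i. \<forall>v w.
                ext_deriv X (\<alpha> u) i x v w =
                  wedge (dt_form n u) (n u) i x v w + wedge (dt_form l u) (l u) i x v w))))
    \<and> (admits_adapted_parallel_spinor (brinkmann_atlas X) (brinkmann_metric H \<alpha> q) \<longrightarrow>
        (\<forall>u. complete_metric X (q u) \<and> flat_metric X (q u)))"
    (is "(?spinor \<longleftrightarrow> (\<exists>l n. ?coframe l n)) \<and> (?spinor \<longrightarrow> ?flat)")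
proof -
  interpret brinkmann_data X H \<alpha> q
    by unfold_locales (rule assms)+
  have forward: "\<exists>l n. ?coframe l n" if spinor: ?spinor
  proof -
    obtain U e h \<epsilon> where "spin_structure M g U e h" "parallel_spinor M g U e h \<epsilon>"
      "\<And>p i x. x \<in> U p \<inter> chart_dom M i \<Longrightarrow> dirac_current (e p) (\<epsilon> p x) i x = d_v"
      using spinor unfolding admits_adapted_parallel_spinor_def by blast
    then interpret adapted_spinor X H \<alpha> q U e h \<epsilon> by unfold_locales
    have P: "mat 1 \<in> chirality_operators" "volume_element \<in> chirality_operators"
      by (simp_all add: chirality_operators_def)
    show ?thesis
      by (intro exI[of _ "spinor_coframe (mat 1)"] exI[of _ "spinor_coframe volume_element"] conjI allI ballI
          smooth_spinor_coframe_family spinor_coframe_parallel P spinor_coframe_orthonormal spinor_coframe_exterior_derivative)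
  qed
  have backward: "?spinor \<and> ?flat" if coframe: "?coframe l n" for l n
  proof -
    interpret parallel_coframe X H \<alpha> q l n by unfold_locales (use coframe in blast)+
    obtain s where s: "s * s = 1" "\<And>u i x. x \<in> chart_dom X i \<Longrightarrow> s * coframe_det (l u i x) (n u i x) < 0"
      using coframe_orientation[OF assms(2,3)] by blast
    interpret oriented_parallel_coframe X H \<alpha> q l n s
      by unfold_locales (use s coframe in blast)+
    show ?thesis using admits flat assms(7) by blast
  qed
  show ?thesis using forward backward by blast
qed

end
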